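(* Let $0<p\le 1$ and let $f=h+\overline{g}:\mathbb{D}\to\mathbb{C}$ be a univalent sense-preserving harmonic mapping whose dilatation $w$ belongs to $Q_{p,0}$ and satisfies $\|w\|<1$. Assume that for some $\lambda\in\partial\mathbb{D}$ the analytic function $\varphi=h+\lambda g$ is a conformal map of $\mathbb{D}$ such that $\varphi(\partial\mathbb{D})$ is a closed Jordan curve. If $d\mu(z)=|S_f(z)|^2(1-|z|^2)^{2+p}\,dA(z)$ is a vanishing $p$-Carleson measure, then $F=\log J_f\in\widetilde{\mathcal{Q}}_{p,0}$.
   Context: $\mathbb{D}$ is the unit disk and $dA$ is Lebesgue area measure. A sense-preserving locally univalent harmonic mapping $f:\mathbb{D}\to\mathbb{C}$ is written $f=h+\overline{g}$ with $h,g$ analytic in $\mathbb{D}$, $h(0)=g(0)=0$, $h'\neq 0$ in $\mathbb{D}$; its dilatation is $w=g'/h'$, an analytic function with $|w|<1$ in $\mathbb{D}$, and its Jacobian is $J_f=|h'|^2-|g'|^2>0$. Write $\|w\|=\sup_{z\in\mathbb{D}}|w(z)|$. With $\partial_z=\frac12(\partial_x-i\partial_y)$, $\partial_{\bar z}=\frac12(\partial_x+i\partial_y)$ and $F=\log J_f$, the Schwarzian derivative of $f$ is $S_f=F_{zz}-\frac12 F_z^2$; explicitly $S_f=S_h+\frac{\overline{w}}{1-|w|^2}\big(w'\frac{h''}{h'}-w''\big)-\frac32\big(\frac{w'\overline{w}}{1-|w|^2}\big)^2$, where $S_h=(h''/h')'-\frac12(h''/h')^2$. For $a\in\mathbb{D}$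 let $\varphi_a(z)=\frac{a-z}{1-\overline{a}z}$. For $0<p<\infty$: $Q_{p,0}$ is the space of analytic $u$ on $\mathbb{D}$ with $\lim_{|a|\to1^-}\int_{\mathbb{D}}|u'(z)|^2(1-|\varphi_a(z)|^2)^p\,dA(z)=0$; $\widetilde{\mathcal{Q}}_{p,0}$ is the class of smooth $G:\mathbb{D}\to\mathbb{C}$ with $\lim_{|a|\to1^-}\int_{\mathbb{D}}(|G_z(z)|+|G_{\bar z}(z)|)^2(1-|\varphi_a(z)|^2)^p\,dA(z)=0$. A positive Borel measure $\mu$ on $\mathbb{D}$ is a vanishing $p$-Carleson measure if $\sup_{a\in\mathbb{D}}\int_{\mathbb{D}}|\varphi_a'|^p\,d\mu<\infty$ and $\lim_{|a|\to1^-}\int_{\mathbb{D}}|\varphi_a'(z)|^p\,d\mu(z)=0$. *)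

theory Defs
  imports "HOL-Complex_Analysis.Complex_Analysis"
begin

definition disc_auto :: "complex \<Rightarrow> complex \<Rightarrow> complex" where
  "disc_auto a z = (a - z) / (1 - cnj a * z)"

definition tends_zero_at_boundary :: "(complex \<Rightarrow> ennreal) \<Rightarrow> bool" where
  "tends_zero_at_boundary I \<longleftrightarrow>
     (\<forall>e>0. \<exists>r<1. \<forall>a. r < cmod a \<longrightarrow> cmod a < 1 \<longrightarrow> I a < ennreal e)"

definition dz :: "(complex \<Rightarrow> complex) \<Rightarrow> complex \<Rightarrow> complex" where
  "dz G z = (frechet_derivative G (at z) 1 - \<i> * frechet_derivative G (at z) \<i>) / 2"

definition dzbar :: "(complex \<Rightarrow> complex) \<Rightarrow> complex \<Rightarrow> complex" where
  "dzbar G z = (frechet_derivative G (at z) 1 + \<i> * frechet_derivative G (at z) \<i>) / 2"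

fun wirt_iter :: "bool list \<Rightarrow> (complex \<Rightarrow> complex) \<Rightarrow> complex \<Rightarrow> complex" where
  "wirt_iter [] G = G"
| "wirt_iter (b # bs) G = (if b then dz else dzbar) (wirt_iter bs G)"

definition smooth_on :: "complex set \<Rightarrow> (complex \<Rightarrow> complex) \<Rightarrow> bool" where
  "smooth_on S G \<longleftrightarrow> (\<forall>ws. wirt_iter ws G differentiable_on S)"

definition Q_p0 :: "real \<Rightarrow> (complex \<Rightarrow> complex) \<Rightarrow> bool" where
  "Q_p0 p u \<longleftrightarrow> u holomorphic_on ball 0 1 \<and>
     tends_zero_at_boundary (\<lambda>a. \<integral>\<^sup>+ z. indicator (ball 0 1) z *
        ennreal ((cmod (deriv u z))\<^sup>2 * (1 - (cmod (disc_auto a z))\<^sup>2) powr p) \<partial>lborel)"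

definition Qt_p0 :: "real \<Rightarrow> (complex \<Rightarrow> complex) \<Rightarrow> bool" where
  "Qt_p0 p G \<longleftrightarrow> smooth_on (ball 0 1) G \<and>
     tends_zero_at_boundary (\<lambda>a. \<integral>\<^sup>+ z. indicator (ball 0 1) z *
        ennreal ((cmod (dz G z) + cmod (dzbar G z))\<^sup>2 * (1 - (cmod (disc_auto a z))\<^sup>2) powr p) \<partial>lborel)"

definition vanishing_carleson :: "real \<Rightarrow> complex measure \<Rightarrow> bool" where
  "vanishing_carleson p \<mu> \<longleftrightarrow>
     (SUP a\<in>ball 0 1. \<integral>\<^sup>+ z. ennreal ((cmod (deriv (disc_auto a) z)) powr p) \<partial>\<mu>) < \<infinity> \<and>
     tends_zero_at_boundary (\<lambda>a. \<integral>\<^sup>+ z. ennreal ((cmod (deriv (disc_auto a) z)) powr p) \<partial>\<mu>)"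

text \<open>Dilatation, Jacobian, log-Jacobian and Schwarzian of f = h + conj g.\<close>
definition dil :: "(complex \<Rightarrow> complex) \<Rightarrow> (complex \<Rightarrow> complex) \<Rightarrow> complex \<Rightarrow> complex" where
  "dil h g z = deriv g z / deriv h z"

definition jac :: "(complex \<Rightarrow> complex) \<Rightarrow> (complex \<Rightarrow> complex) \<Rightarrow> complex \<Rightarrow> real" where
  "jac h g z = (cmod (deriv h z))\<^sup>2 - (cmod (deriv g z))\<^sup>2"

definition log_jac :: "(complex \<Rightarrow> complex) \<Rightarrow> (complex \<Rightarrow> complex) \<Rightarrow> complex \<Rightarrow> real" where
  "log_jac h g z = ln (jac h g z)"

definition schwarzian :: "(complex \<Rightarrow> complex) \<Rightarrow> (complex \<Rightarrow> complex) \<Rightarrow> complex \<Rightarrow> complex" where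
  "schwarzian h g z =
     dz (dz (\<lambda>x. complex_of_real (log_jac h g x))) z
     - (dz (\<lambda>x. complex_of_real (log_jac h g x)) z)\<^sup>2 / 2"

definition jordan_boundary :: "(complex \<Rightarrow> complex) \<Rightarrow> bool" where
  "jordan_boundary \<phi> \<longleftrightarrow> (\<exists>\<Phi>. continuous_on (cball 0 1) \<Phi> \<and> (\<forall>z\<in>ball 0 1. \<Phi> z = \<phi> z) \<and>
      simple_path (\<lambda>t. \<Phi> (cis (2 * pi * t))))"

end

theory Submission
  imports Defs
begin

text \<open>
  Write \<open>\<phi> = h + \<lambda> g\<close>, \<open>y = \<phi>'' / \<phi>'\<close> and \<open>w = g' / h'\<close>. Then \<open>F\<^sub>z = y - w' A\<close> and
  \<open>S\<^sub>f = S\<^sub>\<phi> - w'' A - w'^2 B + y w' A\<close> with \<open>A\<close>, \<open>B\<close> bounded because \<open>|w|\<close> stays away from 1. So the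
  theorem is about the Riccati equation \<open>y' = S\<^sub>\<phi> + y^2 / 2\<close>: a vanishing Carleson condition on \<open>S\<^sub>\<phi>\<close> has
  to be transferred to \<open>y\<close>.

  Green's formula with the test function \<open>(r^2 - |z|^2)\<^sub>+^(2 + p) |1 - cnj a z|^(-2 p)\<close> compares the weighted
  \<open>L^2\<close> norms of an analytic function and of its derivative in both directions; in the difficult
  direction the factor produced by the Laplacian is bounded below outside a cone with vertex near \<open>a\<close>,
  and inside the cone the estimate \<open>y = o(1 / (1 - |z|))\<close> suffices. The same estimate absorbs the term
  \<open>y^2\<close>. It is obtained by following \<open>1 / y\<close> along radii: where \<open>y\<close> is not small it must be close to
  \<open>2 / (1 - |z|)\<close>, and then \<open>\<phi>'\<close> grows too fast for the bounded function \<open>\<phi>\<close>.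
\<close>

section \<open>Integration by parts on the disc\<close>

text \<open>The order of the estimates is forced. The cross term y w' A must be controlled before
  anything finer is known about y, so univalence of the shear first supplies the crude bound y =
  O(1/(1-|z|)), through a Koebe-type estimate with a non-sharp constant obtained from Schottky's
  theorem. Only then is S_phi known to satisfy a vanishing condition; the mean value property turns
  it into S_phi = o((1-|z|)^-2), which is the input of the radial argument. No integral of y is
  known to be finite beforehand. Hence Green's formula is applied with the cut-off at a radius r <
  1, with constants independent of r, and Fatou's lemma removes the cut-off. The exponent 2 + p is
  the one from which two derivatives of the weight leave p: |u'|^2 is paired with the power 2 + p of
  1 - |z|^2 and |u|^2 with the power p. The factor |1 - cnj a z|^(-2p) is the squared modulus of an
  analytic function, which keeps the Laplacian of the product explicit.\<close>

lemma integral_directional_zero: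
  fixes F :: "complex \<Rightarrow> complex"
  assumes der: "\<And>z. (F has_derivative (\<lambda>h. a z * h + b z * cnj h)) (at z)"
    and supp: "\<And>z. r < cmod z \<Longrightarrow> F z = 0"
    and bd: "\<And>z. cmod (a z) + cmod (b z) \<le> M"
    and e: "cmod e = 1"
    and int: "integrable lborel (\<lambda>z. a z * e + b z * cnj e)"
  shows "(\<integral>z. a z * e + b z * cnj e \<partial>lborel) = 0"
proof -
  define c where "c n = complex_of_real (1 / real (Suc n)) * e" for n
  \<comment> \<open>Difference quotients in direction e with step 1/(n+1): translation invariance
    makes each integral zero, and dominated convergence passes to the directional
    derivative.\<close>
  define s where "s n z = (F (z + c n) - F z) * of_nat (Suc n)" for n z
  have cn: "cmod (c n) = 1 / real (Suc n)" for n
    by (simp add: c_def norm_mult e norm_divide del: of_nat_Suc)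
  have cont: "continuous_on UNIV F"
    using der has_derivative_continuous continuous_at_imp_continuous_on by blast
  have F_int: "integrable lborel F"
  proof -
    have "integrable lborel (\<lambda>x. indicator (cball 0 r) x *\<^sub>R F x)"
      by (rule borel_integrable_compact) (auto intro: continuous_on_subset[OF cont])
    moreover have "(\<lambda>x. indicator (cball 0 r) x *\<^sub>R F x) = F"
      using supp by (auto simp: indicator_def fun_eq_iff)
    ultimately show ?thesis by simp
  qed
  have F_int': "integrable lborel (\<lambda>z. F (z + k))" and F_tr: "(\<integral>z. F (z + k) \<partial>lborel) = (\<integral>z. F z \<partial>lborel)" for k
  proof -
    have "distr lborel borel ((+) k) = lborel" by (rule lborel_distr_plus)
    moreover have "integrable (distr lborel borel ((+) k)) F"
      by (subst lborel_distr_plus) (rule F_int)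
    moreover have "F \<in> borel_measurable borel" using cont by (rule borel_measurable_continuous_onI)
    ultimately show "integrable lborel (\<lambda>z. F (z + k))" "(\<integral>z. F (z + k) \<partial>lborel) = (\<integral>z. F z \<partial>lborel)"
      using integral_distr[of "(+) k" lborel borel F] integrable_distr_eq[of "(+) k" lborel borel F]
      by (auto simp: add.commute)
  qed
  have s0: "(\<integral>z. s n z \<partial>lborel) = 0" for n
    unfolding s_def using F_int F_int' F_tr by simp
  have M0: "M \<ge> 0" using bd[of 0] by (smt (verit) norm_ge_zero)
  have lim: "(\<lambda>n. s n z) \<longlonglongrightarrow> a z * e + b z * cnj e" for z
  proof -
    have v: "((\<lambda>t. F (z + of_real t * e)) has_vector_derivative a z * e + b z * cnj e) (at 0)"
    proof -
      have 1: "((\<lambda>t::real. z + of_real t * e) has_derivative (\<lambda>t. of_real t * e)) (at 0)"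
        by (auto intro!: derivative_eq_intros)
      have 2: "(F has_derivative (\<lambda>h. a z * h + b z * cnj h)) (at (z + of_real 0 * e))"
        using der[of z] by simp
      show ?thesis unfolding has_vector_derivative_def
        by (rule has_derivative_eq_rhs[OF has_derivative_compose[OF 1 2]])
           (auto simp: fun_eq_iff algebra_simps scaleR_conv_of_real)
    qed
    have X: "filterlim (\<lambda>n. 1 / real (Suc n)) (at 0) sequentially"
      using LIMSEQ_inverse_real_of_nat by (simp add: filterlim_at inverse_eq_divide del: of_nat_Suc)
    have "((\<lambda>t. cmod (F (z + of_real (0 + t) * e) - F (z + of_real 0 * e) - t *\<^sub>R (a z * e + b z * cnj e)) / norm t) \<longlongrightarrow> 0) (at 0)"
      using v unfolding has_vector_derivative_def has_derivative_at by blast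
    from filterlim_compose[OF this X]
    have 3: "(\<lambda>n. cmod (F (z + c n) - F z - (1 / real (Suc n)) *\<^sub>R (a z * e + b z * cnj e)) / (1 / real (Suc n))) \<longlonglongrightarrow> 0"
      by (simp add: c_def del: of_nat_Suc)
    have 4: "cmod (F (z + c n) - F z - (1 / real (Suc n)) *\<^sub>R (a z * e + b z * cnj e)) / (1 / real (Suc n))
       = cmod (s n z - (a z * e + b z * cnj e))" for n
    proof -
      have "s n z - (a z * e + b z * cnj e) = (F (z + c n) - F z - (1 / real (Suc n)) *\<^sub>R (a z * e + b z * cnj e)) * of_nat (Suc n)"
        by (simp add: s_def scaleR_conv_of_real field_simps del: of_nat_Suc)
      then have "cmod (s n z - (a z * e + b z * cnj e)) = cmod (F (z + c n) - F z - (1 / real (Suc n)) *\<^sub>R (a z * e + b z * cnj e)) * real (Suc n)"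
        by (metis norm_mult norm_of_nat)
      then show ?thesis by (simp del: of_nat_Suc)
    qed
    show ?thesis using 3 unfolding 4 by (simp add: tendsto_norm_zero_iff LIM_zero_iff)
  qed
  \<comment> \<open>M is a Lipschitz constant for F, so it bounds every quotient; the steps have
    length at most 1, so all supports lie in radius |r| + 1.\<close>
  have bound: "cmod (s n z) \<le> M * indicator (cball 0 (\<bar>r\<bar> + 1)) z" for n z
  proof (cases "cmod z \<le> \<bar>r\<bar> + 1")
    case True
    have "cmod (F (z + c n) - F z) \<le> M * cmod (z + c n - z)"
    proof (rule differentiable_bound[of UNIV])
      fix x :: complex
      show "(F has_derivative (\<lambda>h. a x * h + b x * cnj h)) (at x within UNIV)" using der by simp
      show "onorm (\<lambda>h. a x * h + b x * cnj h) \<le> M"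
      proof (rule onorm_le)
        fix h
        have "cmod (a x * h + b x * cnj h) \<le> (cmod (a x) + cmod (b x)) * cmod h"
          by (rule order_trans[OF norm_triangle_ineq]) (simp add: norm_mult algebra_simps)
        also have "\<dots> \<le> M * cmod h" by (rule mult_right_mono[OF bd]) simp
        finally show "cmod (a x * h + b x * cnj h) \<le> M * cmod h" .
      qed
    qed auto
    then have "cmod (F (z + c n) - F z) * real (Suc n) \<le> M"
      by (simp add: cn field_simps del: of_nat_Suc)
    then show ?thesis using True by (simp add: s_def norm_mult del: of_nat_Suc)
  next
    case False
    have "cmod z - cmod (c n) \<le> cmod (z + c n)" by (metis norm_diff_ineq)
    moreover have "cmod (c n) \<le> 1" by (simp add: cn)
    ultimately have "F (z + c n) = 0" "F z = 0" using False supp by auto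
    then show ?thesis using M0 by (simp add: s_def)
  qed
  have "(\<lambda>n. \<integral>z. s n z \<partial>lborel) \<longlonglongrightarrow> (\<integral>z. a z * e + b z * cnj e \<partial>lborel)"
  proof (rule integral_dominated_convergence)
    show "(\<lambda>z. a z * e + b z * cnj e) \<in> borel_measurable lborel" using int by simp
    show "s n \<in> borel_measurable lborel" for n
      unfolding s_def using F_int F_int' by (auto intro!: borel_measurable_times borel_measurable_diff)
    show "integrable lborel (\<lambda>z. M * indicator (cball 0 (\<bar>r\<bar> + 1)) z)"
      by (intro integrable_mult_right integrable_real_indicator) (use emeasure_lborel_cball_finite in auto)
  qed (use lim bound in auto)
  then show ?thesis using s0 by (simp add: LIMSEQ_const_iff)
qed

text \<open>The direction 1 shows that the sum of the integrals of a and b vanishes, the direction i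
  that their difference does.\<close>

lemma integral_wirtinger_zero:
  fixes F :: "complex \<Rightarrow> complex"
  assumes der: "\<And>z. (F has_derivative (\<lambda>h. a z * h + b z * cnj h)) (at z)"
    and supp: "\<And>z. r < cmod z \<Longrightarrow> F z = 0"
    and bd: "\<And>z. cmod (a z) + cmod (b z) \<le> M"
    and a: "integrable lborel a" and b: "integrable lborel b"
  shows "(\<integral>z. a z \<partial>lborel) = 0"
proof -
  have "(\<integral>z. a z * 1 + b z * cnj 1 \<partial>lborel) = 0"
    by (rule integral_directional_zero[OF der supp bd]) (use a b in auto)
  then have 1: "(\<integral>z. a z \<partial>lborel) + (\<integral>z. b z \<partial>lborel) = 0" using a b by simp
  have "(\<integral>z. a z * \<i> + b z * cnj \<i> \<partial>lborel) = 0"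
    by (rule integral_directional_zero[OF der supp bd]) (use a b in auto)
  then have 2: "(\<integral>z. a z \<partial>lborel) * \<i> - (\<integral>z. b z \<partial>lborel) * \<i> = 0" using a b by simp
  then have "(\<integral>z. a z \<partial>lborel) = (\<integral>z. b z \<partial>lborel)" by (metis complex_i_not_zero eq_iff_diff_eq_0 mult_cancel_right)
  with 1 show ?thesis by simp
qed

text \<open>At 0 the difference quotient is at most |h|^(q-1), which tends to 0 because q > 1. This
  is what lets the cut-off weight be differentiated across its boundary circle.\<close>

lemma has_real_derivative_max_powr:
  fixes q x :: real
  assumes "1 < q"
  shows "((\<lambda>x. max 0 x powr q) has_real_derivative q * max 0 x powr (q - 1)) (at x)"
proof -
  consider "x > 0" | "x < 0" | "x = 0" by linarith
  then show ?thesis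
  proof cases
    case 1
    have "((\<lambda>x. x powr q) has_real_derivative q * x powr (q - 1)) (at x)"
      by (rule has_real_derivative_powr[OF 1])
    moreover have "eventually (\<lambda>y. y powr q = max 0 y powr q) (nhds x)"
      using eventually_nhds_in_open[of "{0<..}" x] 1 by (auto elim!: eventually_mono)
    ultimately show ?thesis using 1 DERIV_cong_ev[of x x "\<lambda>x. x powr q" "\<lambda>x. max 0 x powr q" "q * x powr (q - 1)" "q * max 0 x powr (q - 1)"]
      by (auto simp: max_def)
  next
    case 2
    have "((\<lambda>x. 0) has_real_derivative 0) (at x)" by simp
    moreover have "eventually (\<lambda>y. 0 = max 0 y powr q) (nhds x)"
      using eventually_nhds_in_open[of "{..<0}" x] 2 by (auto elim!: eventually_mono)
    ultimately show ?thesis using 2 DERIV_cong_ev[of x x "\<lambda>x. 0" "\<lambda>x. max 0 x powr q" 0 "q * max 0 x powr (q - 1)"]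
      by (auto simp: max_def)
  next
    case 3
    have "((\<lambda>h. \<bar>h\<bar> powr (q - 1)) \<longlongrightarrow> 0) (at (0::real))"
    proof -
      have "((\<lambda>h. \<bar>h\<bar> powr (q - 1)) \<longlongrightarrow> \<bar>0\<bar> powr (q - 1)) (at (0::real))"
        by (rule tendsto_powr') (use assms in \<open>auto intro!: tendsto_eq_intros\<close>)
      then show ?thesis using assms by simp
    qed
    moreover have "norm (max 0 h powr q / h) \<le> \<bar>h\<bar> powr (q - 1)" for h :: real
    proof (cases "h > 0")
      case True
      then show ?thesis by (simp add: powr_diff)
    next
      case False
      then have "max 0 h = 0" by simp
      then show ?thesis by simp
    qed
    ultimately have "((\<lambda>h. max 0 h powr q / h) \<longlongrightarrow> 0) (at 0)"
      by (intro Lim_null_comparison[of "\<lambda>h. max 0 h powr q / h"]) auto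
    then show ?thesis using 3 assms by (simp add: DERIV_def)
  qed
qed

text \<open>For 0 < r < 1 it vanishes outside the disc of radius r. A function analytic only in the
  unit disc therefore becomes compactly supported on the whole plane once multiplied by a positive
  power of it, whatever its values outside the disc are.\<close>

definition bump :: "real \<Rightarrow> complex \<Rightarrow> real" where
  "bump r z = max 0 (r\<^sup>2 - (cmod z)\<^sup>2)"

lemma bump_nonneg: "0 \<le> bump r z" by (simp add: bump_def)

lemma bump_eq_0: "0 \<le> r \<Longrightarrow> r \<le> cmod z \<Longrightarrow> bump r z = 0"
  by (simp add: bump_def max_def power_mono)

lemma continuous_on_bump_powr: "0 < q \<Longrightarrow> continuous_on S (\<lambda>z. bump r z powr q)"
  unfolding bump_def by (intro continuous_on_powr' continuous_intros) auto

lemma has_derivative_bump_powr: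
  assumes "1 < q"
  shows "((\<lambda>z. complex_of_real (bump r z powr q)) has_derivative
     (\<lambda>h. of_real (q * bump r z powr (q - 1)) * (- (cnj z * h) - z * cnj h))) (at z)"
proof -
  have 1: "((\<lambda>z. r\<^sup>2 - (cmod z)\<^sup>2) has_derivative (\<lambda>h. - 2 * (z \<bullet> h))) (at z)"
    by (auto intro!: derivative_eq_intros simp: power2_norm_eq_inner inner_commute)
  have 2: "((\<lambda>x. max 0 x powr q) has_derivative (*) (q * max 0 (r\<^sup>2 - (cmod z)\<^sup>2) powr (q - 1))) (at (r\<^sup>2 - (cmod z)\<^sup>2))"
    using has_real_derivative_max_powr[OF assms] by (simp add: has_field_derivative_def)
  have eq: "complex_of_real (- 2 * (z \<bullet> h)) = - (cnj z * h) - z * cnj h" for h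
    by (simp add: complex_eq_iff inner_complex_def algebra_simps)
  show ?thesis
    unfolding bump_def
    by (rule has_derivative_eq_rhs[OF has_derivative_of_real[OF has_derivative_compose[OF 1 2]]])
      (simp only: of_real_mult flip: eq)
qed

lemma continuous_on_imp_integrable_lborel:
  fixes f :: "complex \<Rightarrow> 'b::{banach, second_countable_topology}"
  assumes "continuous_on (cball 0 r) f" "\<And>z. r < cmod z \<Longrightarrow> f z = 0"
  shows "integrable lborel f"
proof -
  have "integrable lborel (\<lambda>x. indicator (cball 0 r) x *\<^sub>R f x)"
    by (rule borel_integrable_compact) (use assms in auto)
  moreover have "(\<lambda>x. indicator (cball 0 r) x *\<^sub>R f x) = f"
    using assms(2) by (auto simp: indicator_def fun_eq_iff)
  ultimately show ?thesis by simp
qed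

text \<open>The integrand is the z-derivative of A cnj(B) bump^q; \<open>b\<close> in the proof is
  the zbar-derivative. With q > 1 the product is differentiable also on the circle |z| = r.\<close>

lemma integral_bump_by_parts:
  assumes A: "A holomorphic_on ball 0 1" and B: "B holomorphic_on ball 0 1"
    and r: "0 < r" "r < 1" and q: "1 < q"
  shows "integrable lborel (\<lambda>z. deriv A z * cnj (B z) * of_real (bump r z powr q)
            - q * (cnj z * A z * cnj (B z) * of_real (bump r z powr (q - 1))))"
    and "(\<integral>z. deriv A z * cnj (B z) * of_real (bump r z powr q)
            - q * (cnj z * A z * cnj (B z) * of_real (bump r z powr (q - 1))) \<partial>lborel) = 0"
proof -
  define a where "a z = deriv A z * cnj (B z) * of_real (bump r z powr q)
            - q * (cnj z * A z * cnj (B z) * of_real (bump r z powr (q - 1)))" for z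
  define b where "b z = A z * cnj (deriv B z) * of_real (bump r z powr q)
            - q * (z * A z * cnj (B z) * of_real (bump r z powr (q - 1)))" for z
  let ?F = "\<lambda>z. A z * cnj (B z) * of_real (bump r z powr q)"
  have sub: "cball 0 r \<subseteq> ball (0::complex) 1" using r by auto
  have hol: "deriv A holomorphic_on ball 0 1" "deriv B holomorphic_on ball 0 1"
    using A B by (auto intro: holomorphic_deriv)
  have c: "continuous_on (cball 0 r) A" "continuous_on (cball 0 r) B"
    "continuous_on (cball 0 r) (deriv A)" "continuous_on (cball 0 r) (deriv B)"
    using A B hol sub by (auto intro: holomorphic_on_imp_continuous_on continuous_on_subset)
  have ca: "continuous_on (cball 0 r) a" and cb: "continuous_on (cball 0 r) b"
    unfolding a_def b_def using q c
    by (auto intro!: continuous_intros continuous_on_bump_powr)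
  have z0: "a z = 0" "b z = 0" "?F z = 0" if "r < cmod z" for z
    using that r by (auto simp: a_def b_def bump_eq_0)
  have ia: "integrable lborel a" by (rule continuous_on_imp_integrable_lborel[OF ca z0(1)])
  have ib: "integrable lborel b" by (rule continuous_on_imp_integrable_lborel[OF cb z0(2)])
  have "compact ((\<lambda>z. cmod (a z) + cmod (b z)) ` cball 0 r)"
    by (intro compact_continuous_image continuous_intros ca cb) auto
  then obtain M where M: "\<And>z. z \<in> cball 0 r \<Longrightarrow> cmod (a z) + cmod (b z) \<le> M"
    by (meson bdd_above.E bounded_imp_bdd_above compact_imp_bounded imageI)
  have bd: "cmod (a z) + cmod (b z) \<le> max 0 M" for z
    using M[of z] z0[of z] by (cases "cmod z \<le> r") auto
  have der: "(?F has_derivative (\<lambda>h. a z * h + b z * cnj h)) (at z)" for z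
  proof (cases "cmod z < 1")
    case True
    have dA: "(A has_derivative (*) (deriv A z)) (at z)" and dB: "(B has_derivative (*) (deriv B z)) (at z)"
      using A B True holomorphic_derivI[of _ "ball 0 1" z]
      by (auto simp: has_field_derivative_def)
    show ?thesis
      by (rule has_derivative_eq_rhs[OF has_derivative_mult[OF has_derivative_mult[OF dA has_derivative_cnj[OF dB]] has_derivative_bump_powr[OF q]]])
         (auto simp: a_def b_def fun_eq_iff algebra_simps)
  next
    \<comment> \<open>A and B need not be differentiable here, but the product is zero on the open
      complement of \<open>cball 0 r\<close>.\<close>
    case False
    then have z: "r < cmod z" using r by auto
    have "((\<lambda>z. 0) has_derivative (\<lambda>h. 0)) (at z)" by simp
    then have "(?F has_derivative (\<lambda>h. 0)) (at z)"
      by (rule has_derivative_transform_within_open[of _ _ _ _ "- cball 0 r"]) (use z z0 in auto)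
    moreover have "(\<lambda>h. a z * h + b z * cnj h) = (\<lambda>h. 0)" using z0 z by auto
    ultimately show ?thesis by simp
  qed
  have "(\<integral>z. a z \<partial>lborel) = 0"
    by (rule integral_wirtinger_zero[OF der z0(3) bd ia ib])
  then show "(\<integral>z. deriv A z * cnj (B z) * of_real (bump r z powr q)
            - q * (cnj z * A z * cnj (B z) * of_real (bump r z powr (q - 1))) \<partial>lborel) = 0"
    by (simp only: a_def)
  show "integrable lborel (\<lambda>z. deriv A z * cnj (B z) * of_real (bump r z powr q)
            - q * (cnj z * A z * cnj (B z) * of_real (bump r z powr (q - 1))))"
    using ia unfolding a_def[abs_def] .
qed

text \<open>Green's second identity. With Psi = |K|^2 bump^q, \<open>G\<close> is |u|^2 Psi_zzbar -
  |u'|^2 Psi, where |u'|^2 is the mixed derivative of |u|^2. Expanding Psi_zzbar with K' = k K gives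
  the bracket. One integration by parts uses the exponent q - 1, which exceeds 1 because q >
  2.\<close>

lemma green_identity:
  fixes u K k :: "complex \<Rightarrow> complex"
  assumes u: "u holomorphic_on ball 0 1" and K: "K holomorphic_on ball 0 1"
    and k: "\<And>z. z \<in> ball 0 1 \<Longrightarrow> deriv K z = k z * K z"
    and r: "0 < r" "r < 1" and q: "2 < q"
  defines "G \<equiv> \<lambda>z. (cmod (u z))\<^sup>2 * (cmod (K z))\<^sup>2 * bump r z powr (q - 2) *
       ((bump r z)\<^sup>2 * (cmod (k z))\<^sup>2 - q * bump r z * (1 + 2 * Re (z * k z)) + q * (q - 1) * (cmod z)\<^sup>2)
     - (cmod (deriv u z))\<^sup>2 * (cmod (K z))\<^sup>2 * bump r z powr q"
  shows "integrable lborel G" and "(\<integral>z. G z \<partial>lborel) = 0"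
proof -
  \<comment> \<open>With Psi = |K|^2 bump^q, \<open>f1\<close> - q \<open>f2\<close> is the
    z-derivative of |u|^2 Psi_zbar, and cnj \<open>f3\<close> is the zbar-derivative of cnj(u) u'
    Psi. The mixed terms cancel in the difference.\<close>
  define f1 where "f1 z = deriv (\<lambda>z. u z * K z) z * cnj (u z * deriv K z) * of_real (bump r z powr q)
            - q * (cnj z * (u z * K z) * cnj (u z * deriv K z) * of_real (bump r z powr (q - 1)))" for z
  define f2 where "f2 z = deriv (\<lambda>z. z * u z * K z) z * cnj (u z * K z) * of_real (bump r z powr (q - 1))
            - of_real (q - 1) * (cnj z * (z * u z * K z) * cnj (u z * K z) * of_real (bump r z powr (q - 1 - 1)))" for z
  define f3 where "f3 z = deriv (\<lambda>z. u z * K z) z * cnj (deriv u z * K z) * of_real (bump r z powr q)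
            - q * (cnj z * (u z * K z) * cnj (deriv u z * K z) * of_real (bump r z powr (q - 1)))" for z
  have hol: "(\<lambda>z. u z * K z) holomorphic_on ball 0 1" "(\<lambda>z. z * u z * K z) holomorphic_on ball 0 1"
    "(\<lambda>z. u z * deriv K z) holomorphic_on ball 0 1" "(\<lambda>z. deriv u z * K z) holomorphic_on ball 0 1"
    using u K by (auto intro!: holomorphic_intros)
  have 1: "integrable lborel f1" "(\<integral>z. f1 z \<partial>lborel) = 0"
    using integral_bump_by_parts[OF hol(1,3) r, of q] q unfolding f1_def[abs_def] by auto
  have 2: "integrable lborel f2" "(\<integral>z. f2 z \<partial>lborel) = 0"
    using integral_bump_by_parts[OF hol(2,1) r, of "q - 1"] q unfolding f2_def[abs_def] by auto
  have 3: "integrable lborel f3" "(\<integral>z. f3 z \<partial>lborel) = 0"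
    using integral_bump_by_parts[OF hol(1,4) r, of q] q unfolding f3_def[abs_def] by auto
  have eq: "complex_of_real (G z) = f1 z - q * f2 z - cnj (f3 z)" for z
  proof (cases "cmod z < 1")
    case True
    have d: "(u has_field_derivative deriv u z) (at z)" "(K has_field_derivative k z * K z) (at z)"
      using u K True k[of z] holomorphic_derivI[of _ "ball 0 1" z] by force+
    have d1: "deriv (\<lambda>z. u z * K z) z = deriv u z * K z + u z * (k z * K z)"
      by (rule DERIV_imp_deriv) (auto intro!: derivative_eq_intros d)
    have d2: "deriv (\<lambda>z. z * u z * K z) z = u z * K z + z * (deriv u z * K z) + z * u z * (k z * K z)"
      by (rule DERIV_imp_deriv) (auto intro!: derivative_eq_intros d simp: algebra_simps)
    have dK: "deriv K z = k z * K z" using k True by simp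
    have R: "bump r z powr q = bump r z powr (q - 2) * (bump r z)\<^sup>2"
        "bump r z powr (q - 1) = bump r z powr (q - 2) * bump r z" "q - 1 - 1 = q - 2"
    proof -
      have "bump r z powr (q - 2 + 2) = bump r z powr (q - 2) * bump r z powr 2"
        "bump r z powr (q - 2 + 1) = bump r z powr (q - 2) * bump r z powr 1"
        by (rule powr_add)+
      then show "bump r z powr q = bump r z powr (q - 2) * (bump r z)\<^sup>2"
        "bump r z powr (q - 1) = bump r z powr (q - 2) * bump r z" "q - 1 - 1 = q - 2"
        using bump_nonneg[of r z] by (simp_all add: algebra_simps)
    qed
    have Re2: "complex_of_real 2 * complex_of_real (Re w) = w + cnj w" for w by (simp add: complex_eq_iff)
    have sq: "complex_of_real ((cmod w)\<^sup>2) = w * cnj w" for w by (rule complex_norm_square)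
    have sqb: "complex_of_real ((bump r z)\<^sup>2) = of_real (bump r z) * of_real (bump r z)" by (simp add: power2_eq_square)
    show ?thesis
      unfolding G_def f1_def f2_def f3_def d1 d2 dK R
      by (simp only: of_real_mult of_real_add of_real_diff of_real_1 sq sqb Re2
           complex_cnj_mult complex_cnj_add complex_cnj_diff complex_cnj_complex_of_real complex_cnj_cnj)
        (simp add: algebra_simps)
  next
    case False
    then have "bump r z = 0" using r by (intro bump_eq_0) auto
    then show ?thesis using q by (simp add: G_def f1_def f2_def f3_def)
  qed
  have int: "integrable lborel (\<lambda>z. f1 z - q * f2 z - cnj (f3 z))"
    using 1 2 3 by auto
  then have "integrable lborel (\<lambda>z. complex_of_real (G z))" by (simp only: eq)
  then show iG: "integrable lborel G" by (simp only: complex_of_real_integrable_eq)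
  have "complex_of_real (\<integral>z. G z \<partial>lborel) = (\<integral>z. f1 z - q * f2 z - cnj (f3 z) \<partial>lborel)"
    by (simp only: integral_complex_of_real[symmetric] eq)
  also have "\<dots> = 0"
    using 1 2 3 by simp
  finally show "(\<integral>z. G z \<partial>lborel) = 0" by simp
qed

text \<open>Write G(z) = G(0) + z H(z) with H analytic. Integrating by parts with cnj(H) bump^2
  shows that z H contributes nothing.\<close>

lemma integral_bump_mean_value:
  assumes G: "G holomorphic_on ball 0 1" and r: "0 < r" "r < 1"
  shows "integrable lborel (\<lambda>z. G z * of_real (bump r z))"
    and "(\<integral>z. G z * of_real (bump r z) \<partial>lborel) = G 0 * of_real (\<integral>z. bump r z \<partial>lborel)"
proof -
  define H where "H z = (if z = 0 then deriv G 0 else (G z - G 0) / (z - 0))" for z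
  have H: "H holomorphic_on ball 0 1"
    unfolding H_def by (rule pole_lemma_open[OF G]) auto
  have zH: "G z = G 0 + z * H z" for z by (simp add: H_def)
  have 1: "integrable lborel (\<lambda>z. - 2 * (cnj z * cnj (H z) * of_real (bump r z)))"
     "(\<integral>z. - 2 * (cnj z * cnj (H z) * of_real (bump r z)) \<partial>lborel) = 0"
    using integral_bump_by_parts[of "\<lambda>_. 1" H r 2] H r bump_nonneg[of r] by auto
  have i1: "integrable lborel (\<lambda>z. cnj (cnj z * cnj (H z) * of_real (bump r z)))"
  proof -
    have "integrable lborel (\<lambda>z. - (1/2) * (- 2 * (cnj z * cnj (H z) * of_real (bump r z))))"
      by (rule integrable_mult_right) (use 1(1) in simp)
    then show ?thesis by (intro integrable_bounded_linear[OF bounded_linear_cnj]) simp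
  qed
  have "(\<integral>z. cnj (cnj z * cnj (H z) * of_real (bump r z)) \<partial>lborel) = 0"
    using 1(2) by (subst Bochner_Integration.integral_cnj) simp
  then have 2: "integrable lborel (\<lambda>z. z * H z * of_real (bump r z))" "(\<integral>z. z * H z * of_real (bump r z) \<partial>lborel) = 0"
    using i1 by simp_all
  have "continuous_on (cball 0 r) (\<lambda>z. bump r z)" unfolding bump_def by (intro continuous_intros)
  then have 3: "integrable lborel (bump r)"
    by (rule continuous_on_imp_integrable_lborel) (use r in \<open>auto intro: bump_eq_0\<close>)
  have eq: "G z * of_real (bump r z) = G 0 * of_real (bump r z) + z * H z * of_real (bump r z)" for z
    by (subst zH) (simp add: algebra_simps)
  show "integrable lborel (\<lambda>z. G z * of_real (bump r z))"
    unfolding eq using 2 3 by (intro Bochner_Integration.integrable_add integrable_mult_right) auto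
  show "(\<integral>z. G z * of_real (bump r z) \<partial>lborel) = G 0 * of_real (\<integral>z. bump r z \<partial>lborel)"
    unfolding eq using 2 3 by (subst Bochner_Integration.integral_add) auto
qed

section \<open>Vanishing Carleson conditions\<close>

text \<open>If the integral of H is infinite there is nothing to prove; otherwise G + H dominates P,
  so P is integrable and G drops out. Integrability of P is thus a by-product and not an
  assumption.\<close>

lemma nn_integral_le_if_integral_zero:
  fixes G P H :: "'a \<Rightarrow> real"
  assumes G: "integrable M G" "(\<integral>z. G z \<partial>M) = 0"
    and P: "P \<in> borel_measurable M" "\<And>z. 0 \<le> P z"
    and H: "H \<in> borel_measurable M" "\<And>z. 0 \<le> H z"
    and le: "\<And>z. P z \<le> G z + H z"
  shows "(\<integral>\<^sup>+ z. ennreal (P z) \<partial>M) \<le> (\<integral>\<^sup>+ z. ennreal (H z) \<partial>M)"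
proof (cases "(\<integral>\<^sup>+ z. ennreal (H z) \<partial>M) = \<infinity>")
  case False
  then have iH: "integrable M H"
    using H by (intro integrableI_nonneg) (auto simp: less_top)
  have iP: "integrable M P"
    by (rule Bochner_Integration.integrable_bound[of M "\<lambda>z. G z + H z"])
      (use G iH P le in \<open>auto intro: order_trans[OF _ abs_ge_self]\<close>)
  have "(\<integral>z. P z \<partial>M) \<le> (\<integral>z. G z + H z \<partial>M)"
    by (rule integral_mono) (use iP iH G le in auto)
  also have "\<dots> = (\<integral>z. H z \<partial>M)" using G iH by simp
  finally show ?thesis
    using iP iH P H by (simp add: nn_integral_eq_integral integral_nonneg_AE)
qed simp

lemma bump_le: "r < 1 \<Longrightarrow> 0 < r \<Longrightarrow> z \<in> ball 0 1 \<Longrightarrow> bump r z \<le> 1 - (cmod z)\<^sup>2"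
  by (auto simp: bump_def power_le_one_iff abs_square_le_1)

text \<open>Fatou's lemma along r = 1 - 1/(n+2): a bound uniform in r survives the removal of the
  cut-off.\<close>

lemma nn_integral_bump_limit:
  assumes f: "continuous_on (ball 0 1) f" "\<And>z. z \<in> ball 0 1 \<Longrightarrow> 0 \<le> f z" and q: "0 < q"
    and B: "\<And>r. 0 < r \<Longrightarrow> r < 1 \<Longrightarrow> (\<integral>\<^sup>+ z. ennreal (f z * bump r z powr q) \<partial>lborel) \<le> B"
  shows "(\<integral>\<^sup>+ z. indicator (ball 0 1) z * ennreal (f z * (1 - (cmod z)\<^sup>2) powr q) \<partial>lborel) \<le> B"
proof -
  define r where "r n = 1 - 1 / real (n + 2)" for n
  have r: "0 < r n" "r n < 1" for n by (auto simp: r_def field_simps)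
  have r_lim: "r \<longlonglongrightarrow> 1" unfolding r_def by real_asymp
  have meas: "(\<lambda>z. ennreal (f z * bump (r n) z powr q)) \<in> borel_measurable lborel" for n
  proof -
    have "(\<lambda>z. indicator (ball 0 1) z *\<^sub>R (f z * bump (r n) z powr q)) \<in> borel_measurable borel"
      by (rule borel_measurable_continuous_on_indicator)
        (auto intro!: continuous_intros f continuous_on_bump_powr q)
    moreover have "(\<lambda>z. indicator (ball 0 1) z *\<^sub>R (f z * bump (r n) z powr q)) = (\<lambda>z. f z * bump (r n) z powr q)"
      using r[of n] by (auto simp: indicator_def fun_eq_iff bump_eq_0)
    ultimately show ?thesis by simp
  qed
  have "(\<integral>\<^sup>+ z. indicator (ball 0 1) z * ennreal (f z * (1 - (cmod z)\<^sup>2) powr q) \<partial>lborel)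
      \<le> (\<integral>\<^sup>+ z. liminf (\<lambda>n. ennreal (f z * bump (r n) z powr q)) \<partial>lborel)"
  proof (rule nn_integral_mono)
    fix z :: complex
    show "indicator (ball 0 1) z * ennreal (f z * (1 - (cmod z)\<^sup>2) powr q) \<le> liminf (\<lambda>n. ennreal (f z * bump (r n) z powr q))"
    proof (cases "z \<in> ball 0 1")
      case True
      have "(\<lambda>n. bump (r n) z) \<longlonglongrightarrow> max 0 (1\<^sup>2 - (cmod z)\<^sup>2)"
        unfolding bump_def by (intro tendsto_intros r_lim)
      moreover have "max 0 (1\<^sup>2 - (cmod z)\<^sup>2) = 1 - (cmod z)\<^sup>2" "1 - (cmod z)\<^sup>2 > 0"
        using True by (auto simp: abs_square_less_1 abs_square_le_1)
      ultimately have "(\<lambda>n. f z * bump (r n) z powr q) \<longlonglongrightarrow> f z * (1 - (cmod z)\<^sup>2) powr q"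
        by (intro tendsto_intros) auto
      then have "(\<lambda>n. ennreal (f z * bump (r n) z powr q)) \<longlonglongrightarrow> ennreal (f z * (1 - (cmod z)\<^sup>2) powr q)"
        by simp
      then have "liminf (\<lambda>n. ennreal (f z * bump (r n) z powr q)) = ennreal (f z * (1 - (cmod z)\<^sup>2) powr q)"
        by (intro lim_imp_Liminf) auto
      then show ?thesis using True by simp
    qed auto
  qed
  also have "\<dots> \<le> liminf (\<lambda>n. \<integral>\<^sup>+ z. ennreal (f z * bump (r n) z powr q) \<partial>lborel)"
    by (rule nn_integral_liminf[OF meas])
  also have "\<dots> \<le> limsup (\<lambda>n. B)"
    by (rule order_trans[OF Liminf_mono Liminf_le_Limsup]) (auto intro!: always_eventually B r)
  finally show ?thesis by (simp add: Limsup_const)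
qed

lemma one_minus_cnj_mult:
  assumes "a \<in> ball 0 1" "z \<in> ball 0 1"
  shows "1 - cmod z \<le> cmod (1 - cnj a * z)" "1 - cmod a \<le> cmod (1 - cnj a * z)"
    "1 - (cmod z)\<^sup>2 \<le> 2 * cmod (1 - cnj a * z)" "0 < cmod (1 - cnj a * z)" "0 < Re (1 - cnj a * z)"
proof -
  have m: "cmod (cnj a * z) \<le> cmod z" "cmod (cnj a * z) \<le> cmod a"
    using assms by (auto simp: norm_mult intro: mult_left_le_one_le mult_right_le_one_le)
  have t: "1 - cmod (cnj a * z) \<le> cmod (1 - cnj a * z)" by (metis norm_one norm_triangle_ineq2)
  show 1: "1 - cmod z \<le> cmod (1 - cnj a * z)" "1 - cmod a \<le> cmod (1 - cnj a * z)" using m t by linarith+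
  have "1 - (cmod z)\<^sup>2 = (1 - cmod z) * (1 + cmod z)" by (simp add: power2_eq_square algebra_simps)
  also have "\<dots> \<le> (1 - cmod z) * 2" using assms by (intro mult_left_mono) auto
  also have "\<dots> \<le> cmod (1 - cnj a * z) * 2" by (intro mult_right_mono 1) auto
  finally show "1 - (cmod z)\<^sup>2 \<le> 2 * cmod (1 - cnj a * z)" by simp
  show "0 < cmod (1 - cnj a * z)" using 1 assms by auto
  have "Re (cnj a * z) \<le> cmod (cnj a * z)" by (rule complex_Re_le_cmod)
  then show "0 < Re (1 - cnj a * z)" using m assms by auto
qed

text \<open>On the disc this is \<open>|\<phi>\<^sub>a'|^p\<close> for the automorphism \<open>\<phi>\<^sub>a\<close> = \<^const>\<open>disc_auto\<close> \<open>a\<close>.\<close>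

definition kern :: "real \<Rightarrow> complex \<Rightarrow> complex \<Rightarrow> real" where
  "kern p a z = (1 - (cmod a)\<^sup>2) powr p * cmod (1 - cnj a * z) powr (- 2 * p)"

lemma kern_nonneg: "0 \<le> kern p a z" by (simp add: kern_def)

lemma continuous_on_kern:
  assumes "a \<in> ball 0 1"
  shows "continuous_on (ball 0 1) (kern p a)"
  unfolding kern_def
  by (intro continuous_intros) (use one_minus_cnj_mult(4)[OF assms] in force)+

text \<open>The limit half of the vanishing p-Carleson condition for the measure f dA. For f =
  |u'|^2 (1 - |z|^2)^p with u analytic it amounts to \<open>Q_p0\<close>, so dilatation, Schwarzian
  and pre-Schwarzian are all treated by this one notion.\<close>

definition vanishing :: "real \<Rightarrow> (complex \<Rightarrow> real) \<Rightarrow> bool" where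
  "vanishing p f \<longleftrightarrow> tends_zero_at_boundary (\<lambda>a. \<integral>\<^sup>+ z. indicator (ball 0 1) z * ennreal (f z * kern p a z) \<partial>lborel)"

section \<open>Closure properties of the vanishing condition\<close>

lemma measurable_indicator_ball:
  fixes f :: "complex \<Rightarrow> real"
  assumes "continuous_on (ball c r) f"
  shows "(\<lambda>z. indicator (ball c r) z * ennreal (f z)) \<in> borel_measurable lborel"
proof -
  have "(\<lambda>z. indicator (ball c r) z *\<^sub>R f z) \<in> borel_measurable borel"
    by (rule borel_measurable_continuous_on_indicator) (use assms in auto)
  then have "(\<lambda>z. ennreal (indicator (ball c r) z *\<^sub>R f z)) \<in> borel_measurable lborel" by simp
  moreover have "(\<lambda>z. ennreal (indicator (ball c r) z *\<^sub>R f z)) = (\<lambda>z. indicator (ball c r) z * ennreal (f z))"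
    by (auto simp: indicator_def fun_eq_iff)
  ultimately show ?thesis by simp
qed

lemma tends_zero_at_boundary_mono:
  assumes "tends_zero_at_boundary J" "\<And>a. a \<in> ball 0 1 \<Longrightarrow> I a \<le> J a"
  shows "tends_zero_at_boundary I"
  unfolding tends_zero_at_boundary_def
proof (intro allI impI)
  fix e :: real assume "0 < e"
  then obtain r where "r < 1" "\<And>a. r < cmod a \<Longrightarrow> cmod a < 1 \<Longrightarrow> J a < ennreal e"
    using assms(1) unfolding tends_zero_at_boundary_def by blast
  with assms(2) show "\<exists>r<1. \<forall>a. r < cmod a \<longrightarrow> cmod a < 1 \<longrightarrow> I a < ennreal e"
    by (intro exI[of _ r]) (auto intro: le_less_trans)
qed

lemma tends_zero_at_boundary_add:
  assumes "tends_zero_at_boundary I" "tends_zero_at_boundary J"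
  shows "tends_zero_at_boundary (\<lambda>a. I a + J a)"
  unfolding tends_zero_at_boundary_def
proof (intro allI impI)
  fix e :: real assume e: "0 < e"
  obtain r where r: "r < 1" "\<And>a. r < cmod a \<Longrightarrow> cmod a < 1 \<Longrightarrow> I a < ennreal (e/2)"
    using assms(1) e unfolding tends_zero_at_boundary_def by (metis half_gt_zero)
  obtain s where s: "s < 1" "\<And>a. s < cmod a \<Longrightarrow> cmod a < 1 \<Longrightarrow> J a < ennreal (e/2)"
    using assms(2) e unfolding tends_zero_at_boundary_def by (metis half_gt_zero)
  have "I a + J a < ennreal e" if "max r s < cmod a" "cmod a < 1" for a
  proof -
    have "I a + J a < ennreal (e/2) + ennreal (e/2)"
      using r(2)[of a] s(2)[of a] that by (intro add_strict_mono) auto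
    also have "\<dots> = ennreal e" using e by (simp flip: ennreal_plus)
    finally show ?thesis .
  qed
  then show "\<exists>r<1. \<forall>a. r < cmod a \<longrightarrow> cmod a < 1 \<longrightarrow> I a + J a < ennreal e"
    using r s by (intro exI[of _ "max r s"]) auto
qed

lemma tends_zero_at_boundary_cmult:
  assumes "tends_zero_at_boundary I"
  shows "tends_zero_at_boundary (\<lambda>a. ennreal c * I a)"
  unfolding tends_zero_at_boundary_def
proof (intro allI impI)
  fix e :: real assume e: "0 < e"
  define d where "d = e / (\<bar>c\<bar> + 1)"
  have d: "0 < d" using e by (simp add: d_def add_nonneg_pos)
  obtain r where r: "r < 1" "\<And>a. r < cmod a \<Longrightarrow> cmod a < 1 \<Longrightarrow> I a < ennreal d"
    using assms d unfolding tends_zero_at_boundary_def by metis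
  have "ennreal c * I a < ennreal e" if "r < cmod a" "cmod a < 1" for a
  proof -
    have "ennreal c * I a \<le> ennreal \<bar>c\<bar> * ennreal d"
      using r(2)[OF that] by (intro mult_mono) (auto intro: ennreal_leI less_imp_le)
    also have "\<dots> = ennreal (\<bar>c\<bar> * d)" by (simp add: ennreal_mult' d less_imp_le)
    also have "\<dots> < ennreal e" using e d by (intro ennreal_lessI) (auto simp: d_def field_simps)
    finally show ?thesis .
  qed
  then show "\<exists>r<1. \<forall>a. r < cmod a \<longrightarrow> cmod a < 1 \<longrightarrow> ennreal c * I a < ennreal e"
    using r by blast
qed

lemma vanishing_mono:
  assumes "vanishing p g" "\<And>z. z \<in> ball 0 1 \<Longrightarrow> f z \<le> g z"
  shows "vanishing p f"
  using assms(1) unfolding vanishing_def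
  by (rule tends_zero_at_boundary_mono)
    (auto intro!: nn_integral_mono ennreal_leI mult_right_mono simp: kern_nonneg assms(2) split: split_indicator)

lemma vanishing_cmult:
  assumes g: "vanishing p g" "continuous_on (ball 0 1) g" and c: "0 \<le> c"
  shows "vanishing p (\<lambda>z. c * g z)"
  unfolding vanishing_def
proof (rule tends_zero_at_boundary_mono[OF tends_zero_at_boundary_cmult[OF g(1)[unfolded vanishing_def], of c]])
  fix a :: complex assume a: "a \<in> ball 0 1"
  have "(\<integral>\<^sup>+ z. indicator (ball 0 1) z * ennreal (c * g z * kern p a z) \<partial>lborel)
     = (\<integral>\<^sup>+ z. ennreal c * (indicator (ball 0 1) z * ennreal (g z * kern p a z)) \<partial>lborel)"
    by (rule nn_integral_cong) (simp add: ennreal_mult' c mult.assoc mult.left_commute)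
  also have "\<dots> = ennreal c * (\<integral>\<^sup>+ z. indicator (ball 0 1) z * ennreal (g z * kern p a z) \<partial>lborel)"
    by (rule nn_integral_cmult) (intro measurable_indicator_ball continuous_intros g continuous_on_kern a)
  finally show "(\<integral>\<^sup>+ z. indicator (ball 0 1) z * ennreal (c * g z * kern p a z) \<partial>lborel)
     \<le> ennreal c * (\<integral>\<^sup>+ z. indicator (ball 0 1) z * ennreal (g z * kern p a z) \<partial>lborel)" by simp
qed

text \<open>\<open>ennreal\<close> truncates negative reals to 0, so equality may fail for mixed
  signs.\<close>

lemma ennreal_add_le: "ennreal (x + y) \<le> ennreal x + ennreal y"
proof (cases "0 \<le> x \<and> 0 \<le> y")
  case False
  then have "ennreal (x + y) \<le> ennreal x \<or> ennreal (x + y) \<le> ennreal y"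
    by (auto intro!: ennreal_leI)
  then show ?thesis by (metis add_increasing add_increasing2 zero_le)
qed simp

lemma vanishing_add:
  assumes f: "vanishing p f" "continuous_on (ball 0 1) f" and g: "vanishing p g" "continuous_on (ball 0 1) g"
  shows "vanishing p (\<lambda>z. f z + g z)"
  unfolding vanishing_def
proof (rule tends_zero_at_boundary_mono[OF tends_zero_at_boundary_add[OF f(1)[unfolded vanishing_def] g(1)[unfolded vanishing_def]]])
  fix a :: complex assume a: "a \<in> ball 0 1"
  have "(\<integral>\<^sup>+ z. indicator (ball 0 1) z * ennreal ((f z + g z) * kern p a z) \<partial>lborel)
     \<le> (\<integral>\<^sup>+ z. indicator (ball 0 1) z * ennreal (f z * kern p a z) + indicator (ball 0 1) z * ennreal (g z * kern p a z) \<partial>lborel)"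
    by (rule nn_integral_mono)
      (auto simp: distrib_right intro!: ennreal_add_le split: split_indicator)
  also have "\<dots> = (\<integral>\<^sup>+ z. indicator (ball 0 1) z * ennreal (f z * kern p a z) \<partial>lborel) + (\<integral>\<^sup>+ z. indicator (ball 0 1) z * ennreal (g z * kern p a z) \<partial>lborel)"
    by (rule nn_integral_add) (intro measurable_indicator_ball continuous_intros f g continuous_on_kern a)+
  finally show "(\<integral>\<^sup>+ z. indicator (ball 0 1) z * ennreal ((f z + g z) * kern p a z) \<partial>lborel)
     \<le> (\<integral>\<^sup>+ z. indicator (ball 0 1) z * ennreal (f z * kern p a z) \<partial>lborel) + (\<integral>\<^sup>+ z. indicator (ball 0 1) z * ennreal (g z * kern p a z) \<partial>lborel)" .
qed

text \<open>Since Re(1 - cnj a z) > 0 in the disc, the principal power K is analytic there and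
  \<open>kern\<close> is a constant times |K|^2. Its logarithmic derivative p cnj a / (1 - cnj a z)
  becomes the k of \<open>green_identity\<close>.\<close>

lemma kern_powr:
  fixes p :: real
  assumes a: "a \<in> ball 0 1"
  defines "K \<equiv> \<lambda>z. (1 - cnj a * z) powr (- of_real p)"
  shows "K holomorphic_on ball 0 1"
    and "\<And>z. z \<in> ball 0 1 \<Longrightarrow> deriv K z = (of_real p * cnj a / (1 - cnj a * z)) * K z"
    and "\<And>z. z \<in> ball 0 1 \<Longrightarrow> kern p a z = (1 - (cmod a)\<^sup>2) powr p * (cmod (K z))\<^sup>2"
    and "\<And>z. z \<in> ball 0 1 \<Longrightarrow> cmod (of_real p * cnj a / (1 - cnj a * z)) \<le> \<bar>p\<bar> / cmod (1 - cnj a * z)"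
proof -
  have pos: "1 - cnj a * z \<notin> \<real>\<^sub>\<le>\<^sub>0" if "z \<in> ball 0 1" for z
    using one_minus_cnj_mult(5)[OF a that] complex_nonpos_Reals_iff by force
  have d: "(K has_field_derivative (of_real p * cnj a / (1 - cnj a * z)) * K z) (at z)" if "z \<in> ball 0 1" for z
  proof -
    have nz: "1 - cnj a * z \<noteq> 0" using pos[OF that] by auto
    have "((\<lambda>w. w powr (- of_real p)) has_field_derivative (- of_real p) * (1 - cnj a * z) powr (- of_real p - 1)) (at (1 - cnj a * z))"
      by (rule has_field_derivative_powr[OF pos[OF that]])
    moreover have "((\<lambda>z. 1 - cnj a * z) has_field_derivative (- cnj a)) (at z)"
      by (auto intro!: derivative_eq_intros)
    ultimately have "(K has_field_derivative ((- of_real p) * (1 - cnj a * z) powr (- of_real p - 1)) * (- cnj a)) (at z)"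
      unfolding K_def by (rule DERIV_chain2)
    moreover have "((- of_real p) * (1 - cnj a * z) powr (- of_real p - 1)) * (- cnj a) = (of_real p * cnj a / (1 - cnj a * z)) * K z"
      using nz by (simp add: K_def powr_diff)
    ultimately show ?thesis by simp
  qed
  then show "K holomorphic_on ball 0 1" by (metis at_within_open holomorphic_on_def field_differentiable_def open_ball)
  show "deriv K z = (of_real p * cnj a / (1 - cnj a * z)) * K z" if "z \<in> ball 0 1" for z
    by (rule DERIV_imp_deriv[OF d[OF that]])
  show "kern p a z = (1 - (cmod a)\<^sup>2) powr p * (cmod (K z))\<^sup>2" if "z \<in> ball 0 1" for z
  proof -
    have "cmod (K z) = cmod (1 - cnj a * z) powr (- p)"
      unfolding K_def using norm_powr_real_powr'[of "-p" "1 - cnj a * z"] by simp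
    then have "(cmod (K z))\<^sup>2 = cmod (1 - cnj a * z) powr (- 2 * p)"
      by (simp add: power2_eq_square flip: powr_add)
    then show ?thesis by (simp add: kern_def)
  qed
  show "cmod (of_real p * cnj a / (1 - cnj a * z)) \<le> \<bar>p\<bar> / cmod (1 - cnj a * z)" if "z \<in> ball 0 1" for z
    using a by (auto simp: norm_divide norm_mult intro!: divide_right_mono mult_right_le_one_le)
qed

section \<open>Area integrals computed by scaling\<close>

lemma nn_integral_lborel_affine:
  fixes f :: "complex \<Rightarrow> ennreal"
  assumes f: "f \<in> borel_measurable borel" and c: "0 < c"
  shows "(\<integral>\<^sup>+ x. f x \<partial>lborel) = ennreal (c\<^sup>2) * (\<integral>\<^sup>+ x. f (t + c *\<^sub>R x) \<partial>lborel)"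
proof -
  have "(\<integral>\<^sup>+ x. f x \<partial>lborel) = (\<integral>\<^sup>+ x. f x \<partial>(density (distr lborel borel (\<lambda>x. t + c *\<^sub>R x)) (\<lambda>_. ennreal (\<bar>c\<bar> ^ DIM(complex)))))"
    using lborel_affine[of c t] c by simp
  also have "\<dots> = (\<integral>\<^sup>+ x. ennreal (c\<^sup>2) * f x \<partial>(distr lborel borel (\<lambda>x. t + c *\<^sub>R x)))"
    using f c by (subst nn_integral_density) auto
  also have "\<dots> = (\<integral>\<^sup>+ x. ennreal (c\<^sup>2) * f (t + c *\<^sub>R x) \<partial>lborel)"
    using f by (subst nn_integral_distr) auto
  also have "\<dots> = ennreal (c\<^sup>2) * (\<integral>\<^sup>+ x. f (t + c *\<^sub>R x) \<partial>lborel)"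
    using f by (subst nn_integral_cmult) auto
  finally show ?thesis .
qed

text \<open>Dyadic induction. Doubling maps 1 <= |z| < 2^n onto 2 <= |z| < 2^(n+1) and multiplies
  the integral by \<open>th\<close> = 2^(2-s) < 1. The rest is at most the area \<open>A\<close> of
  the disc of radius 2, so the truncated integrals satisfy I(n+1) <= A + th I(n), and
  \<open>B\<close> is the fixed point of this recursion.\<close>

lemma nn_integral_norm_powr_outside_disc:
  assumes s: "2 < s"
  obtains B where "0 \<le> B" "(\<integral>\<^sup>+ z. indicator {z. 1 \<le> cmod z} z * ennreal (cmod z powr (- s)) \<partial>lborel) \<le> ennreal B"
proof -
  define f where "f n z = indicator {z. 1 \<le> cmod z \<and> cmod z < 2 ^ n} z * ennreal (cmod z powr (- s))" for n and z :: complex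
  have [measurable]: "f n \<in> borel_measurable borel" for n unfolding f_def by measurable
  define A where "A = measure lborel (ball (0::complex) 2)"
  define th where "th = (2::real) powr (2 - s)"
  have th: "0 < th" "th < 1" using s by (auto simp: th_def powr_less_one)
  define B where "B = A / (1 - th)"
  have A0: "0 \<le> A" by (simp add: A_def)
  have B0: "0 \<le> B" using A0 th by (simp add: B_def)
  have J: "(\<integral>\<^sup>+ z. f n z \<partial>lborel) \<le> ennreal B" for n
  proof (induction n)
    case 0
    have "f 0 = (\<lambda>_. 0)" by (auto simp: f_def fun_eq_iff indicator_def)
    then show ?case by simp
  next
    case (Suc n)
    define g where "g z = indicator {z. 2 \<le> cmod z \<and> cmod z < 2 ^ Suc n} z * ennreal (cmod z powr (- s))" for z :: complex
    have [measurable]: "g \<in> borel_measurable borel" unfolding g_def by measurable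
    have le: "f (Suc n) z \<le> indicator (ball 0 2) z + g z" for z
    proof -
      have "cmod z powr (- s) \<le> 1" if "1 \<le> cmod z"
        using that s powr_mono2'[of "-s" 1 "cmod z"] by simp
      then show ?thesis by (auto simp: f_def g_def indicator_def ennreal_le_1)
    qed
    have "(\<integral>\<^sup>+ z. g z \<partial>lborel) = ennreal (2\<^sup>2) * (\<integral>\<^sup>+ z. g (0 + 2 *\<^sub>R z) \<partial>lborel)"
      by (rule nn_integral_lborel_affine) auto
    also have "(\<lambda>z. g (0 + 2 *\<^sub>R z)) = (\<lambda>z. ennreal (2 powr (- s)) * f n z)"
      by (auto simp: g_def f_def fun_eq_iff indicator_def powr_mult ennreal_mult')
    also have "(\<integral>\<^sup>+ z. ennreal (2 powr (- s)) * f n z \<partial>lborel) = ennreal (2 powr (- s)) * (\<integral>\<^sup>+ z. f n z \<partial>lborel)"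
      by (rule nn_integral_cmult) auto
    also have "ennreal (2\<^sup>2) * (ennreal (2 powr (- s)) * (\<integral>\<^sup>+ z. f n z \<partial>lborel)) = ennreal th * (\<integral>\<^sup>+ z. f n z \<partial>lborel)"
    proof -
      have "ennreal (2\<^sup>2) * ennreal (2 powr (- s)) = ennreal th"
        by (subst ennreal_mult''[symmetric]) (auto simp: th_def powr_diff powr_minus divide_inverse)
      then show ?thesis by (simp only: mult.assoc[symmetric])
    qed
    also have "\<dots> \<le> ennreal th * ennreal B" by (intro mult_left_mono Suc) auto
    finally have g: "(\<integral>\<^sup>+ z. g z \<partial>lborel) \<le> ennreal (th * B)" using th by (simp add: ennreal_mult')
    have "(\<integral>\<^sup>+ z. f (Suc n) z \<partial>lborel) \<le> (\<integral>\<^sup>+ z. indicator (ball 0 2) z + g z \<partial>lborel)"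
      by (rule nn_integral_mono) (rule le)
    also have "\<dots> = emeasure lborel (ball (0::complex) 2) + (\<integral>\<^sup>+ z. g z \<partial>lborel)"
      by (subst nn_integral_add) (auto intro!: borel_measurable_indicator)
    also have "\<dots> \<le> ennreal A + ennreal (th * B)"
      using g emeasure_lborel_ball_finite[of "0::complex" 2]
      by (intro add_mono) (auto simp: A_def emeasure_eq_ennreal_measure)
    also have "\<dots> = ennreal B" using A0 B0 th by (simp add: B_def field_simps flip: ennreal_plus)
    finally show ?case .
  qed
  have "(\<integral>\<^sup>+ z. indicator {z. 1 \<le> cmod z} z * ennreal (cmod z powr (- s)) \<partial>lborel) \<le> (\<integral>\<^sup>+ z. liminf (\<lambda>n. f n z) \<partial>lborel)"
  proof (rule nn_integral_mono)
    fix z :: complex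
    obtain m where "cmod z < 2 ^ m" using real_arch_pow[of 2 "cmod z"] by auto
    then have "\<forall>\<^sub>F n in sequentially. f n z = indicator {z. 1 \<le> cmod z} z * ennreal (cmod z powr (- s))"
      by (intro eventually_sequentiallyI[of m]) (auto simp: f_def indicator_def dest: order_less_le_trans[OF _ power_increasing[of m _ "2::real"]])
    then have "(\<lambda>n. f n z) \<longlonglongrightarrow> indicator {z. 1 \<le> cmod z} z * ennreal (cmod z powr (- s))"
      by (rule tendsto_eventually)
    then show "indicator {z. 1 \<le> cmod z} z * ennreal (cmod z powr (- s)) \<le> liminf (\<lambda>n. f n z)"
      by (simp add: lim_imp_Liminf)
  qed
  also have "\<dots> \<le> liminf (\<lambda>n. \<integral>\<^sup>+ z. f n z \<partial>lborel)" by (rule nn_integral_liminf) auto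
  also have "\<dots> \<le> limsup (\<lambda>n. ennreal B)"
    by (rule order_trans[OF Liminf_mono Liminf_le_Limsup]) (auto intro!: always_eventually J)
  finally show ?thesis using that[OF B0] by (simp add: Limsup_const)
qed

section \<open>Comparing an analytic function with its derivative\<close>

text \<open>This pays for the cone in \<open>vanishing_of_riccati\<close>. The substitution z =
  1/cnj a + (1 - |a|) x turns 1 - cnj a z into -cnj a (1 - |a|) x and sends the disc into |x| >= 1.
  The total exponent -(2 + p) is integrable at infinity, and the powers of 1 - |a| cancel; |a| >=
  1/2 bounds the remaining factor |a| from below.\<close>

lemma kern_integral_bound:
  assumes p: "0 < p"
  obtains C where "0 \<le> C" "\<And>a. 1/2 \<le> cmod a \<Longrightarrow> cmod a < 1 \<Longrightarrow>
    (\<integral>\<^sup>+ z. indicator (ball 0 1) z * ennreal (cmod (1 - cnj a * z) powr (p - 2) * kern p a z) \<partial>lborel) \<le> ennreal C"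
proof -
  define s where "s = 2 + p"
  obtain B where B: "0 \<le> B" "(\<integral>\<^sup>+ z. indicator {z. 1 \<le> cmod z} z * ennreal (cmod z powr (- s)) \<partial>lborel) \<le> ennreal B"
    using nn_integral_norm_powr_outside_disc[of s] p by (auto simp: s_def)
  show ?thesis
  proof (rule that[of "2 powr (p + s) * B"])
    show "0 \<le> 2 powr (p + s) * B" using B by simp
    fix a :: complex assume a: "1/2 \<le> cmod a" "cmod a < 1"
    define d where "d = 1 - cmod a"
    define b where "b = 1 / cnj a"
    define f where "f z = indicator (ball 0 1) z * ennreal (cmod (1 - cnj a * z) powr (p - 2) * kern p a z)" for z
    have d: "0 < d" "d \<le> 1" using a by (auto simp: d_def)
    have a0: "a \<noteq> 0" using a by auto
    have "f \<in> borel_measurable lborel"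
      unfolding f_def[abs_def]
      by (intro measurable_indicator_ball continuous_intros continuous_on_kern)
        (use a one_minus_cnj_mult(4)[of a] in force)+
    then have fm: "f \<in> borel_measurable borel" by simp
    have ab: "1 - cnj a * (b + d *\<^sub>R x) = - (cnj a * (d *\<^sub>R x))" for x
      using a0 by (simp add: b_def field_simps)
    have le: "f (b + d *\<^sub>R x) \<le> ennreal (2 powr (p + s) / d\<^sup>2) * (indicator {z. 1 \<le> cmod z} x * ennreal (cmod x powr (- s)))" for x
    proof (cases "b + d *\<^sub>R x \<in> ball 0 1")
      case True
      have n: "cmod (1 - cnj a * (b + d *\<^sub>R x)) = cmod a * (d * cmod x)"
        unfolding ab using d by (simp add: norm_mult)
      have "d \<le> cmod a * (d * cmod x)"
        using one_minus_cnj_mult(2)[of a "b + d *\<^sub>R x"] True a n by (simp add: d_def)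
      then have "1 \<le> cmod a * cmod x" using d by (simp add: field_simps)
      also have "\<dots> \<le> 1 * cmod x" using a by (intro mult_right_mono) auto
      finally have x1: "1 \<le> cmod x" by simp
      have k1: "(1 - (cmod a)\<^sup>2) powr p \<le> (2 * d) powr p"
      proof (rule powr_mono2)
        have "1 - (cmod a)\<^sup>2 = d * (1 + cmod a)" by (simp add: d_def power2_eq_square algebra_simps)
        also have "\<dots> \<le> d * 2" using a d by (intro mult_left_mono) auto
        finally show "1 - (cmod a)\<^sup>2 \<le> 2 * d" by simp
        show "0 \<le> 1 - (cmod a)\<^sup>2" using a by (simp add: abs_square_le_1)
      qed (use p in auto)
      have k2: "(cmod a * (d * cmod x)) powr (- s) \<le> (1/2 * (d * cmod x)) powr (- s)"
      proof (rule powr_mono2')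
        show "1/2 * (d * cmod x) \<le> cmod a * (d * cmod x)"
          using a d by (intro mult_right_mono) auto
        have "0 < d * cmod x" using d x1 by (intro mult_pos_pos) auto
        then show "0 < 1/2 * (d * cmod x)" by simp
      qed (use p in \<open>simp add: s_def\<close>)
      have "cmod (1 - cnj a * (b + d *\<^sub>R x)) powr (p - 2) * kern p a (b + d *\<^sub>R x)
        = (1 - (cmod a)\<^sup>2) powr p * (cmod a * (d * cmod x)) powr (- s)"
      proof -
        have "p - 2 + - 2 * p = - s" by (simp add: s_def)
        then show ?thesis unfolding kern_def n by (metis mult.left_commute powr_add)
      qed
      also have "\<dots> \<le> (2 * d) powr p * (1/2 * (d * cmod x)) powr (- s)"
        by (intro mult_mono k1 k2) auto
      also have "\<dots> = 2 powr (p + s) / d\<^sup>2 * cmod x powr (- s)"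
      proof -
        have 1: "(2 * d) powr p = 2 powr p * d powr p" using d by (simp add: powr_mult)
        have 2: "(1/2 * (d * cmod x)) powr (- s) = 2 powr s * (d powr (- s) * cmod x powr (- s))"
          using d by (simp add: powr_mult powr_divide powr_minus divide_simps)
        have 3: "d powr p * d powr (- s) = 1 / d\<^sup>2"
          using d by (simp add: s_def powr_minus divide_simps flip: powr_add)
        have "(2 * d) powr p * (1/2 * (d * cmod x)) powr (- s)
            = (2 powr p * 2 powr s) * (d powr p * d powr (- s)) * cmod x powr (- s)"
          unfolding 1 2 by (simp only: mult_ac)
        also have "\<dots> = 2 powr (p + s) / d\<^sup>2 * cmod x powr (- s)"
          unfolding 3 by (simp add: powr_add)
        finally show ?thesis .
      qed
      finally show ?thesis using True x1
        by (simp add: f_def ennreal_leI flip: ennreal_mult'')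
    qed (simp add: f_def)
    have "(\<integral>\<^sup>+ z. f z \<partial>lborel) = ennreal (d\<^sup>2) * (\<integral>\<^sup>+ x. f (b + d *\<^sub>R x) \<partial>lborel)"
      by (rule nn_integral_lborel_affine[OF fm d(1)])
    also have "\<dots> \<le> ennreal (d\<^sup>2) * (\<integral>\<^sup>+ x. ennreal (2 powr (p + s) / d\<^sup>2) * (indicator {z. 1 \<le> cmod z} x * ennreal (cmod x powr (- s))) \<partial>lborel)"
      by (intro mult_left_mono nn_integral_mono le) auto
    also have "\<dots> = ennreal (d\<^sup>2) * (ennreal (2 powr (p + s) / d\<^sup>2) * (\<integral>\<^sup>+ x. (indicator {z. 1 \<le> cmod z} x * ennreal (cmod x powr (- s))) \<partial>lborel))"
      by (subst nn_integral_cmult) auto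
    also have "\<dots> \<le> ennreal (d\<^sup>2) * (ennreal (2 powr (p + s) / d\<^sup>2) * ennreal B)"
      by (intro mult_left_mono B) auto
    also have "\<dots> = ennreal (2 powr (p + s) * B)"
      using d B by (simp flip: ennreal_mult'')
    finally show "(\<integral>\<^sup>+ z. indicator (ball 0 1) z * ennreal (cmod (1 - cnj a * z) powr (p - 2) * kern p a z) \<partial>lborel)
      \<le> ennreal (2 powr (p + s) * B)" by (simp add: f_def)
  qed
qed

text \<open>E is the bracket of \<open>green_identity\<close>. Put rho = 1 - |z|^2 and l = |1 - cnj
  a z|. Then bump |k| <= p rho / l <= 2p bounds E on both sides. From below, E falls short of q(q-1)
  >= 2 by at most q^2 rho + 2qp rho / l. The extra hypotheses of the third bound place z near the
  circle and outside the cone l < (q^2 + 2qp) rho, which makes this loss at most 1.\<close>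

lemma green_factor_bounds:
  fixes p q :: real and a z k :: complex
  assumes a: "a \<in> ball 0 1" and z: "z \<in> ball 0 1" and r: "0 < r" "r < 1" and p: "0 < p" and q: "q = 2 + p"
    and k: "cmod k \<le> p / cmod (1 - cnj a * z)"
  defines "E \<equiv> (bump r z)\<^sup>2 * (cmod k)\<^sup>2 - q * bump r z * (1 + 2 * Re (z * k)) + q * (q - 1) * (cmod z)\<^sup>2"
  shows "E \<le> 4 * p\<^sup>2 + 4 * p * q + q * (q - 1)"
    and "E \<ge> - (q + 4 * q * p)"
    and "(q\<^sup>2 + 2 * q * p) * (1 - (cmod z)\<^sup>2) \<le> 1 \<Longrightarrow> (q\<^sup>2 + 2 * q * p) * (1 - (cmod z)\<^sup>2) \<le> cmod (1 - cnj a * z) \<Longrightarrow> E \<ge> 1"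
proof -
  let ?R = "bump r z" and ?l = "cmod (1 - cnj a * z)" and ?w = "1 - (cmod z)\<^sup>2"
  have R0: "0 \<le> ?R" by (rule bump_nonneg)
  have Rw: "?R \<le> ?w" by (rule bump_le[OF r(2,1) z])
  have l: "0 < ?l" "?w \<le> 2 * ?l" using one_minus_cnj_mult[OF a z] by auto
  have Rk: "?R * cmod k \<le> ?w * p / ?l"
  proof -
    have "?R * cmod k \<le> ?w * (p / ?l)" by (intro mult_mono Rw k) (use R0 Rw in auto)
    then show ?thesis by simp
  qed
  have "?w * p \<le> 2 * ?l * p" using l p by (intro mult_right_mono) auto
  then have wl: "?w * p / ?l \<le> 2 * p" using l by (simp add: field_simps)
  have Re: "\<bar>Re (z * k)\<bar> \<le> cmod k"
  proof -
    have "\<bar>Re (z * k)\<bar> \<le> cmod (z * k)" by (rule abs_Re_le_cmod)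
    also have "\<dots> \<le> 1 * cmod k" unfolding norm_mult using z by (intro mult_right_mono) auto
    finally show ?thesis by simp
  qed
  have Re': "?R * \<bar>Re (z * k)\<bar> \<le> ?w * p / ?l"
    using Re R0 Rk by (meson mult_left_mono order_trans)
  have ReR: "\<bar>?R * Re (z * k)\<bar> \<le> ?w * p / ?l" using Re' R0 by (simp add: abs_mult)
  have w: "0 \<le> ?w" "?w \<le> 1" using R0 Rw by auto
  have q0: "2 < q" using p q by simp
  have sq: "(?R * cmod k)\<^sup>2 \<le> (2 * p)\<^sup>2" using Rk wl R0 by (intro power_mono) auto
  have E: "E = (?R * cmod k)\<^sup>2 - q * ?R - 2 * q * (?R * Re (z * k)) + q * (q - 1) * (1 - ?w)"
    by (simp add: E_def power_mult_distrib algebra_simps)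
  have t1: "\<bar>q * (?R * Re (z * k))\<bar> \<le> q * (?w * p / ?l)" using mult_left_mono[OF ReR, of q] q0 by (simp only: abs_mult[of q] abs_of_pos)
  have t2: "q * (?w * p / ?l) \<le> q * (2 * p)" using wl q0 by (intro mult_left_mono) auto
  have t3: "q * ?R \<ge> 0" "q * ?R \<le> q * ?w" using R0 Rw q0 by (auto intro: mult_left_mono)
  have t4: "q * (q - 1) * (1 - ?w) = q * (q - 1) - q * (q - 1) * ?w" "q * (q - 1) * ?w \<ge> 0"
    "q * (q - 1) * ?w \<le> q * (q - 1)"
  proof -
    have qq: "0 \<le> q * (q - 1)" using q0 by simp
    show "q * (q - 1) * (1 - ?w) = q * (q - 1) - q * (q - 1) * ?w" by (subst right_diff_distrib) simp
    show "q * (q - 1) * ?w \<ge> 0" using qq w(1) by (rule mult_nonneg_nonneg)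
    show "q * (q - 1) * ?w \<le> q * (q - 1)" using mult_left_mono[OF w(2) qq] by simp
  qed
  show "E \<le> 4 * p\<^sup>2 + 4 * p * q + q * (q - 1)"
  proof -
    have "(?R * cmod k)\<^sup>2 \<le> 4 * p\<^sup>2" using sq by (simp add: power_mult_distrib)
    then show ?thesis using t1 t2 t3 t4 unfolding E by argo
  qed
  have t5: "q * ?w \<le> q" using w q0 by (simp add: mult_left_le)
  show "E \<ge> - (q + 4 * q * p)"
    using t1 t2 t3 t4 t5 zero_le_power2[of "?R * cmod k"] unfolding E by linarith
  assume as: "(q\<^sup>2 + 2 * q * p) * ?w \<le> 1" "(q\<^sup>2 + 2 * q * p) * ?w \<le> ?l"
  define m where "m = 1 / (q\<^sup>2 + 2 * q * p)"
  have D: "0 < q\<^sup>2 + 2 * q * p" using q0 p by (intro add_pos_pos) auto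
  have "?w \<le> m" using as(1) D by (simp add: m_def field_simps)
  moreover have "?w / ?l \<le> m" using as(2) D l by (simp add: m_def field_simps)
  ultimately have "q\<^sup>2 * ?w + 2 * q * p * (?w / ?l) \<le> q\<^sup>2 * m + 2 * q * p * m"
    using q0 p by (intro add_mono mult_left_mono) auto
  also have "\<dots> = (q\<^sup>2 + 2 * q * p) * m" by (rule distrib_right[symmetric])
  also have "\<dots> = 1" using D by (simp add: m_def)
  finally have t6: "q\<^sup>2 * ?w + 2 * (q * (?w * p / ?l)) \<le> 1" by (simp add: algebra_simps)
  have t7: "q * ?w + q * (q - 1) * ?w = q\<^sup>2 * ?w" by (simp add: power2_eq_square algebra_simps)
  have "2 * 1 \<le> q * (q - 1)" using q0 by (intro mult_mono) auto
  then show "E \<ge> 1"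
    using t1 t3 t4 t6 t7 zero_le_power2[of "?R * cmod k"] unfolding E by linarith
qed

text \<open>
  The expression multiplied by \<open>\<sigma>\<close> has weighted integral zero by Green's formula, so a pointwise
  inequality modulo any multiple of it may be integrated. In the application \<open>k\<close> is the logarithmic
  derivative of the analytic square root of the kernel.
\<close>

lemma nn_integral_green_le:
  fixes p q \<sigma> :: real and u :: "complex \<Rightarrow> complex" and P H :: "complex \<Rightarrow> real"
  assumes u: "u holomorphic_on ball 0 1" and a: "a \<in> ball 0 1" and r: "0 < r" "r < 1" and p: "0 < p" and q: "q = 2 + p"
    and P: "continuous_on (ball 0 1) P" "\<And>z. z \<in> ball 0 1 \<Longrightarrow> 0 \<le> P z"
    and H: "continuous_on (ball 0 1) H" "\<And>z. z \<in> ball 0 1 \<Longrightarrow> 0 \<le> H z"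
    and le: "\<And>z k. z \<in> ball 0 1 \<Longrightarrow> cmod k \<le> p / cmod (1 - cnj a * z) \<Longrightarrow>
      P z \<le> \<sigma> * ((cmod (u z))\<^sup>2 * bump r z powr p *
       ((bump r z)\<^sup>2 * (cmod k)\<^sup>2 - q * bump r z * (1 + 2 * Re (z * k)) + q * (q - 1) * (cmod z)\<^sup>2)
        - (cmod (deriv u z))\<^sup>2 * bump r z powr q) + H z"
  shows "(\<integral>\<^sup>+ z. indicator (ball 0 1) z * ennreal (P z * kern p a z) \<partial>lborel)
     \<le> (\<integral>\<^sup>+ z. indicator (ball 0 1) z * ennreal (H z * kern p a z) \<partial>lborel)"
proof -
  define K where "K z = (1 - cnj a * z) powr (- of_real p)" for z
  define k where "k z = of_real p * cnj a / (1 - cnj a * z)" for z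
  have K: "K holomorphic_on ball 0 1" "\<And>z. z \<in> ball 0 1 \<Longrightarrow> deriv K z = k z * K z"
    "\<And>z. z \<in> ball 0 1 \<Longrightarrow> kern p a z = (1 - (cmod a)\<^sup>2) powr p * (cmod (K z))\<^sup>2"
    "\<And>z. z \<in> ball 0 1 \<Longrightarrow> cmod (k z) \<le> p / cmod (1 - cnj a * z)"
    using kern_powr[OF a, where p = p] p unfolding K_def k_def by auto
  define G where "G z = (cmod (u z))\<^sup>2 * (cmod (K z))\<^sup>2 * bump r z powr (q - 2) *
       ((bump r z)\<^sup>2 * (cmod (k z))\<^sup>2 - q * bump r z * (1 + 2 * Re (z * k z)) + q * (q - 1) * (cmod z)\<^sup>2)
     - (cmod (deriv u z))\<^sup>2 * (cmod (K z))\<^sup>2 * bump r z powr q" for z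
  have q2: "2 < q" "q - 2 = p" using p q by auto
  have G: "integrable lborel G" "(\<integral>z. G z \<partial>lborel) = 0"
    using green_identity[OF u K(1,2) r q2(1)] unfolding G_def by auto
  let ?c = "(1 - (cmod a)\<^sup>2) powr p"
  have meas: "(\<lambda>z. indicator (ball 0 1) z *\<^sub>R (F z * kern p a z)) \<in> borel_measurable lborel"
    if "continuous_on (ball 0 1) F" for F :: "complex \<Rightarrow> real"
  proof -
    have "(\<lambda>z. indicator (ball 0 1) z *\<^sub>R (F z * kern p a z)) \<in> borel_measurable borel"
      by (rule borel_measurable_continuous_on_indicator)
       (use that in \<open>auto intro!: continuous_intros continuous_on_kern a\<close>)
    then show ?thesis by simp
  qed
  have ind: "indicator (ball 0 1) z * ennreal (F z * kern p a z) = ennreal (indicator (ball 0 1) z *\<^sub>R (F z * kern p a z))"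
    for F and z :: complex by (auto simp: indicator_def)
  show ?thesis
    unfolding ind
  proof (rule nn_integral_le_if_integral_zero[where G = "\<lambda>z. \<sigma> * ?c * G z"])
    show "integrable lborel (\<lambda>z. \<sigma> * ?c * G z)" using G by simp
    show "(\<integral>z. \<sigma> * ?c * G z \<partial>lborel) = 0" using G by simp
    show "(\<lambda>z. indicator (ball 0 1) z *\<^sub>R (P z * kern p a z)) \<in> borel_measurable lborel" by (rule meas[OF P(1)])
    show "(\<lambda>z. indicator (ball 0 1) z *\<^sub>R (H z * kern p a z)) \<in> borel_measurable lborel" by (rule meas[OF H(1)])
    show "0 \<le> indicator (ball 0 1) z *\<^sub>R (P z * kern p a z)" for z using P by (auto simp: indicator_def kern_nonneg)
    show "0 \<le> indicator (ball 0 1) z *\<^sub>R (H z * kern p a z)" for z using H by (auto simp: indicator_def kern_nonneg)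
    show "indicator (ball 0 1) z *\<^sub>R (P z * kern p a z) \<le> \<sigma> * ?c * G z + indicator (ball 0 1) z *\<^sub>R (H z * kern p a z)" for z
    proof (cases "z \<in> ball 0 1")
      case True
      have "P z * kern p a z \<le> (\<sigma> * ((cmod (u z))\<^sup>2 * bump r z powr p *
       ((bump r z)\<^sup>2 * (cmod (k z))\<^sup>2 - q * bump r z * (1 + 2 * Re (z * k z)) + q * (q - 1) * (cmod z)\<^sup>2)
        - (cmod (deriv u z))\<^sup>2 * bump r z powr q) + H z) * kern p a z"
        by (intro mult_right_mono le True K(4) kern_nonneg)
      also have "\<dots> = \<sigma> * ?c * G z + H z * kern p a z"
        unfolding G_def K(3)[OF True] q2(2) by (simp add: algebra_simps)
      finally show ?thesis using True by simp
    next
      case False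
      then have "bump r z = 0" using r by (intro bump_eq_0) auto
      then show ?thesis using False q2 p by (simp add: G_def)
    qed
  qed
qed

section \<open>Transfer of the vanishing condition between a function and its derivative\<close>

lemma one_minus_norm_sq: "z \<in> ball 0 1 \<Longrightarrow> 0 < 1 - (cmod z)\<^sup>2" "z \<in> ball 0 1 \<Longrightarrow> 1 - (cmod z)\<^sup>2 \<le> 1"
  by (auto simp: abs_square_less_1)

lemma continuous_on_rho_powr: "continuous_on (ball 0 1) (\<lambda>z::complex. (1 - (cmod z)\<^sup>2) powr s)"
  by (intro continuous_intros) (use one_minus_norm_sq(1) in force)

lemma continuous_on_holo_norm:
  assumes "f holomorphic_on ball 0 1" shows "continuous_on (ball 0 1) (\<lambda>z. (cmod (f z))\<^sup>2)"
  using assms by (intro continuous_intros holomorphic_on_imp_continuous_on)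

text \<open>The easy direction: the upper bound on the Green factor, used with \<sigma> = -1,
  dominates |u'|^2 by a multiple of |u|^2 in the mean. Applied to u = w' it supplies the condition
  on w''.\<close>

lemma vanishing_deriv:
  assumes u: "u holomorphic_on ball 0 1" and p: "0 < p"
    and v: "vanishing p (\<lambda>z. (cmod (u z))\<^sup>2 * (1 - (cmod z)\<^sup>2) powr p)"
  shows "vanishing p (\<lambda>z. (cmod (deriv u z))\<^sup>2 * (1 - (cmod z)\<^sup>2) powr (2 + p))"
proof -
  define q where "q = 2 + p"
  define C where "C = 4 * p\<^sup>2 + 4 * p * q + q * (q - 1)"
  have C: "0 \<le> C" using p by (simp add: C_def q_def)
  have u': "deriv u holomorphic_on ball 0 1" using u by (auto intro: holomorphic_deriv)
  let ?H = "\<lambda>z. C * ((cmod (u z))\<^sup>2 * (1 - (cmod z)\<^sup>2) powr p)"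
  have cH: "continuous_on (ball 0 1) (\<lambda>z. (cmod (u z))\<^sup>2 * (1 - (cmod z)\<^sup>2) powr p)"
    by (intro continuous_intros continuous_on_holo_norm continuous_on_rho_powr u)
  have "vanishing p ?H" by (rule vanishing_cmult[OF v cH C])
  then show ?thesis unfolding vanishing_def
  proof (rule tends_zero_at_boundary_mono)
    fix a :: complex assume a: "a \<in> ball 0 1"
    let ?B = "\<integral>\<^sup>+ z. indicator (ball 0 1) z * ennreal (?H z * kern p a z) \<partial>lborel"
    have "(\<integral>\<^sup>+ z. indicator (ball 0 1) z * ennreal (((cmod (deriv u z))\<^sup>2 * kern p a z) * (1 - (cmod z)\<^sup>2) powr q) \<partial>lborel) \<le> ?B"
    proof (rule nn_integral_bump_limit)
      show "continuous_on (ball 0 1) (\<lambda>z. (cmod (deriv u z))\<^sup>2 * kern p a z)"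
        by (intro continuous_intros continuous_on_holo_norm u' continuous_on_kern a)
      show "0 < q" using p by (simp add: q_def)
      fix r :: real assume r: "0 < r" "r < 1"
      have "(\<integral>\<^sup>+ z. ennreal ((cmod (deriv u z))\<^sup>2 * kern p a z * bump r z powr q) \<partial>lborel)
         = (\<integral>\<^sup>+ z. indicator (ball 0 1) z * ennreal ((cmod (deriv u z))\<^sup>2 * bump r z powr q * kern p a z) \<partial>lborel)"
        by (rule nn_integral_cong) (use r \<open>0 < q\<close> in \<open>auto simp: indicator_def bump_eq_0 mult_ac\<close>)
      also have "\<dots> \<le> ?B"
      proof (rule nn_integral_green_le[OF u a r p q_def, where \<sigma> = "-1"])
        show "continuous_on (ball 0 1) (\<lambda>z. (cmod (deriv u z))\<^sup>2 * bump r z powr q)"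
          by (intro continuous_intros continuous_on_holo_norm u' continuous_on_bump_powr \<open>0 < q\<close>)
        show "continuous_on (ball 0 1) ?H" by (intro continuous_intros cH)
        show "0 \<le> ?H z" for z using C by simp
        fix z k assume z: "z \<in> ball 0 1" and k: "cmod k \<le> p / cmod (1 - cnj a * z)"
        let ?E = "(bump r z)\<^sup>2 * (cmod k)\<^sup>2 - q * bump r z * (1 + 2 * Re (z * k)) + q * (q - 1) * (cmod z)\<^sup>2"
        have "?E \<le> C" unfolding C_def by (rule green_factor_bounds(1)[OF a z r p q_def k])
        then have "(cmod (u z))\<^sup>2 * bump r z powr p * ?E \<le> (cmod (u z))\<^sup>2 * bump r z powr p * C"
          by (intro mult_left_mono) auto
        also have "\<dots> \<le> (cmod (u z))\<^sup>2 * (1 - (cmod z)\<^sup>2) powr p * C"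
          by (intro mult_right_mono mult_left_mono powr_mono2 bump_le C z r bump_nonneg) (use p in auto)
        finally show "(cmod (deriv u z))\<^sup>2 * bump r z powr q \<le> - 1 * ((cmod (u z))\<^sup>2 * bump r z powr p * ?E
            - (cmod (deriv u z))\<^sup>2 * bump r z powr q) + ?H z"
          by (simp add: mult_ac)
      qed auto
      finally show "(\<integral>\<^sup>+ z. ennreal ((cmod (deriv u z))\<^sup>2 * kern p a z * bump r z powr q) \<partial>lborel) \<le> ?B" .
    qed (auto simp: kern_nonneg)
    then show "(\<integral>\<^sup>+ z. indicator (ball 0 1) z * ennreal ((cmod (deriv u z))\<^sup>2 * (1 - (cmod z)\<^sup>2) powr (2 + p) * kern p a z) \<partial>lborel) \<le> ?B"
      by (simp add: q_def mult_ac)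
  qed
qed

text \<open>With rho = 1 - |z|^2, the bound |1 - cnj a z| >= rho/2 makes the integrand at most
  2^(2p) (1 - |a|^2)^p rho^(2-p), uniformly small as |a| tends to 1. This pays for a compact part of
  the disc, where the Green factor may be negative.\<close>

lemma vanishing_rho:
  assumes p: "0 < p" "p \<le> 2"
  shows "vanishing p (\<lambda>z. (1 - (cmod z)\<^sup>2) powr (2 + p))"
  unfolding vanishing_def tends_zero_at_boundary_def
proof (intro allI impI)
  fix e :: real assume e: "0 < e"
  define A where "A = measure lborel (ball (0::complex) 1) + 1"
  have A: "0 < A" by (simp add: A_def add_nonneg_pos)
  define d where "d = e / (2 powr (2 * p) * A)"
  have d: "0 < d" using e A by (simp add: d_def)
  \<comment> \<open>Since 1 - |a|^2 <= 2(1 - |a|), this choice gives (1 - |a|^2)^p < d whenever |a|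
    > r.\<close>
  define r where "r = 1 - d powr (1 / p) / 2"
  have "(\<integral>\<^sup>+ z. indicator (ball 0 1) z * ennreal ((1 - (cmod z)\<^sup>2) powr (2 + p) * kern p a z) \<partial>lborel) < ennreal e"
    if a: "r < cmod a" "cmod a < 1" for a
  proof -
    define c where "c = (1 - (cmod a)\<^sup>2) powr p"
    have aD: "a \<in> ball 0 1" using a by simp
    have "1 - (cmod a)\<^sup>2 = (1 - cmod a) * (1 + cmod a)" by (simp add: power2_eq_square algebra_simps)
    also have "\<dots> \<le> (1 - cmod a) * 2" using a by (intro mult_left_mono) auto
    also have "\<dots> < d powr (1 / p)" using a by (simp add: r_def)
    finally have "c < (d powr (1/p)) powr p"
      unfolding c_def using one_minus_norm_sq(1)[OF aD] p by (intro powr_less_mono2) auto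
    then have c: "c < d" using p d by (simp add: powr_powr)
    have le: "(1 - (cmod z)\<^sup>2) powr (2 + p) * kern p a z \<le> 2 powr (2 * p) * c" if z: "z \<in> ball 0 1" for z
    proof -
      let ?w = "1 - (cmod z)\<^sup>2" and ?l = "cmod (1 - cnj a * z)"
      note w = one_minus_norm_sq[OF z] and l = one_minus_cnj_mult[OF aD z]
      have "?l powr (- 2 * p) \<le> (?w / 2) powr (- 2 * p)"
        using l w p by (intro powr_mono2') auto
      also have "\<dots> = 2 powr (2 * p) * ?w powr (- 2 * p)"
        using w by (simp add: powr_divide powr_minus divide_simps)
      finally have "?w powr (2 + p) * (c * ?l powr (- 2 * p)) \<le> ?w powr (2 + p) * (c * (2 powr (2 * p) * ?w powr (- 2 * p)))"
        by (intro mult_left_mono) (auto simp: c_def)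
      also have "\<dots> = 2 powr (2 * p) * c * ?w powr (2 - p)" by (simp flip: powr_add)
      also have "\<dots> \<le> 2 powr (2 * p) * c * 1"
        using w p by (intro mult_left_mono powr_le1) (auto simp: c_def)
      finally show ?thesis by (simp add: kern_def c_def)
    qed
    have "(\<integral>\<^sup>+ z. indicator (ball 0 1) z * ennreal ((1 - (cmod z)\<^sup>2) powr (2 + p) * kern p a z) \<partial>lborel)
       \<le> (\<integral>\<^sup>+ z. ennreal (2 powr (2 * p) * c) * indicator (ball (0::complex) 1) z \<partial>lborel)"
      by (intro nn_integral_mono) (auto simp: indicator_def intro!: ennreal_leI le)
    also have "\<dots> = ennreal (2 powr (2 * p) * c) * emeasure lborel (ball (0::complex) 1)"
      by (rule nn_integral_cmult_indicator) auto
    also have "\<dots> = ennreal (2 powr (2 * p) * c * measure lborel (ball (0::complex) 1))"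
      using emeasure_lborel_ball_finite[of "0::complex" 1]
      by (simp add: emeasure_eq_ennreal_measure ennreal_mult'' less_top)
    also have "\<dots> < ennreal e"
    proof (rule ennreal_lessI[OF e])
      have "2 powr (2 * p) * c * measure lborel (ball (0::complex) 1) \<le> 2 powr (2 * p) * c * A"
        by (intro mult_left_mono) (auto simp: A_def c_def)
      also have "\<dots> < 2 powr (2 * p) * d * A" using c A by simp
      finally show "2 powr (2 * p) * c * measure lborel (ball (0::complex) 1) < e" using A by (simp add: d_def)
    qed
    finally show ?thesis .
  qed
  then show "\<exists>r<1. \<forall>a. r < cmod a \<longrightarrow> cmod a < 1 \<longrightarrow>
     (\<integral>\<^sup>+ z. indicator (ball 0 1) z * ennreal ((1 - (cmod z)\<^sup>2) powr (2 + p) * kern p a z) \<partial>lborel) < ennreal e"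
    using d by (intro exI[of _ r]) (auto simp: r_def)
qed

text \<open>With X and Y the cut-off integrands of |u|^2 and |u'|^2, it suffices to prove X <= 2(X E
  - Y) + H pointwise, because the Green term integrates to zero. Near the circle u' = S + u^2/2
  gives Y <= 2|S|^2 (1 - |z|^2)^q + X/2; where E >= 1, the doubled Green term is then at least X -
  4|S|^2 (1 - |z|^2)^q. That is the reason for the factor 2. \<open>H\<close> collects the S term,
  the compact part and the cone.\<close>

lemma vanishing_of_riccati:
  assumes u: "u holomorphic_on ball 0 1" and p: "0 < p" "p \<le> 1"
    and little: "\<And>e. 0 < e \<Longrightarrow> \<exists>r<1. \<forall>z. r < cmod z \<longrightarrow> cmod z < 1 \<longrightarrow> (cmod (u z))\<^sup>2 * (1 - (cmod z)\<^sup>2)\<^sup>2 \<le> e"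
    and v: "vanishing p (\<lambda>z. (cmod (deriv u z - (u z)\<^sup>2 / 2))\<^sup>2 * (1 - (cmod z)\<^sup>2) powr (2 + p))"
  shows "vanishing p (\<lambda>z. (cmod (u z))\<^sup>2 * (1 - (cmod z)\<^sup>2) powr p)"
  unfolding vanishing_def tends_zero_at_boundary_def
proof (intro allI impI)
  fix e :: real assume e: "0 < e"
  define q where "q = 2 + p"
  have q0: "2 < q" "0 < q" using p by (auto simp: q_def)
  define S where "S z = deriv u z - (u z)\<^sup>2 / 2" for z
  have u': "deriv u holomorphic_on ball 0 1" using u by (auto intro: holomorphic_deriv)
  have S: "S holomorphic_on ball 0 1" unfolding S_def by (intro holomorphic_intros u u') auto
  obtain C0 where C0: "0 \<le> C0" "\<And>a. 1/2 \<le> cmod a \<Longrightarrow> cmod a < 1 \<Longrightarrow>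
    (\<integral>\<^sup>+ z. indicator (ball 0 1) z * ennreal (cmod (1 - cnj a * z) powr (p - 2) * kern p a z) \<partial>lborel) \<le> ennreal C0"
    using kern_integral_bound[OF p(1)] by blast
  define m where "m = q\<^sup>2 + 2 * q * p"
  have m: "1 < m"
  proof -
    have "1 * 1 < q * q" using q0 by (intro mult_strict_mono) auto
    moreover have "0 < 2 * q * p" using q0 p by simp
    ultimately show ?thesis unfolding m_def power2_eq_square by linarith
  qed
  define M where "M = q + 4 * q * p"
  have M: "0 \<le> M" using q0 p by (simp add: M_def)
  \<comment> \<open>Inside the cone 2X - 2XE <= 2(1 + M) X, and X <= \<epsilon> m^(2-p) |1 - cnj a
    z|^(p-2); C is the product of these constants.\<close>
  define C where "C = 2 * (1 + M) * m powr (2 - p)"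
  have C: "0 < C" using M m by (simp add: C_def)
  \<comment> \<open>The cap 1 gives |u|^2 bump^2 <= 1, which reduces the u^4 term to X/2; the other
    entry keeps the contribution of the cone below e.\<close>
  define \<epsilon> where "\<epsilon> = min 1 (e / (2 * C * (C0 + 1)))"
  have eps: "0 < \<epsilon>" "\<epsilon> \<le> 1" using e C C0 by (auto simp: \<epsilon>_def)
  have epsC: "C * \<epsilon> * C0 < e"
  proof -
    have "C * \<epsilon> * C0 \<le> C * (e / (2 * C * (C0 + 1))) * C0"
      using C C0 by (intro mult_right_mono mult_left_mono) (auto simp: \<epsilon>_def)
    also have "\<dots> = e * (C0 / (2 * (C0 + 1)))"
    proof -
      have "C \<noteq> 0" "C0 + 1 \<noteq> 0" using C C0(1) by auto
      then show ?thesis by (simp add: divide_simps)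
    qed
    also have "\<dots> < e * 1" using e C0 by (intro mult_strict_left_mono) (auto simp: field_simps)
    finally show ?thesis by simp
  qed
  obtain r0 where r0: "r0 < 1" "\<And>z. r0 < cmod z \<Longrightarrow> cmod z < 1 \<Longrightarrow> (cmod (u z))\<^sup>2 * (1 - (cmod z)\<^sup>2)\<^sup>2 \<le> \<epsilon>"
    using little[OF eps(1)] by blast
  \<comment> \<open>Beyond r1 the function u is small and m (1 - |z|^2) <= 1, the first extra
    hypothesis of the third bound in \<open>green_factor_bounds\<close>.\<close>
  define r1 where "r1 = max (max 0 r0) (sqrt (1 - 1 / m))"
  have r1: "0 \<le> r1" "r1 < 1" "r0 \<le> r1" using r0(1) m by (auto simp: r1_def)
  have r1w: "m * (1 - (cmod z)\<^sup>2) \<le> 1" if "r1 < cmod z" for z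
  proof -
    have "(sqrt (1 - 1/m))\<^sup>2 \<le> (cmod z)\<^sup>2" using that m by (intro power_mono) (auto simp: r1_def)
    then have "1 - 1/m \<le> (cmod z)\<^sup>2" using m by simp
    then show ?thesis using m by (simp add: field_simps)
  qed
  have "\<exists>B. \<forall>z\<in>cball 0 r1. 2 * ((cmod (u z))\<^sup>2 * (1 + M) + (cmod (deriv u z))\<^sup>2) \<le> B"
  proof -
    have sub: "cball 0 r1 \<subseteq> ball (0::complex) 1" using r1 by auto
    have "compact ((\<lambda>z. 2 * ((cmod (u z))\<^sup>2 * (1 + M) + (cmod (deriv u z))\<^sup>2)) ` cball 0 r1)"
      by (intro compact_continuous_image continuous_intros continuous_on_subset[OF continuous_on_holo_norm sub] u u') auto
    then show ?thesis
      by (meson bdd_above.E bounded_imp_bdd_above compact_imp_bounded imageI)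
  qed
  then obtain B where B: "\<And>z. z \<in> cball 0 r1 \<Longrightarrow> 2 * ((cmod (u z))\<^sup>2 * (1 + M) + (cmod (deriv u z))\<^sup>2) \<le> B" by blast
  have B0: "0 \<le> B" using B[of 0] r1 M by (auto intro: order_trans[rotated])
  \<comment> \<open>On |z| <= r1 the weight (1 - |z|^2)^q is bounded below, so the constant B can be
    traded for a multiple of a weight that is known to vanish.\<close>
  define B' where "B' = B / (1 - r1\<^sup>2) powr q"
  have r1': "0 < 1 - r1\<^sup>2" using r1 by (simp add: abs_square_less_1)
  have B'0: "0 \<le> B'" using B0 by (simp add: B'_def)
  have B': "B \<le> B' * (1 - (cmod z)\<^sup>2) powr q" if "cmod z \<le> r1" for z
  proof -
    have "(1 - r1\<^sup>2) powr q \<le> (1 - (cmod z)\<^sup>2) powr q"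
      using that r1 r1' q0 by (intro powr_mono2) (auto intro: power_mono)
    then have "B' * (1 - r1\<^sup>2) powr q \<le> B' * (1 - (cmod z)\<^sup>2) powr q"
      using B'0 by (rule mult_left_mono)
    then show ?thesis using r1' by (simp add: B'_def)
  qed
  define J where "J z = 4 * ((cmod (S z))\<^sup>2 * (1 - (cmod z)\<^sup>2) powr q) + B' * (1 - (cmod z)\<^sup>2) powr q" for z
  have cJ: "continuous_on (ball 0 1) J"
    unfolding J_def by (intro continuous_intros continuous_on_holo_norm continuous_on_rho_powr S)
  have "vanishing p J"
  proof -
    have cS: "continuous_on (ball 0 1) (\<lambda>z. (cmod (S z))\<^sup>2 * (1 - (cmod z)\<^sup>2) powr q)"
      by (intro continuous_on_mult continuous_on_holo_norm continuous_on_rho_powr S)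
    have "vanishing p (\<lambda>z. 4 * ((cmod (S z))\<^sup>2 * (1 - (cmod z)\<^sup>2) powr q))"
      using v cS unfolding S_def q_def by (rule vanishing_cmult) simp
    moreover have "vanishing p (\<lambda>z. (1 - (cmod z)\<^sup>2) powr q)"
      using vanishing_rho[of p] p by (simp add: q_def)
    then have "vanishing p (\<lambda>z. B' * (1 - (cmod z)\<^sup>2) powr q)"
      using continuous_on_rho_powr B'0 by (rule vanishing_cmult)
    ultimately show ?thesis
      unfolding J_def by (rule vanishing_add[OF _ continuous_on_mult[OF continuous_on_const cS] _ continuous_on_mult[OF continuous_on_const continuous_on_rho_powr]])
  qed
  then have "\<exists>r<1. \<forall>a. r < cmod a \<longrightarrow> cmod a < 1 \<longrightarrow>
      (\<integral>\<^sup>+ z. indicator (ball 0 1) z * ennreal (J z * kern p a z) \<partial>lborel) < ennreal (e - C * \<epsilon> * C0)"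
    unfolding vanishing_def tends_zero_at_boundary_def using epsC by (metis diff_gt_0_iff_gt)
  then obtain r2 where r2: "r2 < 1" "\<And>a. r2 < cmod a \<Longrightarrow> cmod a < 1 \<Longrightarrow>
      (\<integral>\<^sup>+ z. indicator (ball 0 1) z * ennreal (J z * kern p a z) \<partial>lborel) < ennreal (e - C * \<epsilon> * C0)" by blast
  have "(\<integral>\<^sup>+ z. indicator (ball 0 1) z * ennreal ((cmod (u z))\<^sup>2 * (1 - (cmod z)\<^sup>2) powr p * kern p a z) \<partial>lborel) < ennreal e"
    if a': "max (1/2) r2 < cmod a" "cmod a < 1" for a
  proof -
    have a: "a \<in> ball 0 1" using a' by simp
    define H where "H z = J z + C * \<epsilon> * cmod (1 - cnj a * z) powr (p - 2)" for z
    have cl: "continuous_on (ball 0 1) (\<lambda>z. cmod (1 - cnj a * z) powr (p - 2))"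
      by (intro continuous_intros) (use one_minus_cnj_mult(4)[OF a] in force)
    have cH: "continuous_on (ball 0 1) H" unfolding H_def by (intro continuous_intros cJ cl)
    have J0: "0 \<le> J z" for z using B'0 by (simp add: J_def)
    have H0: "0 \<le> H z" for z using J0 C eps by (simp add: H_def)
    let ?B = "\<integral>\<^sup>+ z. indicator (ball 0 1) z * ennreal (H z * kern p a z) \<partial>lborel"
    have "(\<integral>\<^sup>+ z. indicator (ball 0 1) z * ennreal (((cmod (u z))\<^sup>2 * kern p a z) * (1 - (cmod z)\<^sup>2) powr p) \<partial>lborel) \<le> ?B"
    proof (rule nn_integral_bump_limit)
      show "continuous_on (ball 0 1) (\<lambda>z. (cmod (u z))\<^sup>2 * kern p a z)"
        by (intro continuous_intros continuous_on_holo_norm u continuous_on_kern a)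
      show "0 < p" by fact
      fix r :: real assume r: "0 < r" "r < 1"
      have "(\<integral>\<^sup>+ z. ennreal ((cmod (u z))\<^sup>2 * kern p a z * bump r z powr p) \<partial>lborel)
         = (\<integral>\<^sup>+ z. indicator (ball 0 1) z * ennreal ((cmod (u z))\<^sup>2 * bump r z powr p * kern p a z) \<partial>lborel)"
        by (rule nn_integral_cong) (use r p in \<open>auto simp: indicator_def bump_eq_0 mult_ac\<close>)
      also have "\<dots> \<le> ?B"
      proof (rule nn_integral_green_le[OF u a r p(1) q_def, where \<sigma> = "2"])
        show "continuous_on (ball 0 1) (\<lambda>z. (cmod (u z))\<^sup>2 * bump r z powr p)"
          by (intro continuous_intros continuous_on_holo_norm u continuous_on_bump_powr p)
        show "continuous_on (ball 0 1) H" by (rule cH)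
        show "0 \<le> H z" for z by (rule H0)
        fix z k assume z: "z \<in> ball 0 1" and k: "cmod k \<le> p / cmod (1 - cnj a * z)"
        define E where "E = (bump r z)\<^sup>2 * (cmod k)\<^sup>2 - q * bump r z * (1 + 2 * Re (z * k)) + q * (q - 1) * (cmod z)\<^sup>2"
        define X where "X = (cmod (u z))\<^sup>2 * bump r z powr p"
        define Y where "Y = (cmod (deriv u z))\<^sup>2 * bump r z powr q"
        note w = one_minus_norm_sq[OF z] and bl = bump_le[OF r(2,1) z] and b0 = bump_nonneg[of r z]
        have X0: "0 \<le> X" "0 \<le> Y" by (auto simp: X_def Y_def)
        have E1: "E \<ge> - M" unfolding E_def M_def by (rule green_factor_bounds(2)[OF a z r p(1) q_def k])
        have CE: "0 \<le> C * \<epsilon> * cmod (1 - cnj a * z) powr (p - 2)" using C eps by simp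
        have "X \<le> 2 * (X * E - Y) + H z"
        proof (cases "cmod z \<le> r1")
          case True
          have b1: "bump r z \<le> 1" using bl w by linarith
          have "bump r z powr p \<le> 1" "bump r z powr q \<le> 1" using b0 b1 p q0 by (auto intro!: powr_le1)
          then have XY: "X \<le> (cmod (u z))\<^sup>2" "Y \<le> (cmod (deriv u z))\<^sup>2"
            unfolding X_def Y_def by (auto intro: mult_left_le)
          have "X * (- M) \<le> X * E" using E1 X0 by (intro mult_left_mono) auto
          then have "X - 2 * (X * E - Y) \<le> 2 * (X * (1 + M) + Y)" using X0 by (simp add: algebra_simps)
          also have "\<dots> \<le> 2 * ((cmod (u z))\<^sup>2 * (1 + M) + (cmod (deriv u z))\<^sup>2)"
            using XY M by (intro mult_left_mono add_mono mult_right_mono) auto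
          also have "\<dots> \<le> B" by (rule B) (use True in auto)
          also have "\<dots> \<le> B' * (1 - (cmod z)\<^sup>2) powr q" by (rule B'[OF True])
          also have "\<dots> \<le> H z" using CE unfolding H_def J_def by simp
          finally show ?thesis by simp
        next
          case False
          then have z1: "r1 < cmod z" by simp
          have ue: "(cmod (u z))\<^sup>2 * (1 - (cmod z)\<^sup>2)\<^sup>2 \<le> \<epsilon>" using r0(2)[of z] z z1 r1 by auto
          have bq: "bump r z powr q = bump r z powr p * (bump r z)\<^sup>2"
            using b0 unfolding q_def by (simp add: powr_add)
          have ub: "(cmod (u z))\<^sup>2 * (bump r z)\<^sup>2 \<le> 1"
          proof -
            have "(cmod (u z))\<^sup>2 * (bump r z)\<^sup>2 \<le> (cmod (u z))\<^sup>2 * (1 - (cmod z)\<^sup>2)\<^sup>2"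
              by (intro mult_left_mono power_mono bl b0) auto
            then show ?thesis using ue eps by linarith
          qed
          have Y: "Y \<le> 2 * ((cmod (S z))\<^sup>2 * (1 - (cmod z)\<^sup>2) powr q) + X / 2"
          proof -
            have "cmod (deriv u z) \<le> cmod (S z) + cmod ((u z)\<^sup>2 / 2)"
              using norm_triangle_ineq[of "S z" "(u z)\<^sup>2 / 2"] by (simp add: S_def)
            then have "(cmod (deriv u z))\<^sup>2 \<le> (cmod (S z) + cmod ((u z)\<^sup>2 / 2))\<^sup>2" by (intro power_mono) auto
            also have "\<dots> \<le> 2 * (cmod (S z))\<^sup>2 + 2 * (cmod ((u z)\<^sup>2 / 2))\<^sup>2"
              using sum_squares_ge_zero[of "cmod (S z) - cmod ((u z)\<^sup>2 / 2)" 0] by (simp add: power2_eq_square algebra_simps)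
            also have "(cmod ((u z)\<^sup>2 / 2))\<^sup>2 = ((cmod (u z))\<^sup>2)\<^sup>2 / 4"
              by (simp add: norm_divide norm_power power_divide)
            finally have "(cmod (deriv u z))\<^sup>2 \<le> 2 * (cmod (S z))\<^sup>2 + (cmod (u z))\<^sup>2 * (cmod (u z))\<^sup>2 / 2"
              by (simp add: power2_eq_square)
            then have "Y \<le> (2 * (cmod (S z))\<^sup>2 + (cmod (u z))\<^sup>2 * (cmod (u z))\<^sup>2 / 2) * bump r z powr q"
              unfolding Y_def by (intro mult_right_mono) auto
            also have "\<dots> = 2 * ((cmod (S z))\<^sup>2 * bump r z powr q) + X / 2 * ((cmod (u z))\<^sup>2 * (bump r z)\<^sup>2)"
              unfolding X_def bq by (simp add: algebra_simps)
            also have "\<dots> \<le> 2 * ((cmod (S z))\<^sup>2 * (1 - (cmod z)\<^sup>2) powr q) + X / 2 * 1"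
              using X0 q0 by (intro add_mono mult_left_mono powr_mono2 bl b0 ub) auto
            finally show ?thesis by simp
          qed
          show ?thesis
          proof (cases "m * (1 - (cmod z)\<^sup>2) \<le> cmod (1 - cnj a * z)")
            case True
            have "E \<ge> 1" unfolding E_def
              by (rule green_factor_bounds(3)[OF a z r p(1) q_def k]) (use True r1w[OF z1] in \<open>auto simp: m_def\<close>)
            then have "X * 1 \<le> X * E" using X0 by (intro mult_left_mono) auto
            moreover have "H z \<ge> 4 * ((cmod (S z))\<^sup>2 * (1 - (cmod z)\<^sup>2) powr q)"
              using CE B'0 by (simp add: H_def J_def)
            ultimately show ?thesis using Y by argo
          next
            case False
            let ?w = "1 - (cmod z)\<^sup>2" and ?l = "cmod (1 - cnj a * z)"
            have l: "0 < ?l" by (rule one_minus_cnj_mult(4)[OF a z])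
            \<comment> \<open>The exponent p - 2 is negative, so the cone condition |1 - cnj a z| <
              m (1 - |z|^2) becomes an upper bound for (1 - |z|^2)^(p-2).\<close>
            have wp: "?w powr (p - 2) \<le> (?l / m) powr (p - 2)"
              using False l m p w by (intro powr_mono2') (auto simp: field_simps)
            have "(?l / m) powr (p - 2) = m powr (2 - p) * ?l powr (p - 2)"
              using l m by (simp add: powr_divide powr_diff field_simps)
            then have wp': "?w powr (p - 2) \<le> m powr (2 - p) * ?l powr (p - 2)" using wp by simp
            have "?w powr p = ?w\<^sup>2 * ?w powr (p - 2)"
              using w by (simp add: powr_diff)
            then have "X \<le> (cmod (u z))\<^sup>2 * (?w\<^sup>2 * ?w powr (p - 2))"
              using bl b0 p unfolding X_def by (metis mult_left_mono powr_mono2 zero_le_power2 less_imp_le)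
            also have "\<dots> = ((cmod (u z))\<^sup>2 * ?w\<^sup>2) * ?w powr (p - 2)" by simp
            also have "\<dots> \<le> \<epsilon> * (m powr (2 - p) * ?l powr (p - 2))"
              by (intro mult_mono ue wp') (use eps in auto)
            finally have "2 * (1 + M) * X \<le> 2 * (1 + M) * (\<epsilon> * (m powr (2 - p) * ?l powr (p - 2)))"
              using M by (intro mult_left_mono) auto
            then have XC: "2 * (1 + M) * X \<le> C * \<epsilon> * ?l powr (p - 2)" by (simp add: C_def algebra_simps)
            have "X * (- M) \<le> X * E" using E1 X0 by (intro mult_left_mono) auto
            then have "X - 2 * (X * E) + X \<le> 2 * (1 + M) * X" by (simp add: algebra_simps)
            moreover have "H z \<ge> 4 * ((cmod (S z))\<^sup>2 * ?w powr q) + C * \<epsilon> * ?l powr (p - 2)"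
              using B'0 by (simp add: H_def J_def)
            ultimately show ?thesis using Y XC by argo
          qed
        qed
        then show "(cmod (u z))\<^sup>2 * bump r z powr p \<le> 2 * ((cmod (u z))\<^sup>2 * bump r z powr p *
           ((bump r z)\<^sup>2 * (cmod k)\<^sup>2 - q * bump r z * (1 + 2 * Re (z * k)) + q * (q - 1) * (cmod z)\<^sup>2)
            - (cmod (deriv u z))\<^sup>2 * bump r z powr q) + H z"
          by (simp only: X_def Y_def E_def)
      qed auto
      finally show "(\<integral>\<^sup>+ z. ennreal ((cmod (u z))\<^sup>2 * kern p a z * bump r z powr p) \<partial>lborel) \<le> ?B" .
    qed (auto simp: kern_nonneg)
    also have "?B = (\<integral>\<^sup>+ z. indicator (ball 0 1) z * ennreal (J z * kern p a z)
        + ennreal (C * \<epsilon>) * (indicator (ball 0 1) z * ennreal (cmod (1 - cnj a * z) powr (p - 2) * kern p a z)) \<partial>lborel)"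
    proof (rule nn_integral_cong)
      fix z :: complex
      have "ennreal (H z * kern p a z) = ennreal (J z * kern p a z) + ennreal (C * \<epsilon>) * ennreal (cmod (1 - cnj a * z) powr (p - 2) * kern p a z)"
        using J0 C eps kern_nonneg[of p a z] unfolding H_def
        by (simp add: distrib_right mult.assoc flip: ennreal_plus ennreal_mult'')
      then show "indicator (ball 0 1) z * ennreal (H z * kern p a z) = indicator (ball 0 1) z * ennreal (J z * kern p a z)
        + ennreal (C * \<epsilon>) * (indicator (ball 0 1) z * ennreal (cmod (1 - cnj a * z) powr (p - 2) * kern p a z))"
        by (auto simp: indicator_def)
    qed
    also have "\<dots> = (\<integral>\<^sup>+ z. indicator (ball 0 1) z * ennreal (J z * kern p a z) \<partial>lborel)
        + ennreal (C * \<epsilon>) * (\<integral>\<^sup>+ z. indicator (ball 0 1) z * ennreal (cmod (1 - cnj a * z) powr (p - 2) * kern p a z) \<partial>lborel)"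
    proof -
      have 1: "(\<lambda>z. indicator (ball 0 1) z * ennreal (J z * kern p a z)) \<in> borel_measurable lborel"
        by (intro measurable_indicator_ball continuous_intros cJ continuous_on_kern a)
      have 2: "(\<lambda>z. indicator (ball 0 1) z * ennreal (cmod (1 - cnj a * z) powr (p - 2) * kern p a z)) \<in> borel_measurable lborel"
        by (intro measurable_indicator_ball continuous_on_mult cl continuous_on_kern a)
      show ?thesis
        unfolding nn_integral_add[OF 1 borel_measurable_times_ennreal[OF borel_measurable_const 2]] nn_integral_cmult[OF 2] by simp
    qed
    also have "\<dots> \<le> (\<integral>\<^sup>+ z. indicator (ball 0 1) z * ennreal (J z * kern p a z) \<partial>lborel) + ennreal (C * \<epsilon>) * ennreal C0"
      by (intro add_left_mono mult_left_mono C0) (use a' in auto)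
    also have "\<dots> = ennreal (C * \<epsilon> * C0) + (\<integral>\<^sup>+ z. indicator (ball 0 1) z * ennreal (J z * kern p a z) \<partial>lborel)"
      using C eps C0 by (simp add: ennreal_mult'' add.commute)
    also have "\<dots> < ennreal (C * \<epsilon> * C0) + ennreal (e - C * \<epsilon> * C0)"
      using r2(2)[of a] a' by (simp add: ennreal_add_left_cancel_less)
    also have "\<dots> = ennreal e" using epsC C eps C0 by (simp flip: ennreal_plus)
    finally show ?thesis by (simp add: mult_ac)
  qed
  then show "\<exists>r<1. \<forall>a. r < cmod a \<longrightarrow> cmod a < 1 \<longrightarrow>
     (\<integral>\<^sup>+ z. indicator (ball 0 1) z * ennreal ((cmod (u z))\<^sup>2 * (1 - (cmod z)\<^sup>2) powr p * kern p a z) \<partial>lborel) < ennreal e"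
    using r2(1) by (intro exI[of _ "max (1/2) r2"]) auto
qed

section \<open>Pointwise decay from a vanishing Carleson condition\<close>

text \<open>The weighted mean value property of F^2, rescaled from the disc of radius s and cut off
  at half its radius; c is the integral of \<open>bump (1/2)\<close>.\<close>

lemma submean_value:
  obtains c where "0 < c" "\<And>F a s. 0 < s \<Longrightarrow> F holomorphic_on ball a s \<Longrightarrow>
     ennreal (c * s\<^sup>2 * (cmod (F a))\<^sup>2) \<le> (\<integral>\<^sup>+ z. indicator (ball a (s / 2)) z * ennreal ((cmod (F z))\<^sup>2) \<partial>lborel)"
proof -
  define I where "I = (\<integral>z. bump (1/2) z \<partial>lborel)"
  have ib: "integrable lborel (bump (1/2))"
  proof (rule continuous_on_imp_integrable_lborel)
    show "continuous_on (cball 0 (1/2)) (bump (1/2))" unfolding bump_def by (intro continuous_intros)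
  qed (auto intro: bump_eq_0)
  have I: "0 < I"
  proof -
    have "0 < measure lborel (ball (0::complex) (1/4)) * (1/8)"
      by (simp add: content_ball_pos)
    also have "\<dots> = (\<integral>z. indicator (ball (0::complex) (1/4)) z * (1/8) \<partial>lborel)"
      by simp
    also have "\<dots> \<le> I" unfolding I_def
    proof (rule integral_mono)
      show "integrable lborel (\<lambda>z. indicator (ball (0::complex) (1/4)) z * (1/8::real))"
        using emeasure_lborel_ball_finite[of "0::complex" "1/4"] by auto
      fix z :: complex
      have "(cmod z)\<^sup>2 \<le> (1/4)\<^sup>2" if "cmod z < 1/4" using that by (intro power_mono) auto
      then show "indicator (ball 0 (1/4)) z * (1/8) \<le> bump (1/2) z"
        by (auto simp: bump_def indicator_def power2_eq_square)
    qed (rule ib)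
    finally show ?thesis .
  qed
  show ?thesis
  proof (rule that[OF I])
    fix F :: "complex \<Rightarrow> complex" and a :: complex and s :: real
    assume s: "0 < s" and F: "F holomorphic_on ball a s"
    define G where "G z = (F (a + s *\<^sub>R z))\<^sup>2" for z
    have G: "G holomorphic_on ball 0 1"
    proof -
      have "(F \<circ> (\<lambda>z. a + of_real s * z)) holomorphic_on ball 0 1"
      proof (rule holomorphic_on_compose_gen[OF _ F])
        show "(\<lambda>z. a + of_real s * z) holomorphic_on ball 0 1" by (intro holomorphic_intros)
        show "(\<lambda>z. a + of_real s * z) ` ball 0 1 \<subseteq> ball a s" using s by (auto simp: dist_norm norm_mult)
      qed
      then have "(\<lambda>z. F (a + s *\<^sub>R z)) holomorphic_on ball 0 1" by (simp add: o_def scaleR_conv_of_real)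
      then show ?thesis unfolding G_def by (rule holomorphic_on_power)
    qed
    note mv = integral_bump_mean_value[OF G, of "1/2"]
    have nG: "cmod (G z * of_real (bump (1/2) z)) = (cmod (F (a + s *\<^sub>R z)))\<^sup>2 * bump (1/2) z" for z
      using bump_nonneg[of "1/2" z] by (simp add: G_def norm_mult norm_power)
    have ni: "integrable lborel (\<lambda>z. (cmod (F (a + s *\<^sub>R z)))\<^sup>2 * bump (1/2) z)"
      using integrable_norm[OF mv(1)] unfolding nG by simp
    have "I * (cmod (F a))\<^sup>2 = cmod (G 0 * of_real I)"
      using I by (simp add: G_def norm_mult norm_power)
    also have "\<dots> = cmod (\<integral>z. G z * of_real (bump (1/2) z) \<partial>lborel)" using mv(2) by (simp add: I_def)
    also have "\<dots> \<le> (\<integral>z. cmod (G z * of_real (bump (1/2) z)) \<partial>lborel)" by (rule integral_norm_bound)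
    finally have "ennreal (I * (cmod (F a))\<^sup>2) \<le> ennreal (\<integral>z. (cmod (F (a + s *\<^sub>R z)))\<^sup>2 * bump (1/2) z \<partial>lborel)"
      unfolding nG by (rule ennreal_leI)
    also have "\<dots> = (\<integral>\<^sup>+z. ennreal ((cmod (F (a + s *\<^sub>R z)))\<^sup>2 * bump (1/2) z) \<partial>lborel)"
      by (rule nn_integral_eq_integral[symmetric, OF ni]) (simp add: bump_nonneg)
    also have "\<dots> \<le> (\<integral>\<^sup>+z. indicator (ball a (s/2)) (a + s *\<^sub>R z) * ennreal ((cmod (F (a + s *\<^sub>R z)))\<^sup>2) \<partial>lborel)"
    proof (rule nn_integral_mono)
      fix z :: complex
      show "ennreal ((cmod (F (a + s *\<^sub>R z)))\<^sup>2 * bump (1/2) z) \<le> indicator (ball a (s/2)) (a + s *\<^sub>R z) * ennreal ((cmod (F (a + s *\<^sub>R z)))\<^sup>2)"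
      proof (cases "cmod z < 1/2")
        case True
        then have "a + s *\<^sub>R z \<in> ball a (s/2)" using s by (simp add: dist_norm)
        moreover have "bump (1/2) z \<le> 1"
        proof -
          have "(1/2)\<^sup>2 - (cmod z)\<^sup>2 \<le> 1"
            by (rule order_trans[of _ "(1/2)\<^sup>2"]) (auto simp: power_divide)
          then show ?thesis by (simp add: bump_def)
        qed
        ultimately show ?thesis by (auto intro!: ennreal_leI mult_left_le)
      next
        case False
        then have "bump (1/2) z = 0" by (intro bump_eq_0) auto
        then show ?thesis by simp
      qed
    qed
    finally have 1: "ennreal (I * (cmod (F a))\<^sup>2) \<le> (\<integral>\<^sup>+z. indicator (ball a (s/2)) (a + s *\<^sub>R z) * ennreal ((cmod (F (a + s *\<^sub>R z)))\<^sup>2) \<partial>lborel)" .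
    have "continuous_on (ball a (s/2)) (\<lambda>z. (cmod (F z))\<^sup>2)"
      by (intro continuous_intros holomorphic_on_imp_continuous_on holomorphic_on_subset[OF F]) (use s in auto)
    then have m: "(\<lambda>z. indicator (ball a (s/2)) z * ennreal ((cmod (F z))\<^sup>2)) \<in> borel_measurable borel"
      using measurable_indicator_ball by fastforce
    have "ennreal (I * s\<^sup>2 * (cmod (F a))\<^sup>2) = ennreal (s\<^sup>2) * ennreal (I * (cmod (F a))\<^sup>2)"
      using I by (simp add: mult_ac flip: ennreal_mult'')
    also have "\<dots> \<le> ennreal (s\<^sup>2) * (\<integral>\<^sup>+z. indicator (ball a (s/2)) (a + s *\<^sub>R z) * ennreal ((cmod (F (a + s *\<^sub>R z)))\<^sup>2) \<partial>lborel)"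
      by (intro mult_left_mono 1) auto
    also have "\<dots> = (\<integral>\<^sup>+ z. indicator (ball a (s / 2)) z * ennreal ((cmod (F z))\<^sup>2) \<partial>lborel)"
      by (rule nn_integral_lborel_affine[OF m s, symmetric])
    finally show "ennreal (I * s\<^sup>2 * (cmod (F a))\<^sup>2) \<le> (\<integral>\<^sup>+ z. indicator (ball a (s / 2)) z * ennreal ((cmod (F z))\<^sup>2) \<partial>lborel)" .
  qed
qed

text \<open>The condition is tested at the point a itself. On the disc of radius (1 - |a|)/2 about
  a, weight times kernel is at least a constant times (1 - |a|)^2; the mean value bound for |F|^2 on
  that disc contributes a second such factor.\<close>

lemma vanishing_imp_little:
  assumes F: "F holomorphic_on ball 0 1" and p: "0 < p"
    and v: "vanishing p (\<lambda>z. (cmod (F z))\<^sup>2 * (1 - (cmod z)\<^sup>2) powr (2 + p))" and e: "0 < e"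
  obtains r where "r < 1" "\<And>z. r < cmod z \<Longrightarrow> cmod z < 1 \<Longrightarrow> cmod (F z) * (1 - cmod z)\<^sup>2 < e"
proof -
  obtain c where c: "0 < c" "\<And>F a s. 0 < s \<Longrightarrow> F holomorphic_on ball a s \<Longrightarrow>
     ennreal (c * s\<^sup>2 * (cmod (F a))\<^sup>2) \<le> (\<integral>\<^sup>+ z. indicator (ball a (s / 2)) z * ennreal ((cmod (F z))\<^sup>2) \<partial>lborel)"
    using submean_value by blast
  \<comment> \<open>With s = 1 - |a|, the constants come from 1 - |z|^2 >= s/2, 1 - |a|^2 >= s and
    |1 - cnj a z| <= 3s.\<close>
  define d where "d = (1/2) powr (2 + p) * 3 powr (- 2 * p)"
  have d: "0 < d" by (simp add: d_def)
  have "0 < c * d * e\<^sup>2" using c(1) d e by simp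
  from v[unfolded vanishing_def tends_zero_at_boundary_def, rule_format, OF this]
  obtain r where r: "r < 1" "\<And>a. r < cmod a \<Longrightarrow> cmod a < 1 \<Longrightarrow>
      (\<integral>\<^sup>+ z. indicator (ball 0 1) z * ennreal ((cmod (F z))\<^sup>2 * (1 - (cmod z)\<^sup>2) powr (2 + p) * kern p a z) \<partial>lborel) < ennreal (c * d * e\<^sup>2)"
    by blast
  show ?thesis
  proof (rule that[OF r(1)])
    fix a :: complex assume a: "r < cmod a" "cmod a < 1"
    define s where "s = 1 - cmod a"
    have s: "0 < s" using a by (simp add: s_def)
    have sub: "ball a s \<subseteq> ball 0 1" using ball_subset_ball_iff[of a s 0 1] by (simp add: s_def dist_norm)
    have sub2: "ball a (s/2) \<subseteq> ball 0 1" using sub s by auto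
    have aD: "a \<in> ball 0 1" using a by simp
    have key: "d * s\<^sup>2 \<le> (1 - (cmod z)\<^sup>2) powr (2 + p) * kern p a z" if z: "z \<in> ball a (s/2)" for z
    proof -
      have zD: "z \<in> ball 0 1" using z sub2 by blast
      have az: "cmod (a - z) < s/2" using z by (simp add: dist_norm)
      have "cmod z \<le> cmod a + cmod (a - z)" by (metis norm_minus_commute norm_triangle_sub)
      then have "s / 2 \<le> 1 - cmod z" using az unfolding s_def by argo
      also have "\<dots> \<le> 1 - (cmod z)\<^sup>2" using zD by (simp add: power2_eq_square mult_left_le)
      finally have 1: "(s/2) powr (2 + p) \<le> (1 - (cmod z)\<^sup>2) powr (2 + p)" using s p by (intro powr_mono2) auto
      have "s \<le> 1 - (cmod a)\<^sup>2" using aD by (simp add: s_def power2_eq_square mult_left_le)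
      then have 2: "s powr p \<le> (1 - (cmod a)\<^sup>2) powr p" using s p by (intro powr_mono2) auto
      have "1 - cnj a * z = of_real (1 - (cmod a)\<^sup>2) + cnj a * (a - z)"
        by (simp add: complex_norm_square algebra_simps del: of_real_power)
      then have "cmod (1 - cnj a * z) \<le> \<bar>1 - (cmod a)\<^sup>2\<bar> + cmod a * cmod (a - z)"
        by (metis complex_mod_cnj norm_mult norm_of_real norm_triangle_ineq)
      also have "1 - (cmod a)\<^sup>2 = s * (1 + cmod a)" by (simp add: s_def power2_eq_square algebra_simps)
      also have "\<bar>s * (1 + cmod a)\<bar> + cmod a * cmod (a - z) \<le> s * 2 + 1 * (s/2)"
        using a s az by (intro add_mono mult_mono) (auto simp: abs_mult)
      also have "\<dots> \<le> 3 * s" using s by simp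
      finally have "cmod (1 - cnj a * z) \<le> 3 * s" .
      then have 3: "(3 * s) powr (- 2 * p) \<le> cmod (1 - cnj a * z) powr (- 2 * p)"
        using one_minus_cnj_mult(4)[OF aD zD] p by (intro powr_mono2') auto
      have "d * s\<^sup>2 = (s/2) powr (2 + p) * (s powr p * (3 * s) powr (- 2 * p))"
      proof -
        have "(s/2) powr (2 + p) = (1/2) powr (2 + p) * s powr (2 + p)" "(3 * s) powr (- 2 * p) = 3 powr (- 2 * p) * s powr (- 2 * p)"
          using s powr_mult[of "1/2" s "2 + p"] by (simp_all add: powr_mult)
        moreover have "s powr (2 + p) * s powr p * s powr (- 2 * p) = s\<^sup>2"
          using s by (simp flip: powr_add)
        ultimately show ?thesis by (simp add: d_def mult_ac)
      qed
      also have "\<dots> \<le> (1 - (cmod z)\<^sup>2) powr (2 + p) * ((1 - (cmod a)\<^sup>2) powr p * cmod (1 - cnj a * z) powr (- 2 * p))"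
        by (intro mult_mono 1 2 3) auto
      finally show ?thesis by (simp add: kern_def)
    qed
    have "continuous_on (ball a (s/2)) (\<lambda>z. (cmod (F z))\<^sup>2)"
      by (intro continuous_intros holomorphic_on_imp_continuous_on holomorphic_on_subset[OF F] sub2)
    then have m: "(\<lambda>z. indicator (ball a (s/2)) z * ennreal ((cmod (F z))\<^sup>2)) \<in> borel_measurable lborel"
      by (rule measurable_indicator_ball)
    have "ennreal (d * s\<^sup>2 * (c * s\<^sup>2 * (cmod (F a))\<^sup>2)) = ennreal (d * s\<^sup>2) * ennreal (c * s\<^sup>2 * (cmod (F a))\<^sup>2)"
      using d by (simp add: ennreal_mult')
    also have "\<dots> \<le> ennreal (d * s\<^sup>2) * (\<integral>\<^sup>+ z. indicator (ball a (s / 2)) z * ennreal ((cmod (F z))\<^sup>2) \<partial>lborel)"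
      by (intro mult_left_mono c(2) s holomorphic_on_subset[OF F sub]) auto
    also have "\<dots> = (\<integral>\<^sup>+ z. ennreal (d * s\<^sup>2) * (indicator (ball a (s / 2)) z * ennreal ((cmod (F z))\<^sup>2)) \<partial>lborel)"
      by (rule nn_integral_cmult[symmetric, OF m])
    also have "\<dots> \<le> (\<integral>\<^sup>+ z. indicator (ball 0 1) z * ennreal ((cmod (F z))\<^sup>2 * (1 - (cmod z)\<^sup>2) powr (2 + p) * kern p a z) \<partial>lborel)"
    proof (rule nn_integral_mono)
      fix z
      show "ennreal (d * s\<^sup>2) * (indicator (ball a (s / 2)) z * ennreal ((cmod (F z))\<^sup>2))
        \<le> indicator (ball 0 1) z * ennreal ((cmod (F z))\<^sup>2 * (1 - (cmod z)\<^sup>2) powr (2 + p) * kern p a z)"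
      proof (cases "z \<in> ball a (s/2)")
        case True
        then have "z \<in> ball 0 1" using sub2 by blast
        moreover have "d * s\<^sup>2 * (cmod (F z))\<^sup>2 \<le> (cmod (F z))\<^sup>2 * (1 - (cmod z)\<^sup>2) powr (2 + p) * kern p a z"
          using mult_right_mono[OF key[OF True], of "(cmod (F z))\<^sup>2"] by (simp add: mult_ac)
        ultimately show ?thesis using True by (simp add: ennreal_leI flip: ennreal_mult'')
      qed simp
    qed
    also have "\<dots> < ennreal (c * d * e\<^sup>2)" by (rule r(2)[OF a])
    finally have "d * s\<^sup>2 * (c * s\<^sup>2 * (cmod (F a))\<^sup>2) < c * d * e\<^sup>2"
      using c d by (subst (asm) ennreal_less_iff) auto
    then have "(c * d) * (cmod (F a) * s\<^sup>2)\<^sup>2 < (c * d) * e\<^sup>2" by (simp add: power_mult_distrib power2_eq_square mult_ac)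
    then have "(cmod (F a) * s\<^sup>2)\<^sup>2 < e\<^sup>2" using c d by simp
    then show "cmod (F a) * (1 - cmod a)\<^sup>2 < e" unfolding s_def using e by (rule power2_less_imp_less[OF _ less_imp_le])
  qed
qed

section \<open>The Riccati equation along radii\<close>

text \<open>A continuity argument: at the last point with f <= c the value is exactly c, yet the
  step hypothesis applies there and makes the inequality strict.\<close>

lemma ge_persists_leftwards:
  fixes f :: "real \<Rightarrow> real"
  assumes f: "continuous_on {a..b} f" and b: "c < f b"
    and step: "\<And>s. a \<le> s \<Longrightarrow> s \<le> b \<Longrightarrow> (\<And>t. s \<le> t \<Longrightarrow> t \<le> b \<Longrightarrow> c \<le> f t) \<Longrightarrow> c < f s"
    and t: "a \<le> t" "t \<le> b"
  shows "c \<le> f t"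
proof (rule ccontr)
  assume "\<not> c \<le> f t"
  then have ne: "{x \<in> {a..b}. f x \<le> c} \<noteq> {}" using t by auto
  have "closed {x \<in> {a..b}. f x \<le> c}"
    using continuous_closed_preimage[OF f closed_atLeastAtMost closed_atMost[of c]] by (simp add: vimage_def Int_def)
  then have "compact ({a..b} \<inter> {x \<in> {a..b}. f x \<le> c})" by (rule compact_Int_closed[OF compact_Icc])
  moreover have "{a..b} \<inter> {x \<in> {a..b}. f x \<le> c} = {x \<in> {a..b}. f x \<le> c}" by auto
  ultimately have "compact {x \<in> {a..b}. f x \<le> c}" by simp
  then obtain s where s: "s \<in> {x \<in> {a..b}. f x \<le> c}" "\<And>x. x \<in> {x \<in> {a..b}. f x \<le> c} \<Longrightarrow> x \<le> s"
    using compact_attains_sup[OF _ ne] by blast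
  have sb: "a \<le> s" "s \<le> b" "f s \<le> c" using s(1) by auto
  obtain x where x: "s \<le> x" "x \<le> b" "f x = c"
    using IVT'[of f s c b] sb b continuous_on_subset[OF f, of "{s..b}"] by force
  then have "x \<le> s" using s(2)[of x] sb by auto
  with x have fs: "f s = c" by simp
  have "c < f s"
  proof (rule step[OF sb(1,2)])
    fix y assume y: "s \<le> y" "y \<le> b"
    then show "c \<le> f y" using s(2)[of y] sb fs by (cases "y = s") force+
  qed
  then show False using fs by simp
qed

text \<open>Here (1/Y)' = -1/2 - \<sigma>/Y^2, and the hypothesis on \<sigma> bounds the last term
  by k.\<close>

lemma riccati_reciprocal_bound:
  fixes Y \<sigma> :: "real \<Rightarrow> complex"
  assumes der: "\<And>x. s \<le> x \<Longrightarrow> x \<le> t \<Longrightarrow> (Y has_vector_derivative \<sigma> x + (Y x)\<^sup>2 / 2) (at x)"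
    and nz: "\<And>x. s \<le> x \<Longrightarrow> x \<le> t \<Longrightarrow> Y x \<noteq> 0"
    and bd: "\<And>x. s \<le> x \<Longrightarrow> x \<le> t \<Longrightarrow> cmod (\<sigma> x) \<le> k * (cmod (Y x))\<^sup>2"
    and st: "s \<le> t"
  shows "cmod (1 / Y s - 1 / Y t - of_real ((t - s) / 2)) \<le> k * (t - s)"
proof -
  define g where "g x = 1 / Y x + of_real (x / 2)" for x
  have g': "(g has_vector_derivative - (\<sigma> x / (Y x)\<^sup>2)) (at x within {s..t})" if "x \<in> {s..t}" for x
  proof -
    have "(g has_vector_derivative - (\<sigma> x + (Y x)\<^sup>2 / 2) / (Y x)\<^sup>2 + 1 / 2) (at x)"
      unfolding g_def
    proof (rule has_vector_derivative_add)
      have "((\<lambda>z. 1 / z) has_field_derivative - 1 / (Y x)\<^sup>2) (at (Y x))"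
        using nz that by (auto intro!: derivative_eq_intros simp: power2_eq_square)
      then have "(((\<lambda>z. 1 / z) \<circ> Y) has_vector_derivative (\<sigma> x + (Y x)\<^sup>2 / 2) * (- 1 / (Y x)\<^sup>2)) (at x)"
        using der that by (intro field_vector_diff_chain_at) auto
      then show "((\<lambda>x. 1 / Y x) has_vector_derivative - (\<sigma> x + (Y x)\<^sup>2 / 2) / (Y x)\<^sup>2) (at x)"
        unfolding o_def by (rule has_vector_derivative_eq_rhs) (simp only: times_divide_eq_right mult_minus1_right)
      show "((\<lambda>x. complex_of_real (x / 2)) has_vector_derivative 1 / 2) (at x)"
        by (auto intro!: derivative_eq_intros simp: has_vector_derivative_def scaleR_conv_of_real)
    qed
    moreover have "- (\<sigma> x + (Y x)\<^sup>2 / 2) / (Y x)\<^sup>2 + 1 / 2 = - (\<sigma> x / (Y x)\<^sup>2)"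
      using nz[of x] that by (simp add: field_simps)
    ultimately show ?thesis using has_vector_derivative_at_within by metis
  qed
  have "norm (g s - g t) \<le> k * norm (s - t)"
  proof (rule differentiable_bound[of "{s..t}"])
    fix x assume x: "x \<in> {s..t}"
    show "(g has_derivative (\<lambda>h. h *\<^sub>R - (\<sigma> x / (Y x)\<^sup>2))) (at x within {s..t})"
      using g'[OF x] by (simp add: has_vector_derivative_def)
    have "0 < (cmod (Y x))\<^sup>2" using nz x by simp
    then have "cmod (\<sigma> x / (Y x)\<^sup>2) \<le> k"
      using bd[of x] x by (simp add: norm_divide norm_power divide_le_eq)
    then show "onorm (\<lambda>h. h *\<^sub>R - (\<sigma> x / (Y x)\<^sup>2)) \<le> k"
    proof (intro onorm_le)
      fix h :: real
      show "norm (h *\<^sub>R - (\<sigma> x / (Y x)\<^sup>2)) \<le> k * norm h"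
        using mult_right_mono[OF \<open>cmod (\<sigma> x / (Y x)\<^sup>2) \<le> k\<close>, of "\<bar>h\<bar>"] by (simp add: mult.commute)
    qed
  qed (use st in auto)
  moreover have "g s - g t = 1 / Y s - 1 / Y t - of_real ((t - s) / 2)" by (simp add: g_def diff_divide_distrib)
  ultimately show ?thesis using st by simp
qed

text \<open>The difference y - 1/L = -y (1/y - L)/L has modulus at most |y|/8. Hence |y| <= 8/(7L),
  and the error is at most 1/(7L), below the 1/(4L) used here.\<close>

lemma Re_inverse_near_real:
  assumes "0 < L" "cmod (1 / y - of_real L) \<le> L / 8"
  shows "3 / 4 / L \<le> Re y"
proof -
  have y0: "y \<noteq> 0"
  proof
    assume "y = 0"
    then show False using assms by simp
  qed
  have "y - 1 / of_real L = - (y * (1 / y - of_real L) / of_real L)"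
    using y0 assms(1) by (simp add: field_simps)
  then have "cmod (y - 1 / of_real L) = cmod y * cmod (1 / y - of_real L) / L"
    using assms(1) by (simp add: norm_divide norm_mult)
  also have "\<dots> \<le> cmod y * (L / 8) / L" using assms by (intro divide_right_mono mult_left_mono) auto
  also have "\<dots> = cmod y / 8" using assms(1) by simp
  finally have 1: "cmod (y - 1 / of_real L) \<le> cmod y / 8" .
  have "cmod y \<le> cmod (y - 1 / of_real L) + cmod (1 / of_real L)" by (metis diff_add_cancel norm_triangle_ineq)
  then have 3: "cmod y \<le> cmod y / 8 + 1 / L" using 1 assms(1) by (simp add: norm_divide)
  then have 2: "cmod (y - 1 / of_real L) \<le> 1 / 4 / L"
  proof -
    have "1 / 4 / L = 1 / 4 * (1 / L)" "0 < 1 / L" using assms(1) by auto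
    then show ?thesis using 1 3 by argo
  qed
  have "\<bar>Re (y - 1 / of_real L)\<bar> \<le> cmod (y - 1 / of_real L)" by (rule abs_Re_le_cmod)
  moreover have "Re (y - 1 / of_real L) = Re y - 1 / L"
    by (metis Re_complex_of_real minus_complex.simps(1) of_real_1 of_real_divide)
  ultimately have "1 / L - Re y \<le> 1 / 4 / L" using 2 by linarith
  then show ?thesis using assms(1) by (simp add: field_simps)
qed

lemma norm_triangle_3: "norm (a + b + c) \<le> norm a + norm b + norm (c :: 'a :: real_normed_vector)"
  by (rule order_trans[OF norm_triangle_ineq add_right_mono[OF norm_triangle_ineq]])

text \<open>d stands for phi', and M expresses the boundedness of phi through Cauchy's estimate. If
  |u|(1 - |z|) >= \<epsilon> at radius t1, then on the same ray |d|^2 (1 - s)^3 is nondecreasing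
  from r up to some t2 whose distance to 1 is comparable with 1 - t1. It starts above a fixed
  positive value and ends below M^2 (1 - t2), which is impossible for t1 close to 1.\<close>

lemma riccati_little:
  assumes d: "d holomorphic_on ball 0 1" and d0: "\<And>z. z \<in> ball 0 1 \<Longrightarrow> d z \<noteq> 0"
    and M: "\<And>z. z \<in> ball 0 1 \<Longrightarrow> cmod (d z) * (1 - cmod z) \<le> M"
    and u: "\<And>z. z \<in> ball 0 1 \<Longrightarrow> u z = deriv d z / d z"
    and S: "\<And>e. 0 < e \<Longrightarrow> \<exists>r<1. \<forall>z. r < cmod z \<longrightarrow> cmod z < 1 \<longrightarrow> cmod (deriv u z - (u z)\<^sup>2 / 2) * (1 - cmod z)\<^sup>2 < e"
    and e: "0 < e"
  shows "\<exists>r<1. \<forall>z. r < cmod z \<longrightarrow> cmod z < 1 \<longrightarrow> cmod (u z) * (1 - cmod z) < e"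
proof -
  have uh: "u holomorphic_on ball 0 1"
  proof (rule holomorphic_transform)
    show "(\<lambda>z. deriv d z / d z) holomorphic_on ball 0 1"
      using d d0 by (auto intro!: holomorphic_intros)
  qed (simp add: u)
  define \<epsilon> where "\<epsilon> = min e 1"
  have eps: "0 < \<epsilon>" "\<epsilon> \<le> 1" "\<epsilon> \<le> e" using e by (auto simp: \<epsilon>_def)
  \<comment> \<open>The three errors in 1/Y below add up to (5/2) \<kappa> (1 - s) = (1 - s)/16,
    exactly the tolerance L/8 of \<open>Re_inverse_near_real\<close> for L = (1 - s)/2.\<close>
  define \<kappa> where "\<kappa> = (1/40 :: real)"
  \<comment> \<open>Turns |\<sigma>| (1 - x)^2 < \<eta> into |\<sigma>| <= \<kappa> |Y|^2 wherever
    |Y| (1 - x) >= \<epsilon>/2.\<close>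
  define \<eta> where "\<eta> = \<kappa> * (\<epsilon> / 2)\<^sup>2"
  have eta: "0 < \<eta>" using eps by (simp add: \<eta>_def \<kappa>_def)
  obtain r0 where r0: "r0 < 1" "\<And>z. r0 < cmod z \<Longrightarrow> cmod z < 1 \<Longrightarrow> cmod (deriv u z - (u z)\<^sup>2 / 2) * (1 - cmod z)\<^sup>2 < \<eta>"
    using S[OF eta] by blast
  define r where "r = (1 + max 0 r0) / 2"
  have r: "0 < r" "r < 1" "r0 < r" using r0(1) by (auto simp: r_def)
  have "\<exists>c>0. \<forall>z\<in>sphere 0 r. c \<le> cmod (d z)"
  proof -
    have sub: "sphere 0 r \<subseteq> ball (0::complex) 1" using r by auto
    have "continuous_on (sphere 0 r) (\<lambda>z. cmod (d z))"
      by (intro continuous_intros continuous_on_subset[OF holomorphic_on_imp_continuous_on[OF d] sub])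
    moreover have "sphere (0::complex) r \<noteq> {}" using r by simp
    ultimately obtain z where "z \<in> sphere 0 r" "\<And>y. y \<in> sphere 0 r \<Longrightarrow> cmod (d z) \<le> cmod (d y)"
      using continuous_attains_inf[of "sphere 0 r" "\<lambda>z. cmod (d z)"] by auto
    then show ?thesis using d0 sub by (intro exI[of _ "cmod (d z)"]) auto
  qed
  then obtain c where c: "0 < c" "\<And>z. z \<in> sphere 0 r \<Longrightarrow> c \<le> cmod (d z)" by blast
  define \<beta> where "\<beta> = c\<^sup>2 * (1 - r) ^ 3 / (M\<^sup>2 + 1)"
  have beta: "0 < \<beta>" using c r by (simp add: \<beta>_def add_nonneg_pos)
  \<comment> \<open>\<beta> is the lower bound for 1 - t2 that the growth of d will force, so 1 - t1
    < \<kappa> \<epsilon> \<beta> contradicts it; the entry 1 - r places t2 beyond r.\<close>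
  define R where "R = 1 - \<kappa> * \<epsilon> * min \<beta> (1 - r)"
  have R: "R < 1" using eps beta r by (simp add: R_def \<kappa>_def)
  have "cmod (u z) * (1 - cmod z) < \<epsilon>" if z: "R < cmod z" "cmod z < 1" for z
  proof (rule ccontr)
    assume neg: "\<not> cmod (u z) * (1 - cmod z) < \<epsilon>"
    define t1 where "t1 = cmod z"
    have ke: "0 < \<kappa> * \<epsilon>" "\<kappa> * \<epsilon> \<le> 1" using eps by (auto simp: \<kappa>_def)
    have t1a: "1 - t1 < \<kappa> * \<epsilon> * \<beta>" "1 - t1 < \<kappa> * \<epsilon> * (1 - r)"
      using z(1) mult_left_mono[OF min.cobounded1[of \<beta> "1 - r"], of "\<kappa> * \<epsilon>"]
        mult_left_mono[OF min.cobounded2[of \<beta> "1 - r"], of "\<kappa> * \<epsilon>"] ke by (auto simp: R_def t1_def)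
    have "\<kappa> * \<epsilon> * (1 - r) \<le> 1 * (1 - r)" using ke r by (intro mult_right_mono) auto
    then have t1: "r < t1" "t1 < 1" using t1a(2) z(2) by (auto simp: t1_def)
    define \<zeta> where "\<zeta> = z / of_real t1"
    have zeta: "cmod \<zeta> = 1" "z = of_real t1 * \<zeta>" using t1 r by (auto simp: \<zeta>_def t1_def norm_divide)
    define Y where "Y x = \<zeta> * u (of_real x * \<zeta>)" for x :: real
    define \<sigma> where "\<sigma> x = \<zeta>\<^sup>2 * (deriv u (of_real x * \<zeta>) - (u (of_real x * \<zeta>))\<^sup>2 / 2)" for x :: real
    have nx: "cmod (of_real x * \<zeta>) = x" if "0 \<le> x" for x using that zeta by (simp add: norm_mult)
    have path: "((\<lambda>x::real. of_real x * \<zeta>) has_vector_derivative \<zeta>) (at x)" for x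
      by (auto intro!: derivative_eq_intros simp: has_vector_derivative_def scaleR_conv_of_real)
    have dY: "(Y has_vector_derivative \<sigma> x + (Y x)\<^sup>2 / 2) (at x)" if x: "r \<le> x" "x \<le> t1" for x
    proof -
      have "of_real x * \<zeta> \<in> ball 0 1" using nx[of x] x r t1 by simp
      then have "(u has_field_derivative deriv u (of_real x * \<zeta>)) (at (of_real x * \<zeta>))"
        using uh holomorphic_derivI by blast
      from field_vector_diff_chain_at[OF path this]
      have "((\<lambda>x. u (of_real x * \<zeta>)) has_vector_derivative \<zeta> * deriv u (of_real x * \<zeta>)) (at x)" by (simp add: o_def)
      then have "(Y has_vector_derivative \<zeta> * (\<zeta> * deriv u (of_real x * \<zeta>))) (at x)"
        unfolding Y_def by (rule has_vector_derivative_mult_right)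
      moreover have "\<zeta> * (\<zeta> * deriv u (of_real x * \<zeta>)) = \<sigma> x + (Y x)\<^sup>2 / 2"
        by (simp add: \<sigma>_def Y_def power2_eq_square algebra_simps)
      ultimately show ?thesis by simp
    qed
    have nY: "cmod (Y x) = cmod (u (of_real x * \<zeta>))" for x using zeta by (simp add: Y_def norm_mult)
    have sb: "cmod (\<sigma> x) * (1 - x)\<^sup>2 < \<eta>" if x: "r \<le> x" "x \<le> t1" for x
      using r0(2)[of "of_real x * \<zeta>"] nx[of x] x r t1 zeta by (simp add: \<sigma>_def norm_mult norm_power)
    \<comment> \<open>Where \<open>Y\<close> is not small, \<open>1 / Y\<close> decreases with slope close to 1/2.\<close>
    have seg: "cmod (1 / Y s - 1 / Y t1 - of_real ((t1 - s) / 2)) \<le> \<kappa> * (t1 - s)"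
      if s: "r \<le> s" "s \<le> t1" and ge: "\<And>x. s \<le> x \<Longrightarrow> x \<le> t1 \<Longrightarrow> \<epsilon> / 2 \<le> cmod (Y x) * (1 - x)" for s
    proof (rule riccati_reciprocal_bound)
      fix x assume x: "s \<le> x" "x \<le> t1"
      show "(Y has_vector_derivative \<sigma> x + (Y x)\<^sup>2 / 2) (at x)" using dY x s by auto
      show "Y x \<noteq> 0" using ge[OF x] eps by auto
      have "cmod (\<sigma> x) * (1 - x)\<^sup>2 \<le> \<kappa> * (\<epsilon> / 2)\<^sup>2" using sb[of x] x s by (simp add: \<eta>_def)
      also have "\<dots> \<le> \<kappa> * (cmod (Y x) * (1 - x))\<^sup>2"
        using ge[OF x] eps by (intro mult_left_mono power_mono) (auto simp: \<kappa>_def)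
      finally have "cmod (\<sigma> x) * (1 - x)\<^sup>2 \<le> \<kappa> * (cmod (Y x))\<^sup>2 * (1 - x)\<^sup>2" by (simp add: power_mult_distrib)
      then show "cmod (\<sigma> x) \<le> \<kappa> * (cmod (Y x))\<^sup>2" using x t1 by simp
    qed (rule s)
    have top: "\<epsilon> \<le> cmod (Y t1) * (1 - t1)" using neg nY[of t1] by (simp only: zeta(2)[symmetric]) (simp add: t1_def)
    then have Yt1: "0 < cmod (Y t1)" using eps by (cases "Y t1 = 0") auto
    have topr: "cmod (1 / Y t1) \<le> (1 - t1) / \<epsilon>"
      using top Yt1 eps by (simp add: norm_divide field_simps)
    \<comment> \<open>Going inwards loses less than a factor 2: as long as the estimate for 1/Y is
      valid between s and t1, it keeps 1/|Y s| below 2(1 - s)/\<epsilon>.\<close>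
    have ge: "\<epsilon> / 2 \<le> cmod (Y x) * (1 - x)" if x: "r \<le> x" "x \<le> t1" for x
    proof (rule ge_persists_leftwards[where f = "\<lambda>x. cmod (Y x) * (1 - x)" and a = r and b = t1, OF _ _ _ x])
      show "continuous_on {r..t1} (\<lambda>x. cmod (Y x) * (1 - x))"
        by (intro continuous_intros continuous_at_imp_continuous_on)
          (auto intro: has_vector_derivative_continuous[OF dY])
      show "\<epsilon> / 2 < cmod (Y t1) * (1 - t1)" using top eps by simp
      fix s assume s: "r \<le> s" "s \<le> t1" and ge: "\<And>t. s \<le> t \<Longrightarrow> t \<le> t1 \<Longrightarrow> \<epsilon> / 2 \<le> cmod (Y t) * (1 - t)"
      have "cmod (1 / Y s) \<le> cmod (1 / Y s - 1 / Y t1 - of_real ((t1 - s) / 2)) + cmod (1 / Y t1) + cmod (complex_of_real ((t1 - s) / 2))"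
        using norm_triangle_3[of "1 / Y s - 1 / Y t1 - of_real ((t1 - s) / 2)" "1 / Y t1" "complex_of_real ((t1 - s) / 2)"] by simp
      also have "\<dots> \<le> \<kappa> * (t1 - s) + (1 - t1) / \<epsilon> + (t1 - s) / 2"
      proof (intro add_mono seg[OF s] topr)
        show "cmod (complex_of_real ((t1 - s) / 2)) \<le> (t1 - s) / 2" unfolding norm_of_real using s by simp
      qed (rule ge)
      also have "\<dots> < 2 * (1 - s) / \<epsilon>"
      proof -
        have "\<kappa> * (t1 - s) + (t1 - s) / 2 \<le> 2 * (t1 - s)" using s by (simp add: \<kappa>_def)
        also have "\<dots> \<le> 2 * (t1 - s) / \<epsilon>" using s eps by (simp add: le_divide_eq mult_left_le)
        finally have "\<kappa> * (t1 - s) + (1 - t1) / \<epsilon> + (t1 - s) / 2 \<le> 2 * (t1 - s) / \<epsilon> + (1 - t1) / \<epsilon>"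
          by argo
        also have "\<dots> = (2 * (t1 - s) + (1 - t1)) / \<epsilon>" by (rule add_divide_distrib[symmetric])
        also have "\<dots> < 2 * (1 - s) / \<epsilon>" using eps t1 by (intro divide_strict_right_mono) auto
        finally show ?thesis .
      qed
      finally have 1: "1 / cmod (Y s) < 2 * (1 - s) / \<epsilon>" by (simp add: norm_divide)
      have "0 < cmod (Y s)" using ge[of s] s eps t1 by auto
      then show "\<epsilon> / 2 < cmod (Y s) * (1 - s)" using 1 eps by (simp add: field_simps)
    qed
    \<comment> \<open>For s <= t2 the starting value |1/Y(t1)| <= (1 - t1)/\<epsilon> is at most
      \<kappa> (1 - s), so 1/Y(s) is dominated by (1 - s)/2.\<close>
    define t2 where "t2 = 1 - (1 - t1) / (\<kappa> * \<epsilon>)"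
    have t2: "r < t2" "t2 \<le> t1"
    proof -
      have "(1 - t1) / (\<kappa> * \<epsilon>) < 1 - r" using t1a(2) ke by (simp add: divide_less_eq mult.commute)
      then show "r < t2" by (simp add: t2_def)
      have "1 - t1 \<le> (1 - t1) / (\<kappa> * \<epsilon>)" using ke t1 by (simp add: le_divide_eq mult_left_le)
      then show "t2 \<le> t1" by (simp add: t2_def)
    qed
    have ReY: "3 / 2 \<le> Re (Y s) * (1 - s)" if s: "r \<le> s" "s \<le> t2" for s
    proof -
      have s1: "s \<le> t1" "s < 1" using s t2 t1 by auto
      have a: "(1 - t1) / \<epsilon> \<le> \<kappa> * (1 - s)"
      proof -
        have "(1 - t1) / (\<kappa> * \<epsilon>) \<le> 1 - s" using s by (simp add: t2_def)
        then show ?thesis using eps by (simp add: \<kappa>_def field_simps)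
      qed
      have b: "1 - t1 \<le> (1 - t1) / \<epsilon>" using eps t1 by (simp add: le_divide_eq mult_left_le)
      have "cmod (1 / Y s - of_real ((1 - s) / 2)) \<le> cmod (1 / Y s - 1 / Y t1 - of_real ((t1 - s) / 2)) + cmod (1 / Y t1) + cmod (complex_of_real ((1 - t1) / 2))"
      proof -
        have "1 / Y s - of_real ((1 - s) / 2) = (1 / Y s - 1 / Y t1 - of_real ((t1 - s) / 2)) + 1 / Y t1 + (- complex_of_real ((1 - t1) / 2))"
          by (simp add: diff_divide_distrib)
        then show ?thesis
          using norm_triangle_3[of "1 / Y s - 1 / Y t1 - of_real ((t1 - s) / 2)" "1 / Y t1" "- complex_of_real ((1 - t1) / 2)"]
          by (simp only: norm_minus_cancel)
      qed
      also have "\<dots> \<le> \<kappa> * (t1 - s) + (1 - t1) / \<epsilon> + (1 - t1) / 2"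
      proof (intro add_mono seg s s1 topr)
        show "cmod (complex_of_real ((1 - t1) / 2)) \<le> (1 - t1) / 2" unfolding norm_of_real using t1 by simp
      qed (use ge s in auto)
      also have "\<dots> \<le> \<kappa> * (1 - s) + \<kappa> * (1 - s) + \<kappa> * (1 - s) / 2"
      proof -
        have "\<kappa> * (t1 - s) \<le> \<kappa> * (1 - s)" using t1 by (simp add: \<kappa>_def)
        then show ?thesis using a b by argo
      qed
      also have "\<dots> = (1 - s) / 2 / 8" by (simp add: \<kappa>_def)
      finally have "3 / 4 / ((1 - s) / 2) \<le> Re (Y s)" by (intro Re_inverse_near_real) (use s1 in auto)
      then show ?thesis using s1 by (simp add: field_simps)
    qed
    \<comment> \<open>2 Re Y is the logarithmic derivative of |d|^2 along the ray, and
      \<open>ReY\<close> says that it beats that of (1 - s)^(-3). The exponent 3 exceeds the 2 in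
      |d|^2 <= M^2 (1 - s)^(-2); this gap yields the contradiction.\<close>
    define N where "N s = (cmod (d (of_real s * \<zeta>)))\<^sup>2 * (1 - s) ^ 3" for s :: real
    have "N r \<le> N t2"
    proof (rule DERIV_nonneg_imp_nondecreasing[where f = N])
      show "r \<le> t2" using t2 by simp
      fix s assume s: "r \<le> s" "s \<le> t2"
      let ?w = "of_real s * \<zeta>"
      have w: "?w \<in> ball 0 1" using nx[of s] s r t2 t1 by simp
      have "(d has_field_derivative deriv d ?w) (at ?w)" using d w holomorphic_derivI by blast
      from field_vector_diff_chain_at[OF path this]
      have "((\<lambda>x. d (of_real x * \<zeta>)) has_vector_derivative \<zeta> * deriv d ?w) (at s)" by (simp add: o_def)
      moreover have "\<zeta> * deriv d ?w = Y s * d ?w" using d0[OF w] by (simp add: Y_def u[OF w])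
      ultimately have dd: "((\<lambda>x. d (of_real x * \<zeta>)) has_derivative (\<lambda>h. h *\<^sub>R (Y s * d ?w))) (at s)"
        by (simp add: has_vector_derivative_def)
      have D1: "((\<lambda>x. (cmod (d (of_real x * \<zeta>)))\<^sup>2) has_derivative (\<lambda>h. 2 * (d ?w \<bullet> (h *\<^sub>R (Y s * d ?w))))) (at s)"
        unfolding power2_norm_eq_inner
        by (rule has_derivative_eq_rhs[OF has_derivative_inner[OF dd dd]]) (simp add: inner_commute fun_eq_iff)
      have D2: "2 * (d ?w \<bullet> (h *\<^sub>R (Y s * d ?w))) = (2 * (cmod (d ?w))\<^sup>2 * Re (Y s)) * h" for h
      proof -
        have "d ?w \<bullet> (Y s * d ?w) = (cmod (d ?w))\<^sup>2 * Re (Y s)"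
          by (simp add: inner_complex_def cmod_power2) (simp add: power2_eq_square algebra_simps)
        then show ?thesis by simp
      qed
      have n1: "((\<lambda>x. (cmod (d (of_real x * \<zeta>)))\<^sup>2) has_real_derivative 2 * (cmod (d ?w))\<^sup>2 * Re (Y s)) (at s)"
        unfolding has_field_derivative_def by (rule has_derivative_eq_rhs[OF D1], rule ext, rule D2)
      have n2: "((\<lambda>x. (1 - x) ^ 3) has_real_derivative - 3 * (1 - s)\<^sup>2) (at s)"
        by (auto intro!: derivative_eq_intros)
      have "(N has_real_derivative 2 * (cmod (d ?w))\<^sup>2 * Re (Y s) * (1 - s) ^ 3 + - 3 * (1 - s)\<^sup>2 * (cmod (d ?w))\<^sup>2) (at s)"
        unfolding N_def by (rule DERIV_mult[OF n1 n2])
      moreover have "2 * (cmod (d ?w))\<^sup>2 * Re (Y s) * (1 - s) ^ 3 + - 3 * (1 - s)\<^sup>2 * (cmod (d ?w))\<^sup>2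
        = (cmod (d ?w))\<^sup>2 * (1 - s)\<^sup>2 * (2 * (Re (Y s) * (1 - s)) - 3)"
        by (simp add: power2_eq_square power3_eq_cube algebra_simps)
      moreover have "\<dots> \<ge> 0" using ReY[OF s] by (intro mult_nonneg_nonneg) auto
      ultimately show "\<exists>y. (N has_real_derivative y) (at s) \<and> 0 \<le> y" by metis
    qed
    have "c\<^sup>2 * (1 - r) ^ 3 \<le> N r"
      unfolding N_def using c nx[of r] r by (intro mult_right_mono power_mono) auto
    also note \<open>N r \<le> N t2\<close>
    also have "N t2 = (cmod (d (of_real t2 * \<zeta>)) * (1 - cmod (of_real t2 * \<zeta>)))\<^sup>2 * (1 - t2)"
      using nx[of t2] t2 r by (simp add: N_def power_mult_distrib power2_eq_square power3_eq_cube)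
    also have "\<dots> \<le> M\<^sup>2 * (1 - t2)"
      using M[of "of_real t2 * \<zeta>"] nx[of t2] t2 t1 r by (intro mult_right_mono power_mono) auto
    also have "\<dots> \<le> (M\<^sup>2 + 1) * (1 - t2)" using t2 t1 by (intro mult_right_mono) auto
    finally have "\<beta> \<le> 1 - t2" by (simp add: \<beta>_def divide_le_eq add_nonneg_pos mult.commute)
    then have "\<beta> \<le> (1 - t1) / (\<kappa> * \<epsilon>)" by (simp add: t2_def)
    then have "\<kappa> * \<epsilon> * \<beta> \<le> 1 - t1" using ke by (simp add: le_divide_eq mult.commute)
    then show False using t1a by simp
  qed
  then show ?thesis using R eps by (intro exI[of _ R]) force
qed

section \<open>The pre-Schwarzian of a univalent function\<close>

text \<open>Otherwise the inverse function would map the disc of radius 2 into the unit disc, and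
  Cauchy's estimate on radius 3/2 would bound its derivative at 0, which equals 1, by 2/3.\<close>

lemma injective_omits_small_value:
  assumes f: "f holomorphic_on ball 0 1" "inj_on f (ball 0 1)" "f 0 = 0" "deriv f 0 = 1"
  obtains w where "cmod w < 2" "w \<notin> f ` ball 0 1"
proof (rule ccontr)
  assume "\<not> thesis"
  then have sub: "ball 0 2 \<subseteq> f ` ball 0 1" using that by (auto simp: subset_iff)
  obtain g where g: "g holomorphic_on (f ` ball 0 1)" "\<And>z. z \<in> ball 0 1 \<Longrightarrow> deriv f z * deriv g (f z) = 1"
      "\<And>z. z \<in> ball 0 1 \<Longrightarrow> g (f z) = z"
    using holomorphic_has_inverse[OF f(1) open_ball f(2)] by metis
  have g1: "deriv g 0 = 1" using g(2)[of 0] f by simp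
  have gh: "g holomorphic_on ball 0 2" by (rule holomorphic_on_subset[OF g(1) sub])
  have "norm ((deriv ^^ 1) g 0) \<le> fact 1 * 1 / (3/2) ^ 1"
  proof (rule Cauchy_inequality)
    show "g holomorphic_on ball 0 (3/2)" by (rule holomorphic_on_subset[OF gh]) auto
    show "continuous_on (cball 0 (3/2)) g"
      by (rule continuous_on_subset[OF holomorphic_on_imp_continuous_on[OF gh]]) auto
    fix x :: complex assume "norm (0 - x) = 3/2"
    then have "x \<in> f ` ball 0 1" using sub by (auto simp: subset_iff)
    then show "norm (g x) \<le> 1" using g(3) by force
  qed auto
  then show False using g1 by simp
qed

text \<open>A non-sharp form of Bieberbach's bound for the second coefficient; an absolute constant
  is all that the Koebe-type estimate asks for.\<close>

lemma normalized_injective_second_deriv_bound: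
  obtains C where "0 \<le> C" "\<And>f. f holomorphic_on ball 0 1 \<Longrightarrow> inj_on f (ball 0 1) \<Longrightarrow> f 0 = 0 \<Longrightarrow> deriv f 0 = 1 \<Longrightarrow>
     cmod (deriv (deriv f) 0) \<le> C"
proof -
  \<comment> \<open>Schottky's bound for a function with modulus at most 1 at the centre, on the
    disc of radius 1/2.\<close>
  define B where "B = exp (pi * exp (pi * (2 + 2 * 1 + 12 * (1/2) / (1 - 1/2 :: real))))"
  have B: "0 \<le> B" by (simp add: B_def)
  show ?thesis
  \<comment> \<open>64 is 2! times 2 divided by (1/4)^2: Cauchy's estimate for f'' on radius 1/4,
    where |f| <= 2(1 + B^2).\<close>
  proof (rule that[of "64 * (1 + B\<^sup>2)"])
    show "0 \<le> 64 * (1 + B\<^sup>2)" by simp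
    fix f :: "complex \<Rightarrow> complex"
    assume f: "f holomorphic_on ball 0 1" "inj_on f (ball 0 1)" "f 0 = 0" "deriv f 0 = 1"
    obtain w where w: "cmod w < 2" "w \<notin> f ` ball 0 1" by (rule injective_omits_small_value[OF f])
    have w0: "w \<noteq> 0" using w(2) f(3) by (auto simp: image_iff intro: bexI[of _ 0])
    define G where "G z = 1 - f z / w" for z
    have G: "G holomorphic_on ball 0 1" unfolding G_def using f w0 by (intro holomorphic_intros) auto
    have G0: "G z \<noteq> 0" if "z \<in> ball 0 1" for z using w w0 that by (auto simp: G_def field_simps)
    obtain k where k: "k holomorphic_on ball 0 1" "\<And>z. z \<in> ball 0 1 \<Longrightarrow> G z = (k z)\<^sup>2"
      using contractible_imp_holomorphic_sqrt[OF G convex_imp_contractible[OF convex_ball] G0] by blast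
    \<comment> \<open>A square root of \<open>1 - f / w\<close> with value -1 at 0 omits 0 and 1, so Schottky's theorem applies.\<close>
    define K where "K z = - k 0 * k z" for z
    have "(k 0)\<^sup>2 = 1" using k(2)[of 0] f by (simp add: G_def)
    then have KG: "(K z)\<^sup>2 = G z" if "z \<in> ball 0 1" for z
      using k(2)[OF that] by (auto simp: K_def power2_eq_square power_mult_distrib)
    have K0: "K 0 = -1" using \<open>(k 0)\<^sup>2 = 1\<close> by (simp add: K_def power2_eq_square)
    have Kh: "K holomorphic_on ball 0 1" unfolding K_def using k by (intro holomorphic_intros)
    have Kn0: "K z \<noteq> 0" if "z \<in> ball 0 1" for z using KG[OF that] G0[OF that] by auto
    have Kn1: "K z \<noteq> 1" if "z \<in> ball 0 1" for z
    proof
      assume K1: "K z = 1"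
      then have "f z = f 0" using KG[OF that] w0 f by (auto simp: G_def)
      then have "z = 0" using f(2) that by (auto simp: inj_on_def)
      then show False using K0 K1 by simp
    qed
    have KB: "cmod (K z) \<le> B" if z: "cmod z \<le> 1/4" for z
    proof -
      have "norm ((\<lambda>z. K (z / 2)) (2 * z)) \<le> B" unfolding B_def
      proof (rule Schottky[where f = "\<lambda>z. K (z / 2)" and z = "2 * z" and t = "1/2" and r = 1])
        have "(K \<circ> (\<lambda>z. z / 2)) holomorphic_on cball 0 1"
          by (rule holomorphic_on_compose_gen[OF _ Kh]) (auto intro!: holomorphic_intros simp: norm_divide)
        then show "(\<lambda>z. K (z / 2)) holomorphic_on cball 0 1" by (simp add: o_def)
        show "norm (K (0 / 2)) \<le> 1" using K0 by simp
        show "\<not> (K (x / 2) = 0 \<or> K (x / 2) = 1)" if "x \<in> cball 0 1" for x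
          using Kn0[of "x/2"] Kn1[of "x/2"] that by (auto simp: norm_divide)
        show "norm (2 * z) \<le> 1/2" using z by (simp add: norm_mult)
      qed auto
      then show ?thesis by simp
    qed
    have fB: "cmod (f z) \<le> 2 * (1 + B\<^sup>2)" if z: "cmod z \<le> 1/4" for z
    proof -
      have "f z = w * (1 - (K z)\<^sup>2)" using KG[of z] z w0 by (auto simp: G_def)
      then have "cmod (f z) = cmod w * cmod (1 - (K z)\<^sup>2)" by (simp add: norm_mult)
      also have "\<dots> \<le> 2 * (1 + B\<^sup>2)"
      proof (intro mult_mono)
        have "cmod (1 - (K z)\<^sup>2) \<le> 1 + (cmod (K z))\<^sup>2" by (metis norm_one norm_power norm_triangle_ineq4)
        also have "\<dots> \<le> 1 + B\<^sup>2" using KB[OF z] by (intro add_left_mono power_mono) auto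
        finally show "cmod (1 - (K z)\<^sup>2) \<le> 1 + B\<^sup>2" .
      qed (use w in auto)
      finally show ?thesis .
    qed
    have "norm ((deriv ^^ 2) f 0) \<le> fact 2 * (2 * (1 + B\<^sup>2)) / (1/4) ^ 2"
    proof (rule Cauchy_inequality)
      show "f holomorphic_on ball 0 (1/4)" by (rule holomorphic_on_subset[OF f(1)]) auto
      show "continuous_on (cball 0 (1/4)) f"
        by (rule continuous_on_subset[OF holomorphic_on_imp_continuous_on[OF f(1)]]) auto
      show "norm (f x) \<le> 2 * (1 + B\<^sup>2)" if "norm (0 - x) = 1/4" for x using fB[of x] that by simp
    qed auto
    then show "cmod (deriv (deriv f) 0) \<le> 64 * (1 + B\<^sup>2)"
      by (simp add: numeral_2_eq_2 power2_eq_square)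
  qed
qed

text \<open>An affine map carries the unit disc onto the disc of radius 1 - |a| about a. Normalizing
  f there to value 0 and derivative 1 at the centre turns f''(a)/f'(a) times 1 - |a| into a second
  derivative at 0.\<close>

lemma injective_pre_schwarzian_bound:
  obtains C where "0 \<le> C" "\<And>f a. f holomorphic_on ball 0 1 \<Longrightarrow> inj_on f (ball 0 1) \<Longrightarrow> a \<in> ball 0 1 \<Longrightarrow>
     cmod (deriv (deriv f) a / deriv f a) * (1 - cmod a) \<le> C"
proof -
  obtain C where C: "0 \<le> C" "\<And>f. f holomorphic_on ball 0 1 \<Longrightarrow> inj_on f (ball 0 1) \<Longrightarrow> f 0 = 0 \<Longrightarrow> deriv f 0 = 1 \<Longrightarrow>
     cmod (deriv (deriv f) 0) \<le> C"
    using normalized_injective_second_deriv_bound by blast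
  show ?thesis
  proof (rule that[OF C(1)])
    fix f :: "complex \<Rightarrow> complex" and a :: complex
    assume f: "f holomorphic_on ball 0 1" "inj_on f (ball 0 1)" and a: "a \<in> ball 0 1"
    define s where "s = 1 - cmod a"
    have s: "0 < s" using a by (simp add: s_def)
    define L where "L z = a + of_real s * z" for z
    have L: "L z \<in> ball 0 1" if "z \<in> ball 0 1" for z
    proof -
      have "cmod (L z) \<le> cmod a + s * cmod z"
        unfolding L_def using s by (metis norm_triangle_ineq norm_mult norm_of_real abs_of_pos)
      also have "\<dots> < cmod a + s * 1" using s that by (intro add_strict_left_mono mult_strict_left_mono) auto
      finally show ?thesis by (simp add: s_def)
    qed
    have d: "deriv f a \<noteq> 0" by (rule holomorphic_injective_imp_regular[OF f(1) open_ball f(2) a])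
    define c where "c = of_real s * deriv f a"
    have c: "c \<noteq> 0" using s d by (simp add: c_def)
    define g where "g z = (f (L z) - f a) / c" for z
    have f': "deriv f holomorphic_on ball 0 1" using f(1) by (auto intro: holomorphic_deriv)
    have Ld: "(L has_field_derivative of_real s) (at z)" for z unfolding L_def by (auto intro!: derivative_eq_intros)
    have gd: "(g has_field_derivative deriv f (L z) / deriv f a) (at z)" if z: "z \<in> ball 0 1" for z
    proof -
      have "(f has_field_derivative deriv f (L z)) (at (L z))" using f(1) L[OF z] holomorphic_derivI by blast
      from DERIV_chain2[OF this Ld] have "((\<lambda>z. f (L z)) has_field_derivative deriv f (L z) * of_real s) (at z)" .
      then have "(g has_field_derivative (deriv f (L z) * of_real s - 0) / c) (at z)"
        unfolding g_def by (intro DERIV_cdivide DERIV_diff) auto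
      then show ?thesis using s by (simp add: c_def)
    qed
    have gh: "g holomorphic_on ball 0 1"
      using gd unfolding holomorphic_on_open[OF open_ball] by blast
    have g1: "deriv g z = deriv f (L z) / deriv f a" if "z \<in> ball 0 1" for z by (rule DERIV_imp_deriv[OF gd[OF that]])
    have La: "L 0 = a" by (simp add: L_def)
    have ginj: "inj_on g (ball 0 1)"
    proof (rule inj_onI)
      fix x y assume xy: "x \<in> ball 0 1" "y \<in> ball 0 1" "g x = g y"
      then have "f (L x) = f (L y)" using c by (simp add: g_def)
      then have "L x = L y" using f(2) L xy by (auto simp: inj_on_def)
      then show "x = y" using s by (simp add: L_def)
    qed
    have "((\<lambda>z. deriv f (L z) / deriv f a) has_field_derivative (deriv (deriv f) a * of_real s) / deriv f a) (at 0)"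
    proof -
      have "(deriv f has_field_derivative deriv (deriv f) (L 0)) (at (L 0))" using f' a La holomorphic_derivI by auto
      from DERIV_cdivide[OF DERIV_chain2[OF this Ld]] show ?thesis by (simp add: La)
    qed
    then have "(deriv g has_field_derivative (deriv (deriv f) a * of_real s) / deriv f a) (at 0)"
      by (rule DERIV_cong_ev[THEN iffD1, rotated 3])
        (use g1 in \<open>auto intro!: eventually_mono[OF eventually_nhds_in_open[of "ball 0 1" 0]]\<close>)
    then have "deriv (deriv g) 0 = (deriv (deriv f) a * of_real s) / deriv f a" by (rule DERIV_imp_deriv)
    moreover have "cmod (deriv (deriv g) 0) \<le> C"
      by (rule C(2)[OF gh ginj]) (use g1[of 0] La d in \<open>auto simp: g_def\<close>)
    ultimately have "cmod ((deriv (deriv f) a * of_real s) / deriv f a) \<le> C" by simp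
    then show "cmod (deriv (deriv f) a / deriv f a) * (1 - cmod a) \<le> C"
      using s by (simp add: norm_mult norm_divide flip: s_def)
  qed
qed

section \<open>Wirtinger derivatives\<close>

text \<open>A real-linear map of the plane is a h + b cnj h for exactly one pair (a, b), so a and b
  are the z- and zbar-derivatives. Carrying both in one predicate makes conjugation, product and
  chain rules compositional.\<close>

definition has_wirtinger :: "(complex \<Rightarrow> complex) \<Rightarrow> complex \<Rightarrow> complex \<Rightarrow> complex \<Rightarrow> bool" where
  "has_wirtinger f a b z \<longleftrightarrow> (f has_derivative (\<lambda>h. a * h + b * cnj h)) (at z)"

lemma has_wirtinger_imp:
  assumes "has_wirtinger f a b z"
  shows "dz f z = a" "dzbar f z = b" "f differentiable (at z)"
proof -
  have d: "(f has_derivative (\<lambda>h. a * h + b * cnj h)) (at z)" using assms by (simp add: has_wirtinger_def)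
  have e: "frechet_derivative f (at z) = (\<lambda>h. a * h + b * cnj h)" using frechet_derivative_at[OF d] by simp
  show "dz f z = a" "dzbar f z = b" by (simp_all add: dz_def dzbar_def e algebra_simps)
  show "f differentiable (at z)" using d by (auto simp: differentiable_def)
qed

lemma has_wirtinger_cong:
  assumes "has_wirtinger f a b z" "open S" "z \<in> S" "\<And>x. x \<in> S \<Longrightarrow> f x = g x"
  shows "has_wirtinger g a b z"
  using assms unfolding has_wirtinger_def by (rule has_derivative_transform_within_open)

lemma has_wirtinger_holomorphic:
  assumes "(f has_field_derivative f') (at z)"
  shows "has_wirtinger f f' 0 z"
  using assms unfolding has_wirtinger_def has_field_derivative_def
  by (rule has_derivative_eq_rhs) auto

lemma has_wirtinger_cnj:
  assumes "has_wirtinger f a b z"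
  shows "has_wirtinger (\<lambda>z. cnj (f z)) (cnj b) (cnj a) z"
  using has_derivative_cnj[OF assms[unfolded has_wirtinger_def]] unfolding has_wirtinger_def
  by (rule has_derivative_eq_rhs) (auto simp: add.commute)

lemma has_wirtinger_add:
  assumes "has_wirtinger f a b z" "has_wirtinger g c d z"
  shows "has_wirtinger (\<lambda>z. f z + g z) (a + c) (b + d) z"
  using has_derivative_add[OF assms[unfolded has_wirtinger_def]] unfolding has_wirtinger_def
  by (rule has_derivative_eq_rhs) (auto simp: algebra_simps)

lemma has_wirtinger_diff:
  assumes "has_wirtinger f a b z" "has_wirtinger g c d z"
  shows "has_wirtinger (\<lambda>z. f z - g z) (a - c) (b - d) z"
  using has_derivative_diff[OF assms[unfolded has_wirtinger_def]] unfolding has_wirtinger_def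
  by (rule has_derivative_eq_rhs) (auto simp: algebra_simps)

lemma has_wirtinger_mult:
  assumes "has_wirtinger f a b z" "has_wirtinger g c d z"
  shows "has_wirtinger (\<lambda>z. f z * g z) (a * g z + f z * c) (b * g z + f z * d) z"
  using has_derivative_mult[OF assms[unfolded has_wirtinger_def]] unfolding has_wirtinger_def
  by (rule has_derivative_eq_rhs) (auto simp: algebra_simps)

lemma has_wirtinger_compose:
  assumes "has_wirtinger f a b z" "(g has_field_derivative g') (at (f z))"
  shows "has_wirtinger (\<lambda>z. g (f z)) (g' * a) (g' * b) z"
  using has_derivative_compose[OF assms(1)[unfolded has_wirtinger_def] assms(2)[unfolded has_field_derivative_def]]
  unfolding has_wirtinger_def
  by (rule has_derivative_eq_rhs) (auto simp: algebra_simps)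

lemma has_wirtinger_inverse:
  assumes "has_wirtinger f a b z" "f z \<noteq> 0"
  shows "has_wirtinger (\<lambda>z. inverse (f z)) (- a / (f z)\<^sup>2) (- b / (f z)\<^sup>2) z"
proof -
  have "has_wirtinger (\<lambda>z. inverse (f z)) (- (inverse (f z) ^ Suc (Suc 0)) * a) (- (inverse (f z) ^ Suc (Suc 0)) * b) z"
    by (rule has_wirtinger_compose[OF assms(1)]) (rule DERIV_inverse[OF assms(2)])
  then show ?thesis by (simp add: divide_inverse power2_eq_square mult_ac)
qed

text \<open>A class closed under both Wirtinger derivatives that contains the derivatives of \<open>log J\<^sub>f\<close>.\<close>

inductive wirtinger_smooth :: "(complex \<Rightarrow> complex) \<Rightarrow> bool" where
  holo: "f holomorphic_on ball 0 1 \<Longrightarrow> wirtinger_smooth f"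
| conj: "wirtinger_smooth f \<Longrightarrow> wirtinger_smooth (\<lambda>z. cnj (f z))"
| add: "wirtinger_smooth f \<Longrightarrow> wirtinger_smooth g \<Longrightarrow> wirtinger_smooth (\<lambda>z. f z + g z)"
| mult: "wirtinger_smooth f \<Longrightarrow> wirtinger_smooth g \<Longrightarrow> wirtinger_smooth (\<lambda>z. f z * g z)"
| inv: "wirtinger_smooth f \<Longrightarrow> (\<And>z. z \<in> ball 0 1 \<Longrightarrow> f z \<noteq> 0) \<Longrightarrow> wirtinger_smooth (\<lambda>z. inverse (f z))"

lemma wirtinger_smooth_const: "wirtinger_smooth (\<lambda>z. c)"
  by (rule wirtinger_smooth.holo) auto

lemma wirtinger_smooth_diff:
  assumes "wirtinger_smooth f" "wirtinger_smooth g"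
  shows "wirtinger_smooth (\<lambda>z. f z - g z)"
  using wirtinger_smooth.add[OF assms(1) wirtinger_smooth.mult[OF wirtinger_smooth_const assms(2)], of "-1"] by simp

lemma wirtinger_smooth_derivs:
  "wirtinger_smooth f \<Longrightarrow> \<exists>a b. wirtinger_smooth a \<and> wirtinger_smooth b \<and> (\<forall>z\<in>ball 0 1. has_wirtinger f (a z) (b z) z)"
proof (induction rule: wirtinger_smooth.induct)
  case (holo f)
  have "wirtinger_smooth (deriv f)" using holo by (intro wirtinger_smooth.holo holomorphic_deriv) auto
  moreover have "\<forall>z\<in>ball 0 1. has_wirtinger f (deriv f z) 0 z"
    using holo holomorphic_derivI[OF holo] by (auto intro: has_wirtinger_holomorphic)
  ultimately show ?case using wirtinger_smooth_const[of 0] by (intro exI[of _ "deriv f"] exI[of _ "\<lambda>_. 0"]) auto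
next
  case (conj f)
  then obtain a b where "wirtinger_smooth a" "wirtinger_smooth b" "\<forall>z\<in>ball 0 1. has_wirtinger f (a z) (b z) z" by blast
  then show ?case
    by (intro exI[of _ "\<lambda>z. cnj (b z)"] exI[of _ "\<lambda>z. cnj (a z)"])
      (auto intro: wirtinger_smooth.conj has_wirtinger_cnj)
next
  case (add f g)
  then obtain a b c d where "wirtinger_smooth a" "wirtinger_smooth b" "\<forall>z\<in>ball 0 1. has_wirtinger f (a z) (b z) z"
    "wirtinger_smooth c" "wirtinger_smooth d" "\<forall>z\<in>ball 0 1. has_wirtinger g (c z) (d z) z" by blast
  then show ?case
    by (intro exI[of _ "\<lambda>z. a z + c z"] exI[of _ "\<lambda>z. b z + d z"])
      (auto intro: wirtinger_smooth.add has_wirtinger_add)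
next
  case (mult f g)
  then obtain a b c d where "wirtinger_smooth a" "wirtinger_smooth b" "\<forall>z\<in>ball 0 1. has_wirtinger f (a z) (b z) z"
    "wirtinger_smooth c" "wirtinger_smooth d" "\<forall>z\<in>ball 0 1. has_wirtinger g (c z) (d z) z" by blast
  then show ?case using mult.hyps
    by (intro exI[of _ "\<lambda>z. a z * g z + f z * c z"] exI[of _ "\<lambda>z. b z * g z + f z * d z"])
      (auto intro!: wirtinger_smooth.add wirtinger_smooth.mult has_wirtinger_mult)
next
  case (inv f)
  then obtain a b where ab: "wirtinger_smooth a" "wirtinger_smooth b" "\<forall>z\<in>ball 0 1. has_wirtinger f (a z) (b z) z" by blast
  have i: "wirtinger_smooth (\<lambda>z. inverse (f z))" using inv by (intro wirtinger_smooth.inv) auto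
  have "wirtinger_smooth (\<lambda>z. (-1) * c z * (inverse (f z) * inverse (f z)))" if "wirtinger_smooth c" for c
    by (intro wirtinger_smooth.mult wirtinger_smooth_const that i)
  then have s: "wirtinger_smooth (\<lambda>z. - c z / (f z)\<^sup>2)" if "wirtinger_smooth c" for c
    using that by (simp add: divide_inverse power2_eq_square mult_ac)
  show ?case
    by (intro exI[of _ "\<lambda>z. - a z / (f z)\<^sup>2"] exI[of _ "\<lambda>z. - b z / (f z)\<^sup>2"] conjI s ab ballI has_wirtinger_inverse)
      (use ab inv in auto)
qed

text \<open>Agreement on the disc is enough since derivatives at its points are local. Iterated
  derivatives are uncontrolled outside, hence the separate F and the existential form, which can be
  iterated.\<close>

lemma wirtinger_smooth_dz:
  assumes f: "wirtinger_smooth f" and F: "\<And>z. z \<in> ball 0 1 \<Longrightarrow> F z = f z"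
  shows "\<exists>g. wirtinger_smooth g \<and> (\<forall>z\<in>ball 0 1. dz F z = g z)"
    and "\<exists>g. wirtinger_smooth g \<and> (\<forall>z\<in>ball 0 1. dzbar F z = g z)"
    and "F differentiable_on ball 0 1"
proof -
  obtain a b where ab: "wirtinger_smooth a" "wirtinger_smooth b" "\<And>z. z \<in> ball 0 1 \<Longrightarrow> has_wirtinger f (a z) (b z) z"
    using wirtinger_smooth_derivs[OF f] by blast
  have w: "has_wirtinger F (a z) (b z) z" if "z \<in> ball 0 1" for z
    by (rule has_wirtinger_cong[OF ab(3)[OF that] open_ball that]) (simp add: F)
  show "\<exists>g. wirtinger_smooth g \<and> (\<forall>z\<in>ball 0 1. dz F z = g z)"
    using ab(1) has_wirtinger_imp(1)[OF w] by blast
  show "\<exists>g. wirtinger_smooth g \<and> (\<forall>z\<in>ball 0 1. dzbar F z = g z)"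
    using ab(2) has_wirtinger_imp(2)[OF w] by blast
  show "F differentiable_on ball 0 1"
    unfolding differentiable_on_def using has_wirtinger_imp(3)[OF w] differentiable_at_withinI by blast
qed

text \<open>Class membership is asked of the first derivatives of F and not of F: for log J_f these
  are quotients of polynomials in analytic functions and their conjugates, and the logarithm itself
  has no constructor in the class. The induction therefore starts after one derivative.\<close>

lemma smooth_on_if_derivs:
  assumes a: "wirtinger_smooth a" and b: "wirtinger_smooth b"
    and F: "\<And>z. z \<in> ball 0 1 \<Longrightarrow> has_wirtinger F (a z) (b z) z"
  shows "smooth_on (ball 0 1) F"
proof -
  have "ws \<noteq> [] \<Longrightarrow> \<exists>g. wirtinger_smooth g \<and> (\<forall>z\<in>ball 0 1. wirt_iter ws F z = g z)" for ws
  proof (induction ws)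
    case (Cons d ws)
    show ?case
    proof (cases "ws = []")
      case True
      then show ?thesis using a b has_wirtinger_imp(1,2)[OF F] by (cases d) auto
    next
      case False
      then obtain g where "wirtinger_smooth g" "\<forall>z\<in>ball 0 1. wirt_iter ws F z = g z" using Cons by blast
      then show ?thesis using wirtinger_smooth_dz(1,2)[of g "wirt_iter ws F"] by (cases d) auto
    qed
  qed simp
  then have "wirt_iter ws F differentiable_on ball 0 1" if "ws \<noteq> []" for ws
    using wirtinger_smooth_dz(3) that by metis
  moreover have "F differentiable_on ball 0 1"
    unfolding differentiable_on_def using has_wirtinger_imp(3)[OF F] differentiable_at_withinI by blast
  ultimately show ?thesis unfolding smooth_on_def by (metis wirt_iter.simps(1))
qed

text \<open>J_f = h' cnj h' - g' cnj g' is positive, so its logarithm is the principal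
  \<open>Ln\<close> and the chain rule with analytic outer function applies. As log J_f is real, the
  zbar-derivative is the conjugate of the z-derivative.\<close>

lemma has_wirtinger_log_jac:
  assumes h: "h holomorphic_on ball 0 1" and g: "g holomorphic_on ball 0 1"
    and J: "\<And>z. z \<in> ball 0 1 \<Longrightarrow> 0 < jac h g z" and z: "z \<in> ball 0 1"
  defines "\<alpha> \<equiv> (deriv (deriv h) z * cnj (deriv h z) - deriv (deriv g) z * cnj (deriv g z)) / of_real (jac h g z)"
  shows "has_wirtinger (\<lambda>z. of_real (log_jac h g z)) \<alpha> (cnj \<alpha>) z"
proof -
  have Jc: "complex_of_real (jac h g x) = deriv h x * cnj (deriv h x) - deriv g x * cnj (deriv g x)" for x
    by (simp only: jac_def of_real_diff complex_norm_square)
  have h': "deriv h holomorphic_on ball 0 1" and g': "deriv g holomorphic_on ball 0 1"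
    using h g by (auto intro: holomorphic_deriv)
  have wh: "has_wirtinger (deriv h) (deriv (deriv h) z) 0 z" and wg: "has_wirtinger (deriv g) (deriv (deriv g) z) 0 z"
    using holomorphic_derivI[OF h' open_ball z] holomorphic_derivI[OF g' open_ball z]
    by (auto intro: has_wirtinger_holomorphic)
  let ?a = "deriv (deriv h) z * cnj (deriv h z) - deriv (deriv g) z * cnj (deriv g z)"
  have "has_wirtinger (\<lambda>x. complex_of_real (jac h g x)) ?a (cnj ?a) z"
    using has_wirtinger_diff[OF has_wirtinger_mult[OF wh has_wirtinger_cnj[OF wh]] has_wirtinger_mult[OF wg has_wirtinger_cnj[OF wg]]]
    unfolding Jc by (simp add: mult.commute)
  moreover have "complex_of_real (jac h g z) \<notin> \<real>\<^sub>\<le>\<^sub>0" using J[OF z] by simp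
  ultimately have "has_wirtinger (\<lambda>x. Ln (of_real (jac h g x))) (inverse (of_real (jac h g z)) * ?a) (inverse (of_real (jac h g z)) * cnj ?a) z"
    by (intro has_wirtinger_compose has_field_derivative_Ln)
  then have "has_wirtinger (\<lambda>z. of_real (log_jac h g z)) (inverse (of_real (jac h g z)) * ?a) (inverse (of_real (jac h g z)) * cnj ?a) z"
    by (rule has_wirtinger_cong[OF _ open_ball z]) (simp add: log_jac_def Ln_of_real J)
  moreover have "cnj \<alpha> = inverse (of_real (jac h g z)) * cnj ?a" "\<alpha> = inverse (of_real (jac h g z)) * ?a"
    by (simp_all add: \<alpha>_def divide_inverse mult.commute)
  ultimately show ?thesis by simp
qed

lemma smooth_on_log_jac:
  assumes h: "h holomorphic_on ball 0 1" and g: "g holomorphic_on ball 0 1"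
    and J: "\<And>z. z \<in> ball 0 1 \<Longrightarrow> 0 < jac h g z"
  shows "smooth_on (ball 0 1) (\<lambda>z. of_real (log_jac h g z))"
proof -
  define \<alpha> where "\<alpha> z = (deriv (deriv h) z * cnj (deriv h z) - deriv (deriv g) z * cnj (deriv g z)) / of_real (jac h g z)" for z
  have Jc: "complex_of_real (jac h g x) = deriv h x * cnj (deriv h x) - deriv g x * cnj (deriv g x)" for x
    by (simp only: jac_def of_real_diff complex_norm_square)
  have s: "wirtinger_smooth (deriv h)" "wirtinger_smooth (deriv g)" "wirtinger_smooth (deriv (deriv h))" "wirtinger_smooth (deriv (deriv g))"
    using h g by (auto intro!: wirtinger_smooth.holo holomorphic_deriv)
  have j: "wirtinger_smooth (\<lambda>z. of_real (jac h g z))"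
    unfolding Jc by (intro wirtinger_smooth_diff wirtinger_smooth.mult wirtinger_smooth.conj s)
  have "wirtinger_smooth (\<lambda>z. (deriv (deriv h) z * cnj (deriv h z) - deriv (deriv g) z * cnj (deriv g z)) * inverse (of_real (jac h g z)))"
    by (intro wirtinger_smooth_diff wirtinger_smooth.mult wirtinger_smooth.conj wirtinger_smooth.inv s j) (use J in force)
  then have a: "wirtinger_smooth \<alpha>" by (simp add: \<alpha>_def[abs_def] divide_inverse)
  show ?thesis
    by (rule smooth_on_if_derivs[OF a wirtinger_smooth.conj[OF a]])
      (unfold \<alpha>_def, rule has_wirtinger_log_jac[OF h g J])
qed

section \<open>The shear of a harmonic mapping\<close>

lemma disc_auto_identity:
  assumes a: "a \<in> ball 0 1" and z: "z \<in> ball 0 1"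
  shows "1 - (cmod (disc_auto a z))\<^sup>2 = (1 - (cmod a)\<^sup>2) * (1 - (cmod z)\<^sup>2) / (cmod (1 - cnj a * z))\<^sup>2"
proof -
  have l: "cmod (1 - cnj a * z) \<noteq> 0" using one_minus_cnj_mult(4)[OF a z] by simp
  have "complex_of_real ((cmod (1 - cnj a * z))\<^sup>2 - (cmod (a - z))\<^sup>2) = of_real ((1 - (cmod a)\<^sup>2) * (1 - (cmod z)\<^sup>2))"
    by (simp only: of_real_diff of_real_mult of_real_1 complex_norm_square) (simp add: algebra_simps)
  then have "(cmod (1 - cnj a * z))\<^sup>2 - (cmod (a - z))\<^sup>2 = (1 - (cmod a)\<^sup>2) * (1 - (cmod z)\<^sup>2)"
    by (simp only: of_real_eq_iff)
  then show ?thesis using l by (simp add: disc_auto_def norm_divide power_divide field_simps)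
qed

text \<open>The p-th power of 1 - |phi_a|^2 = (1 - |z|^2) |phi_a'|. It brings the integrals of
  \<open>Q_p0\<close> and \<open>Qt_p0\<close> to the kernel of the Carleson condition.\<close>

lemma disc_auto_powr:
  assumes a: "a \<in> ball 0 1" and z: "z \<in> ball 0 1"
  shows "(1 - (cmod (disc_auto a z))\<^sup>2) powr p = (1 - (cmod z)\<^sup>2) powr p * kern p a z"
proof -
  have l: "0 < cmod (1 - cnj a * z)" using one_minus_cnj_mult(4)[OF a z] .
  have "((cmod (1 - cnj a * z))\<^sup>2) powr p = cmod (1 - cnj a * z) powr (2 * p)"
    using powr_powr[of "cmod (1 - cnj a * z)" 2 p] l by simp
  then show ?thesis
    unfolding disc_auto_identity[OF a z] kern_def
    using one_minus_norm_sq[OF a] one_minus_norm_sq[OF z]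
    by (simp add: powr_mult powr_divide powr_minus_divide)
qed

lemma deriv_disc_auto_powr:
  assumes a: "a \<in> ball 0 1" and z: "z \<in> ball 0 1"
  shows "cmod (deriv (disc_auto a) z) powr p = kern p a z"
proof -
  have l: "0 < cmod (1 - cnj a * z)" using one_minus_cnj_mult(4)[OF a z] .
  then have nz: "1 - cnj a * z \<noteq> 0" by auto
  have "(disc_auto a has_field_derivative (- 1 * (1 - cnj a * z) - (a - z) * (- cnj a)) / ((1 - cnj a * z) * (1 - cnj a * z))) (at z)"
    unfolding disc_auto_def[abs_def]
    by (rule DERIV_divide) (use nz in \<open>auto intro!: derivative_eq_intros\<close>)
  then have "deriv (disc_auto a) z = (- 1 * (1 - cnj a * z) - (a - z) * (- cnj a)) / ((1 - cnj a * z) * (1 - cnj a * z))"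
    by (rule DERIV_imp_deriv)
  also have "- 1 * (1 - cnj a * z) - (a - z) * (- cnj a) = - of_real (1 - (cmod a)\<^sup>2)"
    by (simp only: of_real_diff of_real_1 complex_norm_square) (simp add: algebra_simps)
  finally have "cmod (deriv (disc_auto a) z) = \<bar>1 - (cmod a)\<^sup>2\<bar> / (cmod (1 - cnj a * z))\<^sup>2"
    by (simp only: norm_divide norm_minus_cancel norm_of_real norm_mult power2_eq_square)
  also have "\<bar>1 - (cmod a)\<^sup>2\<bar> = 1 - (cmod a)\<^sup>2" using one_minus_norm_sq(1)[OF a] by simp
  finally have d: "cmod (deriv (disc_auto a) z) = (1 - (cmod a)\<^sup>2) / (cmod (1 - cnj a * z))\<^sup>2" .
  have "((cmod (1 - cnj a * z))\<^sup>2) powr p = cmod (1 - cnj a * z) powr (2 * p)"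
    using powr_powr[of "cmod (1 - cnj a * z)" 2 p] l by simp
  then show ?thesis
    unfolding d kern_def using one_minus_norm_sq(1)[OF a]
    by (simp add: powr_divide powr_minus_divide)
qed

lemma vanishing_carleson_imp:
  assumes v: "vanishing_carleson p (density lborel (\<lambda>z. indicator (ball 0 1) z * ennreal (f z)))"
    and f: "continuous_on (ball 0 1) f" "\<And>z. z \<in> ball 0 1 \<Longrightarrow> 0 \<le> f z"
  shows "vanishing p f"
proof -
  let ?\<mu> = "density lborel (\<lambda>z. indicator (ball 0 1) z * ennreal (f z))"
  have "tends_zero_at_boundary (\<lambda>a. \<integral>\<^sup>+ z. ennreal ((cmod (deriv (disc_auto a) z)) powr p) \<partial>?\<mu>)"
    using v by (simp add: vanishing_carleson_def)
  then show ?thesis unfolding vanishing_def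
  proof (rule tends_zero_at_boundary_mono)
    fix a :: complex assume a: "a \<in> ball 0 1"
    have m: "(\<lambda>z. indicator (ball 0 1) z * ennreal (kern p a z)) \<in> borel_measurable lborel"
      by (intro measurable_indicator_ball continuous_on_kern a)
    have "(\<integral>\<^sup>+ z. indicator (ball 0 1) z * ennreal (f z * kern p a z) \<partial>lborel)
       = (\<integral>\<^sup>+ z. (indicator (ball 0 1) z * ennreal (f z)) * (indicator (ball 0 1) z * ennreal (kern p a z)) \<partial>lborel)"
      by (rule nn_integral_cong) (auto simp: indicator_def ennreal_mult' f)
    also have "\<dots> = (\<integral>\<^sup>+ z. indicator (ball 0 1) z * ennreal (kern p a z) \<partial>?\<mu>)"
      by (rule nn_integral_density[symmetric]) (intro measurable_indicator_ball f m)+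
    also have "\<dots> \<le> (\<integral>\<^sup>+ z. ennreal ((cmod (deriv (disc_auto a) z)) powr p) \<partial>?\<mu>)"
      by (rule nn_integral_mono) (auto simp: indicator_def deriv_disc_auto_powr[OF a])
    finally show "(\<integral>\<^sup>+ z. indicator (ball 0 1) z * ennreal (f z * kern p a z) \<partial>lborel)
       \<le> (\<integral>\<^sup>+ z. ennreal ((cmod (deriv (disc_auto a) z)) powr p) \<partial>?\<mu>)" .
  qed
qed

lemma tends_zero_disc_auto_iff:
  "tends_zero_at_boundary (\<lambda>a. \<integral>\<^sup>+ z. indicator (ball 0 1) z *
        ennreal (f z * (1 - (cmod (disc_auto a z))\<^sup>2) powr p) \<partial>lborel)
    \<longleftrightarrow> vanishing p (\<lambda>z. f z * (1 - (cmod z)\<^sup>2) powr p)"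
proof -
  have eq: "(\<integral>\<^sup>+ z. indicator (ball 0 1) z * ennreal (f z * (1 - (cmod (disc_auto a z))\<^sup>2) powr p) \<partial>lborel)
     = (\<integral>\<^sup>+ z. indicator (ball 0 1) z * ennreal (f z * (1 - (cmod z)\<^sup>2) powr p * kern p a z) \<partial>lborel)"
    if "a \<in> ball 0 1" for a
    by (rule nn_integral_cong) (use that in \<open>auto simp: indicator_def disc_auto_powr mult.assoc\<close>)
  show ?thesis
    unfolding vanishing_def
    by (rule iffI; erule tends_zero_at_boundary_mono) (simp_all add: eq)
qed

text \<open>Cauchy's estimate on the circle of radius (1 - |z|)/2 about z, whence the factor
  2.\<close>

lemma cauchy_deriv_bound:
  assumes f: "f holomorphic_on ball 0 1" and B: "\<And>z. z \<in> ball 0 1 \<Longrightarrow> cmod (f z) \<le> B" and z: "z \<in> ball 0 1"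
  shows "cmod (deriv f z) * (1 - cmod z) \<le> 2 * B"
proof -
  define s where "s = (1 - cmod z) / 2"
  have s: "0 < s" using z by (simp add: s_def)
  have sub: "cball z s \<subseteq> ball 0 1"
  proof
    fix x assume "x \<in> cball z s"
    then have "cmod (z - x) \<le> s" by (simp add: dist_norm)
    moreover have "cmod x \<le> cmod z + cmod (z - x)" by (metis norm_minus_commute norm_triangle_sub)
    moreover have "cmod z + s < 1" using s unfolding s_def by argo
    ultimately show "x \<in> ball 0 1" by simp
  qed
  have "norm ((deriv ^^ 1) f z) \<le> fact 1 * B / s ^ 1"
  proof (rule Cauchy_inequality)
    show "f holomorphic_on ball z s" by (rule holomorphic_on_subset[OF f]) (use sub in auto)
    show "continuous_on (cball z s) f"
      by (rule continuous_on_subset[OF holomorphic_on_imp_continuous_on[OF f] sub])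
    show "norm (f x) \<le> B" if "norm (z - x) = s" for x
      by (rule B) (use sub that in \<open>auto simp: dist_norm\<close>)
  qed (rule s)
  then show ?thesis using s z by (simp add: s_def field_simps)
qed

text \<open>Continuity on the compact closed disc bounds phi; through Cauchy's estimate this becomes
  the bound on |phi'| (1 - |z|) in \<open>riccati_little\<close>.\<close>

lemma jordan_boundary_bounded:
  assumes "jordan_boundary \<phi>"
  obtains B where "\<And>z. z \<in> ball 0 1 \<Longrightarrow> cmod (\<phi> z) \<le> B"
proof -
  obtain \<Phi> where \<Phi>: "continuous_on (cball 0 1) \<Phi>" "\<forall>z\<in>ball 0 1. \<Phi> z = \<phi> z"
    using assms unfolding jordan_boundary_def by blast
  have "bounded (\<Phi> ` cball 0 1)"
    by (intro compact_imp_bounded compact_continuous_image \<Phi>) auto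
  then obtain B where "\<And>z. z \<in> cball 0 1 \<Longrightarrow> cmod (\<Phi> z) \<le> B"
    unfolding bounded_iff by (meson imageI)
  then have "cmod (\<phi> z) \<le> B" if "z \<in> ball 0 1" for z
    using \<Phi>(2) that by (metis ball_subset_cball subsetD)
  then show ?thesis by (rule that)
qed

lemma one_plus_small_norm: "cmod x \<le> k \<Longrightarrow> 1 - k \<le> cmod (1 + x)"
  using norm_triangle_ineq2[of 1 "- x"] by simp

section \<open>Log-Jacobian and Schwarzian in terms of the analytic shear\<close>

context
  fixes h g :: "complex \<Rightarrow> complex" and lam :: complex and k :: real
  assumes h: "h holomorphic_on ball 0 1" and g: "g holomorphic_on ball 0 1"
    and h0: "\<And>z. z \<in> ball 0 1 \<Longrightarrow> deriv h z \<noteq> 0"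
    and k1: "k < 1" and wk: "\<And>z. z \<in> ball 0 1 \<Longrightarrow> cmod (dil h g z) \<le> k"
    and lam: "cmod lam = 1"
begin

abbreviation (input) "w \<equiv> dil h g"

definition pre_schwarzian :: "complex \<Rightarrow> complex" where
  "pre_schwarzian z = deriv (deriv (\<lambda>z. h z + lam * g z)) z / deriv (\<lambda>z. h z + lam * g z) z"

text \<open>The coefficient A of the overview. The first summand comes from h''/h' = y - lam w'/(1 +
  lam w), the second from the z-derivative -w' cnj w/(1 - |w|^2) of log(1 - |w|^2).\<close>

definition dil_correction :: "complex \<Rightarrow> complex" where
  "dil_correction z = lam / (1 + lam * w z) + cnj (w z) / (1 - w z * cnj (w z))"

lemma dil_bound_nonneg: "0 \<le> k"
  using wk[of 0] norm_ge_zero[of "w 0"] by (simp del: norm_ge_zero)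

lemma deriv_h_holomorphic: "deriv h holomorphic_on ball 0 1" and deriv_g_holomorphic: "deriv g holomorphic_on ball 0 1"
  using h g by (auto intro: holomorphic_deriv)

lemma dil_holomorphic: "w holomorphic_on ball 0 1"
  unfolding dil_def[abs_def] by (rule holomorphic_on_divide[OF deriv_g_holomorphic deriv_h_holomorphic h0])

lemma deriv_g_eq: "z \<in> ball 0 1 \<Longrightarrow> deriv g z = w z * deriv h z"
  using h0 by (simp add: dil_def)

lemma denominator_bounds:
  assumes "z \<in> ball 0 1"
  shows "1 - k \<le> cmod (1 + lam * w z)" "1 - k \<le> cmod (1 - w z * cnj (w z))" "1 + lam * w z \<noteq> 0" "1 - w z * cnj (w z) \<noteq> 0"
    "1 - (cmod (w z))\<^sup>2 > 0"
proof -
  show 1: "1 - k \<le> cmod (1 + lam * w z)"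
    by (rule one_plus_small_norm) (use wk[OF assms] lam in \<open>simp add: norm_mult\<close>)
  have "(cmod (w z))\<^sup>2 \<le> k\<^sup>2" using wk[OF assms] by (intro power_mono) auto
  also have "k\<^sup>2 \<le> k" using dil_bound_nonneg k1 by (simp add: power2_eq_square mult_left_le)
  finally have sq: "(cmod (w z))\<^sup>2 \<le> k" .
  then show "1 - (cmod (w z))\<^sup>2 > 0" using k1 by simp
  show 2: "1 - k \<le> cmod (1 - w z * cnj (w z))"
    using one_plus_small_norm[of "- (w z * cnj (w z))" k] sq by (simp add: norm_mult power2_eq_square)
  show "1 + lam * w z \<noteq> 0" "1 - w z * cnj (w z) \<noteq> 0" using 1 2 k1 by auto
qed

lemma jac_factorization: "z \<in> ball 0 1 \<Longrightarrow> jac h g z = (cmod (deriv h z))\<^sup>2 * (1 - (cmod (w z))\<^sup>2)"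
  unfolding jac_def deriv_g_eq by (simp add: norm_mult power_mult_distrib algebra_simps)

lemma jac_pos: "z \<in> ball 0 1 \<Longrightarrow> 0 < jac h g z"
  unfolding jac_factorization using h0 denominator_bounds(5) by (intro mult_pos_pos) auto

lemma second_deriv_g_eq:
  assumes z: "z \<in> ball 0 1"
  shows "deriv (deriv g) z = deriv w z * deriv h z + w z * deriv (deriv h) z"
proof -
  have "((\<lambda>z. w z * deriv h z) has_field_derivative deriv w z * deriv h z + deriv (deriv h) z * w z) (at z)"
    by (intro DERIV_mult holomorphic_derivI[OF dil_holomorphic open_ball z] holomorphic_derivI[OF deriv_h_holomorphic open_ball z])
  then have "(deriv g has_field_derivative deriv w z * deriv h z + deriv (deriv h) z * w z) (at z)"
    by (rule has_field_derivative_transform_within_open[OF _ open_ball z]) (simp add: deriv_g_eq)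
  then show ?thesis by (simp add: DERIV_imp_deriv mult.commute)
qed

lemma deriv_shear: "z \<in> ball 0 1 \<Longrightarrow> deriv (\<lambda>z. h z + lam * g z) z = deriv h z * (1 + lam * w z)"
proof -
  assume z: "z \<in> ball 0 1"
  have "((\<lambda>z. h z + lam * g z) has_field_derivative deriv h z + lam * deriv g z) (at z)"
    by (intro DERIV_add DERIV_cmult holomorphic_derivI[OF h open_ball z] holomorphic_derivI[OF g open_ball z])
  then show ?thesis using deriv_g_eq[OF z] by (simp add: DERIV_imp_deriv algebra_simps)
qed

lemma shear_holomorphic: "(\<lambda>z. h z + lam * g z) holomorphic_on ball 0 1"
  using h g by (intro holomorphic_intros)

lemma deriv_shear_holomorphic: "deriv (\<lambda>z. h z + lam * g z) holomorphic_on ball 0 1"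
  by (rule holomorphic_deriv[OF shear_holomorphic open_ball])

lemma deriv_shear_nonzero: "z \<in> ball 0 1 \<Longrightarrow> deriv (\<lambda>z. h z + lam * g z) z \<noteq> 0"
  using deriv_shear denominator_bounds(3) h0 by simp

lemma pre_schwarzian_holomorphic: "pre_schwarzian holomorphic_on ball 0 1"
  unfolding pre_schwarzian_def[abs_def]
  by (rule holomorphic_on_divide[OF holomorphic_deriv[OF deriv_shear_holomorphic open_ball] deriv_shear_holomorphic deriv_shear_nonzero])

lemma pre_schwarzian_eq:
  assumes z: "z \<in> ball 0 1"
  shows "pre_schwarzian z = deriv (deriv h) z / deriv h z + lam * deriv w z / (1 + lam * w z)"
proof -
  have "((\<lambda>z. deriv h z * (1 + lam * w z)) has_field_derivative deriv (deriv h) z * (1 + lam * w z) + (0 + lam * deriv w z) * deriv h z) (at z)"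
    by (intro DERIV_mult DERIV_add DERIV_const DERIV_cmult holomorphic_derivI[OF dil_holomorphic open_ball z] holomorphic_derivI[OF deriv_h_holomorphic open_ball z])
  then have "(deriv (\<lambda>z. h z + lam * g z) has_field_derivative deriv (deriv h) z * (1 + lam * w z) + (0 + lam * deriv w z) * deriv h z) (at z)"
    by (rule has_field_derivative_transform_within_open[OF _ open_ball z]) (simp add: deriv_shear)
  then have "deriv (deriv (\<lambda>z. h z + lam * g z)) z = deriv (deriv h) z * (1 + lam * w z) + lam * deriv w z * deriv h z"
    by (simp add: DERIV_imp_deriv)
  then show ?thesis
    unfolding pre_schwarzian_def using deriv_shear[OF z] h0[OF z] denominator_bounds(3)[OF z] by (simp add: field_simps)
qed

text \<open>From J_f = |h'|^2 (1 - |w|^2) one gets F_z = h''/h' - w' cnj w/(1 - |w|^2); then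
  \<open>pre_schwarzian_eq\<close> replaces h''/h'.\<close>

lemma dz_log_jac:
  assumes z: "z \<in> ball 0 1"
  shows "dz (\<lambda>z. of_real (log_jac h g z)) z = pre_schwarzian z - deriv w z * dil_correction z"
    and "dzbar (\<lambda>z. of_real (log_jac h g z)) z = cnj (pre_schwarzian z - deriv w z * dil_correction z)"
proof -
  let ?a = "(deriv (deriv h) z * cnj (deriv h z) - deriv (deriv g) z * cnj (deriv g z)) / of_real (jac h g z)"
  have d: "has_wirtinger (\<lambda>z. of_real (log_jac h g z)) ?a (cnj ?a) z"
    by (rule has_wirtinger_log_jac[OF h g jac_pos z])
  have b: "1 - w z * cnj (w z) \<noteq> 0" "1 + lam * w z \<noteq> 0" "deriv h z \<noteq> 0" using denominator_bounds[OF z] h0[OF z] by auto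
  have J: "complex_of_real (jac h g z) = deriv h z * cnj (deriv h z) * (1 - w z * cnj (w z))"
    unfolding jac_factorization[OF z] by (simp only: of_real_mult of_real_diff of_real_1 complex_norm_square)
  have "?a = (deriv (deriv h) z * (1 - w z * cnj (w z)) - deriv w z * deriv h z * cnj (w z)) * cnj (deriv h z)
      / (deriv h z * (1 - w z * cnj (w z)) * cnj (deriv h z))"
    unfolding J second_deriv_g_eq[OF z] deriv_g_eq[OF z] by (simp add: algebra_simps)
  also have "\<dots> = (deriv (deriv h) z * (1 - w z * cnj (w z)) - deriv w z * deriv h z * cnj (w z)) / (deriv h z * (1 - w z * cnj (w z)))"
    using b by simp
  also have "\<dots> = deriv (deriv h) z / deriv h z - deriv w z * cnj (w z) / (1 - w z * cnj (w z))"
    using b by (simp add: diff_divide_distrib)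
  also have "\<dots> = pre_schwarzian z - deriv w z * dil_correction z"
    unfolding pre_schwarzian_eq[OF z] dil_correction_def by (simp add: algebra_simps)
  finally have "?a = pre_schwarzian z - deriv w z * dil_correction z" .
  then show "dz (\<lambda>z. of_real (log_jac h g z)) z = pre_schwarzian z - deriv w z * dil_correction z"
    "dzbar (\<lambda>z. of_real (log_jac h g z)) z = cnj (pre_schwarzian z - deriv w z * dil_correction z)"
    using has_wirtinger_imp(1,2)[OF d] by simp_all
qed

text \<open>The z-derivative of \<open>dil_correction\<close> is w' T, so the right-hand side is
  F_zz - F_z^2/2 for F_z = y - w' A.\<close>

lemma schwarzian_eq:
  assumes z: "z \<in> ball 0 1"
  defines "T \<equiv> (cnj (w z))\<^sup>2 / (1 - w z * cnj (w z))\<^sup>2 - lam\<^sup>2 / (1 + lam * w z)\<^sup>2"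
  shows "schwarzian h g z = deriv pre_schwarzian z - deriv (deriv w) z * dil_correction z - (deriv w z)\<^sup>2 * T
     - (pre_schwarzian z - deriv w z * dil_correction z)\<^sup>2 / 2"
proof -
  have w': "deriv w holomorphic_on ball 0 1" by (rule holomorphic_deriv[OF dil_holomorphic open_ball])
  have W: "has_wirtinger w (deriv w z) 0 z" and W': "has_wirtinger (deriv w) (deriv (deriv w) z) 0 z"
    and P: "has_wirtinger pre_schwarzian (deriv pre_schwarzian z) 0 z"
    using holomorphic_derivI[OF dil_holomorphic open_ball z] holomorphic_derivI[OF w' open_ball z] holomorphic_derivI[OF pre_schwarzian_holomorphic open_ball z]
    by (auto intro: has_wirtinger_holomorphic)
  have C: "has_wirtinger (\<lambda>_. c) 0 0 z" for c by (rule has_wirtinger_holomorphic) simp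
  note b = denominator_bounds(3,4)[OF z]
  have t1: "has_wirtinger (\<lambda>z. inverse (1 + lam * w z)) (- (0 + (0 * w z + lam * deriv w z)) / (1 + lam * w z)\<^sup>2) (- (0 + (0 * w z + lam * 0)) / (1 + lam * w z)\<^sup>2) z"
    by (intro has_wirtinger_inverse has_wirtinger_add has_wirtinger_mult C W b)
  have t2: "has_wirtinger (\<lambda>z. inverse (1 - w z * cnj (w z))) (- (0 - (deriv w z * cnj (w z) + w z * cnj 0)) / (1 - w z * cnj (w z))\<^sup>2) (- (0 - (0 * cnj (w z) + w z * cnj (deriv w z))) / (1 - w z * cnj (w z))\<^sup>2) z"
    by (intro has_wirtinger_inverse has_wirtinger_diff has_wirtinger_mult has_wirtinger_cnj C W b)
  obtain \<gamma> where "has_wirtinger (\<lambda>z. lam * inverse (1 + lam * w z) + cnj (w z) * inverse (1 - w z * cnj (w z)))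
      (0 * inverse (1 + lam * w z) + lam * (- (0 + (0 * w z + lam * deriv w z)) / (1 + lam * w z)\<^sup>2)
       + (cnj 0 * inverse (1 - w z * cnj (w z)) + cnj (w z) * (- (0 - (deriv w z * cnj (w z) + w z * cnj 0)) / (1 - w z * cnj (w z))\<^sup>2))) \<gamma> z"
    using has_wirtinger_add[OF has_wirtinger_mult[OF C t1] has_wirtinger_mult[OF has_wirtinger_cnj[OF W] t2]] by blast
  moreover have "(0 * inverse (1 + lam * w z) + lam * (- (0 + (0 * w z + lam * deriv w z)) / (1 + lam * w z)\<^sup>2)
       + (cnj 0 * inverse (1 - w z * cnj (w z)) + cnj (w z) * (- (0 - (deriv w z * cnj (w z) + w z * cnj 0)) / (1 - w z * cnj (w z))\<^sup>2)))
      = deriv w z * T"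
    unfolding T_def by (simp add: right_diff_distrib power2_eq_square mult_ac)
  ultimately have cw: "has_wirtinger dil_correction (deriv w z * T) \<gamma> z"
    by (simp add: dil_correction_def[abs_def] divide_inverse)
  have "has_wirtinger (\<lambda>z. pre_schwarzian z - deriv w z * dil_correction z)
     (deriv pre_schwarzian z - (deriv (deriv w) z * dil_correction z + deriv w z * (deriv w z * T))) (0 - (0 * dil_correction z + deriv w z * \<gamma>)) z"
    by (intro has_wirtinger_diff has_wirtinger_mult P W' cw)
  then have "has_wirtinger (dz (\<lambda>z. of_real (log_jac h g z)))
     (deriv pre_schwarzian z - (deriv (deriv w) z * dil_correction z + deriv w z * (deriv w z * T))) (0 - (0 * dil_correction z + deriv w z * \<gamma>)) z"
    by (rule has_wirtinger_cong[OF _ open_ball z]) (simp add: dz_log_jac)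
  from has_wirtinger_imp(1)[OF this] show ?thesis
    unfolding schwarzian_def dz_log_jac(1)[OF z] by (simp add: power2_eq_square algebra_simps)
qed

lemma dil_correction_bound: "z \<in> ball 0 1 \<Longrightarrow> cmod (dil_correction z) \<le> 2 / (1 - k)"
proof -
  assume z: "z \<in> ball 0 1"
  note b = denominator_bounds(1,2)[OF z]
  have "cmod (dil_correction z) \<le> cmod (lam / (1 + lam * w z)) + cmod (cnj (w z) / (1 - w z * cnj (w z)))"
    unfolding dil_correction_def by (rule norm_triangle_ineq)
  also have "\<dots> \<le> 1 / (1 - k) + 1 / (1 - k)"
    unfolding norm_divide using b k1 lam wk[OF z] by (intro add_mono frac_le) auto
  finally show ?thesis by simp
qed

text \<open>Solved for S_phi, the identity leaves the remainder w'^2 (T + A^2/2) - y w' A. In each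
  product one factor is O(1/(1 - |z|)): w' by Cauchy's estimate, as |w| < 1, and y by hypothesis. So
  the remainder is O(|w'|/(1 - |z|^2)), and its square with weight exponent 2 + p becomes |w'|^2
  with weight exponent p.\<close>

lemma shear_schwarzian_bound:
  assumes C: "\<And>z. z \<in> ball 0 1 \<Longrightarrow> cmod (pre_schwarzian z) * (1 - cmod z) \<le> C"
  obtains A D where "0 \<le> A" "0 \<le> D" "\<And>z. z \<in> ball 0 1 \<Longrightarrow>
     (cmod (deriv pre_schwarzian z - (pre_schwarzian z)\<^sup>2 / 2))\<^sup>2 * (1 - (cmod z)\<^sup>2) powr (2 + p)
     \<le> 3 * ((cmod (schwarzian h g z))\<^sup>2 * (1 - (cmod z)\<^sup>2) powr (2 + p))
       + A * ((cmod (deriv (deriv w) z))\<^sup>2 * (1 - (cmod z)\<^sup>2) powr (2 + p))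
       + D * ((cmod (deriv w z))\<^sup>2 * (1 - (cmod z)\<^sup>2) powr p)"
proof -
  define a where "a = 2 / (1 - k)"
  have a0: "0 \<le> a" using k1 by (simp add: a_def)
  define b where "b = 2 / (1 - k)\<^sup>2 + a\<^sup>2 / 2"
  have b0: "0 \<le> b" by (simp add: b_def)
  \<comment> \<open>The inner 2 is the bound for |w'| (1 - |z|); the outer 2 replaces 1 - |z| by 1 -
    |z|^2 in the denominator.\<close>
  define d where "d = 2 * (a * C + 2 * b)"
  show ?thesis
  proof (rule that[of "3 * a\<^sup>2" "3 * d\<^sup>2"])
    fix z :: complex assume z: "z \<in> ball 0 1"
    let ?r = "1 - (cmod z)\<^sup>2" and ?s = "1 - cmod z"
    let ?S = "cmod (schwarzian h g z)" and ?w1 = "cmod (deriv w z)" and ?w2 = "cmod (deriv (deriv w) z)"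
    have r: "0 < ?r" "?r \<le> 2 * ?s"
    proof -
      show "0 < ?r" by (rule one_minus_norm_sq(1)[OF z])
      have "?r = ?s * (1 + cmod z)" by (simp add: power2_eq_square algebra_simps)
      also have "\<dots> \<le> ?s * 2" using z by (intro mult_left_mono) auto
      finally show "?r \<le> 2 * ?s" by simp
    qed
    have s: "0 < ?s" using z by simp
    define T where "T = (cnj (w z))\<^sup>2 / (1 - w z * cnj (w z))\<^sup>2 - lam\<^sup>2 / (1 + lam * w z)\<^sup>2"
    have ca: "cmod (dil_correction z) \<le> a" using dil_correction_bound[OF z] by (simp add: a_def)
    have T: "cmod T \<le> 2 / (1 - k)\<^sup>2"
    proof -
      have w1: "(cmod (w z))\<^sup>2 \<le> 1" using wk[OF z] k1 by (simp add: abs_square_le_1)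
      have "cmod T \<le> cmod ((cnj (w z))\<^sup>2 / (1 - w z * cnj (w z))\<^sup>2) + cmod (lam\<^sup>2 / (1 + lam * w z)\<^sup>2)"
        unfolding T_def by (rule norm_triangle_ineq4)
      also have "\<dots> \<le> 1 / (1 - k)\<^sup>2 + 1 / (1 - k)\<^sup>2"
        unfolding norm_divide norm_power using denominator_bounds(1,2)[OF z] k1 lam w1
        by (intro add_mono frac_le power_mono) auto
      finally show ?thesis by simp
    qed
    have w1s: "?w1 * ?s \<le> 2"
      using cauchy_deriv_bound[OF dil_holomorphic _ z, of 1] wk k1 by force
    have eq: "deriv pre_schwarzian z - (pre_schwarzian z)\<^sup>2 / 2
        = schwarzian h g z + deriv (deriv w) z * dil_correction z + ((deriv w z)\<^sup>2 * (T + (dil_correction z)\<^sup>2 / 2) - pre_schwarzian z * deriv w z * dil_correction z)"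
      unfolding schwarzian_eq[OF z] T_def by (simp add: power2_eq_square field_simps)
    have B: "cmod (T + (dil_correction z)\<^sup>2 / 2) \<le> b"
    proof -
      have "cmod (T + (dil_correction z)\<^sup>2 / 2) \<le> cmod T + (cmod (dil_correction z))\<^sup>2 / 2"
        by (rule order_trans[OF norm_triangle_ineq]) (simp add: norm_divide norm_power)
      also have "\<dots> \<le> b" unfolding b_def using T ca by (intro add_mono divide_right_mono power_mono) auto
      finally show ?thesis .
    qed
    have C0: "0 \<le> C" using C[OF z] s by (meson mult_nonneg_nonneg norm_ge_zero less_imp_le order_trans)
    have X: "cmod ((deriv w z)\<^sup>2 * (T + (dil_correction z)\<^sup>2 / 2) - pre_schwarzian z * deriv w z * dil_correction z) \<le> d * (?w1 / ?r)"
    proof -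
      have w1: "?w1 \<le> 2 / ?s" using w1s s by (simp add: le_divide_eq)
      have y1: "cmod (pre_schwarzian z) \<le> C / ?s" using C[OF z] s by (simp add: le_divide_eq)
      have "cmod ((deriv w z)\<^sup>2 * (T + (dil_correction z)\<^sup>2 / 2) - pre_schwarzian z * deriv w z * dil_correction z)
         \<le> ?w1 * ?w1 * cmod (T + (dil_correction z)\<^sup>2 / 2) + cmod (pre_schwarzian z) * ?w1 * cmod (dil_correction z)"
        by (rule order_trans[OF norm_triangle_ineq4]) (simp add: norm_mult power2_eq_square)
      also have "\<dots> \<le> (2 / ?s) * ?w1 * b + (C / ?s) * ?w1 * a"
        using w1 y1 B ca b0 a0 s C0 by (intro add_mono mult_mono) auto
      also have "\<dots> = (a * C + 2 * b) * (?w1 / ?s)" by (simp add: algebra_simps add_divide_distrib)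
      also have "\<dots> \<le> (a * C + 2 * b) * (?w1 * (2 / ?r))"
      proof (rule mult_left_mono)
        have "1 / ?s \<le> 2 / ?r" using r s by (simp add: field_simps)
        then have "?w1 * (1 / ?s) \<le> ?w1 * (2 / ?r)" by (rule mult_left_mono) simp
        then show "?w1 / ?s \<le> ?w1 * (2 / ?r)" by simp
        show "0 \<le> a * C + 2 * b" using a0 b0 C0 by simp
      qed
      also have "\<dots> = d * (?w1 / ?r)" by (simp add: d_def)
      finally show ?thesis .
    qed
    have "cmod (deriv pre_schwarzian z - (pre_schwarzian z)\<^sup>2 / 2) \<le> ?S + a * ?w2 + d * (?w1 / ?r)"
      unfolding eq using X ca
      by (intro order_trans[OF norm_triangle_3] add_mono) (auto simp: norm_mult mult.commute intro: mult_right_mono)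
    then have "(cmod (deriv pre_schwarzian z - (pre_schwarzian z)\<^sup>2 / 2))\<^sup>2 \<le> (?S + a * ?w2 + d * (?w1 / ?r))\<^sup>2"
      by (intro power_mono) auto
    also have "\<dots> \<le> 3 * (?S\<^sup>2 + (a * ?w2)\<^sup>2 + (d * (?w1 / ?r))\<^sup>2)"
    proof -
      have "(x + y + t)\<^sup>2 \<le> 3 * (x\<^sup>2 + y\<^sup>2 + t\<^sup>2)" for x y t :: real
        using zero_le_power2[of "x - y"] zero_le_power2[of "x - t"] zero_le_power2[of "y - t"]
        by (simp add: power2_eq_square algebra_simps)
      then show ?thesis .
    qed
    also have "\<dots> = 3 * ?S\<^sup>2 + 3 * a\<^sup>2 * ?w2\<^sup>2 + 3 * d\<^sup>2 * ?w1\<^sup>2 / ?r\<^sup>2"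
      by (simp add: power_mult_distrib power_divide algebra_simps)
    finally have "(cmod (deriv pre_schwarzian z - (pre_schwarzian z)\<^sup>2 / 2))\<^sup>2 * ?r powr (2 + p)
       \<le> (3 * ?S\<^sup>2 + 3 * a\<^sup>2 * ?w2\<^sup>2 + 3 * d\<^sup>2 * ?w1\<^sup>2 / ?r\<^sup>2) * ?r powr (2 + p)"
      by (rule mult_right_mono) simp
    also have "\<dots> = 3 * (?S\<^sup>2 * ?r powr (2 + p)) + 3 * a\<^sup>2 * (?w2\<^sup>2 * ?r powr (2 + p)) + 3 * d\<^sup>2 * (?w1\<^sup>2 * (?r powr (2 + p) / ?r\<^sup>2))"
      by (simp add: algebra_simps)
    also have "?r powr (2 + p) / ?r\<^sup>2 = ?r powr p" using r(1) by (simp add: powr_add)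
    finally show "(cmod (deriv pre_schwarzian z - (pre_schwarzian z)\<^sup>2 / 2))\<^sup>2 * ?r powr (2 + p)
     \<le> 3 * (?S\<^sup>2 * ?r powr (2 + p)) + 3 * a\<^sup>2 * (?w2\<^sup>2 * ?r powr (2 + p)) + 3 * d\<^sup>2 * (?w1\<^sup>2 * ?r powr p)" .
  qed (auto simp: a0)
qed

lemma continuous_on_schwarzian: "continuous_on (ball 0 1) (schwarzian h g)"
proof -
  have "smooth_on (ball 0 1) (\<lambda>z. of_real (log_jac h g z))" by (rule smooth_on_log_jac[OF h g jac_pos])
  then have "wirt_iter [True, True] (\<lambda>z. of_real (log_jac h g z)) differentiable_on ball 0 1"
    "wirt_iter [True] (\<lambda>z. of_real (log_jac h g z)) differentiable_on ball 0 1"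
    unfolding smooth_on_def by blast+
  then show ?thesis
    unfolding schwarzian_def[abs_def]
    by (intro continuous_intros) (auto dest!: differentiable_imp_continuous_on)
qed

lemma log_jac_in_Qt_p0:
  assumes p: "0 < p" "p \<le> 1"
    and inj: "inj_on (\<lambda>z. h z + lam * g z) (ball 0 1)"
    and bnd: "\<And>z. z \<in> ball 0 1 \<Longrightarrow> cmod (h z + lam * g z) \<le> B"
    and vw: "vanishing p (\<lambda>z. (cmod (deriv w z))\<^sup>2 * (1 - (cmod z)\<^sup>2) powr p)"
    and vS: "vanishing p (\<lambda>z. (cmod (schwarzian h g z))\<^sup>2 * (1 - (cmod z)\<^sup>2) powr (2 + p))"
  shows "Qt_p0 p (\<lambda>z. of_real (log_jac h g z))"
proof -
  have w': "deriv w holomorphic_on ball 0 1" by (rule holomorphic_deriv[OF dil_holomorphic open_ball])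
  have w'': "deriv (deriv w) holomorphic_on ball 0 1" by (rule holomorphic_deriv[OF w' open_ball])
  have y': "deriv pre_schwarzian holomorphic_on ball 0 1" by (rule holomorphic_deriv[OF pre_schwarzian_holomorphic open_ball])
  obtain C where C: "\<And>z. z \<in> ball 0 1 \<Longrightarrow> cmod (pre_schwarzian z) * (1 - cmod z) \<le> C"
    using injective_pre_schwarzian_bound shear_holomorphic inj unfolding pre_schwarzian_def by metis
  obtain A D where AD: "0 \<le> A" "0 \<le> D" "\<And>z. z \<in> ball 0 1 \<Longrightarrow>
     (cmod (deriv pre_schwarzian z - (pre_schwarzian z)\<^sup>2 / 2))\<^sup>2 * (1 - (cmod z)\<^sup>2) powr (2 + p)
     \<le> 3 * ((cmod (schwarzian h g z))\<^sup>2 * (1 - (cmod z)\<^sup>2) powr (2 + p))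
       + A * ((cmod (deriv (deriv w) z))\<^sup>2 * (1 - (cmod z)\<^sup>2) powr (2 + p))
       + D * ((cmod (deriv w z))\<^sup>2 * (1 - (cmod z)\<^sup>2) powr p)"
    using shear_schwarzian_bound[OF C] by metis
  have cS: "continuous_on (ball 0 1) (\<lambda>z. (cmod (schwarzian h g z))\<^sup>2 * (1 - (cmod z)\<^sup>2) powr (2 + p))"
    by (intro continuous_on_mult continuous_on_power continuous_on_norm continuous_on_schwarzian continuous_on_rho_powr)
  have cw: "continuous_on (ball 0 1) (\<lambda>z. (cmod (deriv w z))\<^sup>2 * (1 - (cmod z)\<^sup>2) powr p)"
    and cw': "continuous_on (ball 0 1) (\<lambda>z. (cmod (deriv (deriv w) z))\<^sup>2 * (1 - (cmod z)\<^sup>2) powr (2 + p))"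
    and cy: "continuous_on (ball 0 1) (\<lambda>z. (cmod (pre_schwarzian z))\<^sup>2 * (1 - (cmod z)\<^sup>2) powr p)"
    by (intro continuous_on_mult continuous_on_holo_norm continuous_on_rho_powr w' w'' pre_schwarzian_holomorphic)+
  have vw': "vanishing p (\<lambda>z. (cmod (deriv (deriv w) z))\<^sup>2 * (1 - (cmod z)\<^sup>2) powr (2 + p))"
    by (rule vanishing_deriv[OF w' p(1) vw])
  have vP: "vanishing p (\<lambda>z. (cmod (deriv pre_schwarzian z - (pre_schwarzian z)\<^sup>2 / 2))\<^sup>2 * (1 - (cmod z)\<^sup>2) powr (2 + p))"
  proof (rule vanishing_mono[OF _ AD(3)])
    show "vanishing p (\<lambda>z. 3 * ((cmod (schwarzian h g z))\<^sup>2 * (1 - (cmod z)\<^sup>2) powr (2 + p))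
       + A * ((cmod (deriv (deriv w) z))\<^sup>2 * (1 - (cmod z)\<^sup>2) powr (2 + p))
       + D * ((cmod (deriv w z))\<^sup>2 * (1 - (cmod z)\<^sup>2) powr p))"
      by (rule vanishing_add[OF vanishing_add[OF vanishing_cmult[OF vS cS] _ vanishing_cmult[OF vw' cw' AD(1)]] _ vanishing_cmult[OF vw cw AD(2)]])
        (auto intro!: continuous_on_add continuous_on_mult[OF continuous_on_const] cS cw cw')
  qed
  have hP: "(\<lambda>z. deriv pre_schwarzian z - (pre_schwarzian z)\<^sup>2 / 2) holomorphic_on ball 0 1"
    by (intro holomorphic_intros y' pre_schwarzian_holomorphic) auto
  have little: "\<exists>r<1. \<forall>z. r < cmod z \<longrightarrow> cmod z < 1 \<longrightarrow> cmod (pre_schwarzian z) * (1 - cmod z) < e" if e: "0 < e" for e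
  proof (rule riccati_little[OF deriv_shear_holomorphic deriv_shear_nonzero _ _ _ e])
    show "cmod (deriv (\<lambda>z. h z + lam * g z) z) * (1 - cmod z) \<le> 2 * B" if "z \<in> ball 0 1" for z
      by (rule cauchy_deriv_bound[OF shear_holomorphic bnd that])
    show "\<exists>r<1. \<forall>z. r < cmod z \<longrightarrow> cmod z < 1 \<longrightarrow> cmod (deriv pre_schwarzian z - (pre_schwarzian z)\<^sup>2 / 2) * (1 - cmod z)\<^sup>2 < e" if "0 < e" for e
      using vanishing_imp_little[OF hP p(1) vP that] by metis
  qed (simp_all add: pre_schwarzian_def)
  have vy: "vanishing p (\<lambda>z. (cmod (pre_schwarzian z))\<^sup>2 * (1 - (cmod z)\<^sup>2) powr p)"
  proof (rule vanishing_of_riccati[OF pre_schwarzian_holomorphic p _ vP])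
    fix e :: real assume e: "0 < e"
    obtain r where r: "r < 1" "\<And>z. r < cmod z \<Longrightarrow> cmod z < 1 \<Longrightarrow> cmod (pre_schwarzian z) * (1 - cmod z) < sqrt e / 2"
      using little[of "sqrt e / 2"] e by auto
    have "(cmod (pre_schwarzian z))\<^sup>2 * (1 - (cmod z)\<^sup>2)\<^sup>2 \<le> e" if z: "r < cmod z" "cmod z < 1" for z
    proof -
      have "1 - (cmod z)\<^sup>2 = (1 - cmod z) * (1 + cmod z)" by (simp add: power2_eq_square algebra_simps)
      also have "\<dots> \<le> (1 - cmod z) * 2" using z by (intro mult_left_mono) auto
      finally have "cmod (pre_schwarzian z) * (1 - (cmod z)\<^sup>2) \<le> cmod (pre_schwarzian z) * ((1 - cmod z) * 2)" by (rule mult_left_mono) simp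
      also have "\<dots> \<le> sqrt e" using r(2)[OF z] by argo
      finally have "(cmod (pre_schwarzian z) * (1 - (cmod z)\<^sup>2))\<^sup>2 \<le> (sqrt e)\<^sup>2"
        using one_minus_norm_sq(1)[of z] z by (intro power_mono) auto
      then show ?thesis using e by (simp add: power_mult_distrib)
    qed
    then show "\<exists>r<1. \<forall>z. r < cmod z \<longrightarrow> cmod z < 1 \<longrightarrow> (cmod (pre_schwarzian z))\<^sup>2 * (1 - (cmod z)\<^sup>2)\<^sup>2 \<le> e"
      using r(1) by blast
  qed
  \<comment> \<open>|F_z| and |F_zbar| are equal, so the squared sum costs a factor 4; splitting y -
    w' A costs another 2, and |A| <= 2/(1 - k).\<close>
  define E where "E = 8 * (2 / (1 - k))\<^sup>2"
  have E0: "0 \<le> E" by (simp add: E_def)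
  have "vanishing p (\<lambda>z. 8 * ((cmod (pre_schwarzian z))\<^sup>2 * (1 - (cmod z)\<^sup>2) powr p) + E * ((cmod (deriv w z))\<^sup>2 * (1 - (cmod z)\<^sup>2) powr p))"
    by (rule vanishing_add[OF vanishing_cmult[OF vy cy] _ vanishing_cmult[OF vw cw E0]])
      (auto intro!: continuous_on_mult[OF continuous_on_const] cy cw)
  then have "vanishing p (\<lambda>z. (cmod (dz (\<lambda>z. of_real (log_jac h g z)) z) + cmod (dzbar (\<lambda>z. of_real (log_jac h g z)) z))\<^sup>2 * (1 - (cmod z)\<^sup>2) powr p)"
  proof (rule vanishing_mono)
    fix z :: complex assume z: "z \<in> ball 0 1"
    let ?r = "(1 - (cmod z)\<^sup>2) powr p"
    have "cmod (pre_schwarzian z - deriv w z * dil_correction z) \<le> cmod (pre_schwarzian z) + cmod (deriv w z) * (2 / (1 - k))"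
      by (rule order_trans[OF norm_triangle_ineq4])
        (use mult_left_mono[OF dil_correction_bound[OF z], of "cmod (deriv w z)"] in \<open>simp add: norm_mult\<close>)
    then have "(cmod (pre_schwarzian z - deriv w z * dil_correction z))\<^sup>2 \<le> (cmod (pre_schwarzian z) + cmod (deriv w z) * (2 / (1 - k)))\<^sup>2"
      by (rule power_mono) simp
    also have "\<dots> \<le> 2 * ((cmod (pre_schwarzian z))\<^sup>2 + (cmod (deriv w z) * (2 / (1 - k)))\<^sup>2)"
    proof -
      have "(x + y)\<^sup>2 \<le> 2 * (x\<^sup>2 + y\<^sup>2)" for x y :: real
        using zero_le_power2[of "x - y"] by (simp add: power2_eq_square algebra_simps)
      then show ?thesis .
    qed
    finally have "4 * (cmod (pre_schwarzian z - deriv w z * dil_correction z))\<^sup>2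
        \<le> 8 * (cmod (pre_schwarzian z))\<^sup>2 + 8 * (cmod (deriv w z) * (2 / (1 - k)))\<^sup>2"
      by argo
    also have "8 * (cmod (deriv w z) * (2 / (1 - k)))\<^sup>2 = E * (cmod (deriv w z))\<^sup>2"
      unfolding E_def power_mult_distrib by (simp only: mult_ac)
    finally have "4 * (cmod (pre_schwarzian z - deriv w z * dil_correction z))\<^sup>2
        \<le> 8 * (cmod (pre_schwarzian z))\<^sup>2 + E * (cmod (deriv w z))\<^sup>2" .
    then have "4 * (cmod (pre_schwarzian z - deriv w z * dil_correction z))\<^sup>2 * ?r \<le> (8 * (cmod (pre_schwarzian z))\<^sup>2 + E * (cmod (deriv w z))\<^sup>2) * ?r"
      by (rule mult_right_mono) simp
    then show "(cmod (dz (\<lambda>z. of_real (log_jac h g z)) z) + cmod (dzbar (\<lambda>z. of_real (log_jac h g z)) z))\<^sup>2 * ?r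
      \<le> 8 * ((cmod (pre_schwarzian z))\<^sup>2 * ?r) + E * ((cmod (deriv w z))\<^sup>2 * ?r)"
      unfolding dz_log_jac[OF z] complex_mod_cnj by (simp add: algebra_simps)
  qed
  then show ?thesis
    unfolding Qt_p0_def tends_zero_disc_auto_iff
    using smooth_on_log_jac[OF h g jac_pos] by simp
qed

end

theorem theorem5:
  fixes p :: real and h g :: "complex \<Rightarrow> complex" and lam :: complex
  assumes "0 < p" and "p \<le> 1"
    and "h holomorphic_on ball 0 1" and "g holomorphic_on ball 0 1"
    and "h 0 = 0" and "g 0 = 0"
    and "\<forall>z\<in>ball 0 1. deriv h z \<noteq> 0"
    and "\<forall>z\<in>ball 0 1. cmod (dil h g z) < 1"
    and "inj_on (\<lambda>z. h z + cnj (g z)) (ball 0 1)"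
    and "Q_p0 p (dil h g)"
    and "(SUP z\<in>ball 0 1. cmod (dil h g z)) < 1"
    and "cmod lam = 1"
    and "(\<lambda>z. h z + lam * g z) holomorphic_on ball 0 1"
    and "inj_on (\<lambda>z. h z + lam * g z) (ball 0 1)"
    and "jordan_boundary (\<lambda>z. h z + lam * g z)"
    and "vanishing_carleson p (density lborel (\<lambda>z. indicator (ball 0 1) z *
           ennreal ((cmod (schwarzian h g z))\<^sup>2 * (1 - (cmod z)\<^sup>2) powr (2 + p))))"
  shows "Qt_p0 p (\<lambda>z. complex_of_real (log_jac h g z))"
proof -
  define k where "k = (SUP z\<in>ball 0 1. cmod (dil h g z))"
  have wk: "cmod (dil h g z) \<le> k" if "z \<in> ball 0 1" for z
    unfolding k_def
  proof (rule cSUP_upper[OF that])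
    \<comment> \<open>A real supremum bounds its set only if that set is bounded above; the
      pointwise bound |w| < 1 provides this.\<close>
    show "bdd_above ((\<lambda>z. cmod (dil h g z)) ` ball 0 1)"
      using assms(8) by (intro bdd_aboveI2[of _ _ 1]) (auto intro: less_imp_le)
  qed
  have k1: "k < 1" using assms(11) by (simp add: k_def)
  obtain B where B: "\<And>z. z \<in> ball 0 1 \<Longrightarrow> cmod (h z + lam * g z) \<le> B"
    using jordan_boundary_bounded[OF assms(15)] by blast
  have h0: "\<And>z. z \<in> ball 0 1 \<Longrightarrow> deriv h z \<noteq> 0" using assms(7) by blast
  have vw: "vanishing p (\<lambda>z. (cmod (deriv (dil h g) z))\<^sup>2 * (1 - (cmod z)\<^sup>2) powr p)"
    using assms(10) unfolding Q_p0_def tends_zero_disc_auto_iff by simp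
  have "continuous_on (ball 0 1) (\<lambda>z. (cmod (schwarzian h g z))\<^sup>2 * (1 - (cmod z)\<^sup>2) powr (2 + p))"
    by (intro continuous_on_mult continuous_on_power continuous_on_norm continuous_on_rho_powr
        continuous_on_schwarzian[OF assms(3,4) h0 k1 wk assms(12)])
  then have vS: "vanishing p (\<lambda>z. (cmod (schwarzian h g z))\<^sup>2 * (1 - (cmod z)\<^sup>2) powr (2 + p))"
    by (rule vanishing_carleson_imp[OF assms(16)]) simp
  show ?thesis
    by (rule log_jac_in_Qt_p0[OF assms(3,4) h0 k1 wk assms(12,1,2,14) B vw vS])
qed

end
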